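(* Let $G_0=(\mathcal V,\mathcal E)$ be a graph with $\mathcal V\subset\mathbb R^d$, of finite local complexity, with a uniformly discrete vertex set of radius $r>0$, with bounded degree sequence $d_{\max}:=\sup_{v\in\mathcal V}d_{G_0}(v)<\infty$, and with maximal edge length $l_{\max}:=\sup\{|u-v|:\{u,v\}\in\mathcal E\}<\infty$. Let $X:=X_{\{G_0\}}$ be the associated dynamical system and let $\mu$ be an ergodic probability measure on $X$ such that $\varrho_\infty>0$ with respect to $\mu$. For $p\in[0,1]$ let $N$ be the integrated density of states of the Laplacian on bond-percolation graphs associated with $G_0$, with respect to the measure $\widehat\mu_p$. If $p\in\,]0,\frac1{d_{\max}-1}[$, then $$\lim_{E\downarrow0}\frac{\ln\bigl|\ln[N(E)-N(0)]\bigr|}{\ln E}=-\frac12 .$$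
   Context: Graphs $G=(\mathcal V_G,\mathcal E_G)$ are simple (no loops, no multiple edges), with countable $\mathcal V_G\subset\mathbb R^d$ and $\mathcal E_G$ a set of unordered pairs of distinct vertices; $d_G(v)$ is the degree of $v$. $B_s(x)$ is the open ball of radius $s$ about $x$, $B_s:=B_s(0)$. $\mathcal V_G$ is uniformly discrete of radius $r>0$ if every open ball of radius $r$ contains at most one vertex. For $x\in\mathbb R^d$, $x+G$ is the translated graph (vertices $x+v$, edges $\{x+v,x+w\}$). For Borel $B\subseteq\mathbb R^d$, $G\wedge B$ is the induced subgraph of $G$ on $\mathcal V_G\cap B$. A graph $G$ has finite local complexity if $\{(-v+G)\wedge B_s:v\in\mathcal V_G\}$ is finite for every $s>0$. Metric: $\mathrm{dist}(G,G'):=\min\{2^{-1/2},\inf\{\varepsilon>0:\exists x,y\in B_\varepsilon \text{ with }(x+G)\wedge B_{1/\varepsilon}=(y+G')\wedge B_{1/\varepsilon}\}\}$. $X=X_{\{G_0\}}$ is the completion of $\{x+G_0:x\in\mathbb R^d\}$ under this metric, realised as its closure in the space of graphs with locally finite vertex set in $\mathbb R^d$; $\mathbb R^d$ acts on it by translations. An ergodic probability measure is a Borel probability measure that is invariant and ergodic under this action. A mollifier is a continuous function $\psi:\mathbb R^d\to[0,\infty[$ supported in $B_r$ with $\int_{\mathbb R^d}\psi(x)\,dx=1$; fix one (the quantities below do not depend on the choice). Let $\mathcal V_{G,\infty}$ be the set of vertices of $G$ lying in infinite connected components of $G$, and $$\varrho_\infty:=\int_X d\mu(F)\sum_{v\in\mathcal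 V_{F,\infty}}\psi(v)$$ (this equals $\lim_{n\to\infty}|\mathcal V_{G,\infty}\cap B_n|/\mathrm{vol}(B_n)$ for $\mu$-a.e. $G\in X$). Percolation: for a graph $G$ let $\Omega_G:=\{0,1\}^{\mathcal E_G}$ with product $\sigma$-algebra and product measure $\mathbb P_G^p:=\bigotimes_{e\in\mathcal E_G}(p\,\delta_1+(1-p)\delta_0)$. For $\omega\in\Omega_G$, $G^{(\omega)}$ is the subgraph of $G$ with the same vertex set $\mathcal V_G$ and edge set $\{e\in\mathcal E_G:\omega_e=1\}$. The measure $\widehat\mu_p$ on pairs $G^{(\omega)}\equiv(G,\omega)$, $G\in X$, $\omega\in\Omega_G$, is given by $\int\phi\,d\widehat\mu_p=\int_Xd\mu(G)\int_{\Omega_G}d\mathbb P_G^p(\omega)\,\phi(G^{(\omega)})$. The graph Laplacian of a graph $G$ with bounded degrees is the bounded, self-adjoint, non-negative operator on $\ell^2(\mathcal V_G)$ given by $(\Delta_G\varphi)(v):=\sum_{w:\{v,w\}\in\mathcal E_G}[\varphi(v)-\varphi(w)]$. The Laplacian on bond-percolation graphs associated with $G_0$ is the map $G^{(\omega)}\mapsto\Delta_{G^{(\omega)}}$, and its integrated density of states is $$N(E):=\int_Xd\mu(G)\int_{\Omega_G}d\mathbb P^p_G(\omega)\sum_{v\in\mathcal V_G}\psi(v)\,\langle\delta_v,\Theta(E-\Delta_{G^{(\omega)}})\delta_v\rangle,\qquad E\in\mathbb R,$$ where $\Theta:=\chi_{[0,\infty[}$ is the right-continuous Heaviside function, $\Theta(E-\Delta)$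 is defined by functional calculus, and $(\delta_v)$ is the canonical basis. *)

theory Defs
  imports "HOL-Probability.Probability"
begin

section \<open>Graphs in Euclidean space\<close>

type_synonym 'a graph = "'a set \<times> 'a set set"

abbreviation verts :: "'a graph \<Rightarrow> 'a set" where "verts \<equiv> fst"
abbreviation edges :: "'a graph \<Rightarrow> 'a set set" where "edges \<equiv> snd"

definition simple_graph :: "'a graph \<Rightarrow> bool" where
  "simple_graph G \<longleftrightarrow>
     countable (verts G) \<and> edges G \<subseteq> {{u, v} |u v. u \<in> verts G \<and> v \<in> verts G \<and> u \<noteq> v}"

definition neighbours :: "'a graph \<Rightarrow> 'a \<Rightarrow> 'a set" where
  "neighbours G v = {w. {v, w} \<in> edges G}"

definition degree :: "'a graph \<Rightarrow> 'a \<Rightarrow> nat" where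
  "degree G v = card (neighbours G v)"

text \<open>Finiteness of the neighbourhoods is required separately because the cardinality of an
  infinite set is 0 by convention.\<close>

definition bounded_degrees :: "'a graph \<Rightarrow> bool" where
  "bounded_degrees G \<longleftrightarrow>
     (\<forall>v\<in>verts G. finite (neighbours G v)) \<and> bdd_above (degree G ` verts G)"

definition max_degree :: "'a graph \<Rightarrow> nat" where
  "max_degree G = (SUP v\<in>verts G. degree G v)"

definition bounded_edge_lengths :: "'a::euclidean_space graph \<Rightarrow> bool" where
  "bounded_edge_lengths G \<longleftrightarrow> bdd_above {norm (u - v) |u v. {u, v} \<in> edges G}"

definition uniformly_discrete :: "real \<Rightarrow> 'a::euclidean_space set \<Rightarrow> bool" where
  "uniformly_discrete r V \<longleftrightarrow>
     r > 0 \<and> (\<forall>x. \<forall>u\<in>V \<inter> ball x r. \<forall>v\<in>V \<inter> ball x r. u = v)"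

definition translate :: "'a::euclidean_space \<Rightarrow> 'a graph \<Rightarrow> 'a graph" where
  "translate x G = ((+) x ` verts G, (\<lambda>e. (+) x ` e) ` edges G)"

definition induced :: "'a graph \<Rightarrow> 'a set \<Rightarrow> 'a graph" where
  "induced G B = (verts G \<inter> B, {e \<in> edges G. e \<subseteq> B})"

definition finite_local_complexity :: "'a::euclidean_space graph \<Rightarrow> bool" where
  "finite_local_complexity G \<longleftrightarrow>
     (\<forall>s>0. finite {induced (translate (- v) G) (ball 0 s) |v. v \<in> verts G})"

definition infinite_cluster_verts :: "'a graph \<Rightarrow> 'a set" where
  "infinite_cluster_verts G =
     {v \<in> verts G. infinite {w. (v, w) \<in> {(a, b). {a, b} \<in> edges G}\<^sup>*}}"


section \<open>The space of graphs and the dynamical system of a graph\<close>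

definition agreement_radii :: "'a::euclidean_space graph \<Rightarrow> 'a graph \<Rightarrow> real set" where
  "agreement_radii G G' =
     {\<epsilon>. \<epsilon> > 0 \<and> (\<exists>x\<in>ball 0 \<epsilon>. \<exists>y\<in>ball 0 \<epsilon>.
        induced (translate x G) (ball 0 (1 / \<epsilon>)) = induced (translate y G') (ball 0 (1 / \<epsilon>)))}"

text \<open>Taking the infimum over the set enlarged by \<open>2 powr (- 1/2)\<close> gives the minimum of
  that number and the infimum of the set, where the infimum of the empty set is \<open>+\<infinity>\<close>.\<close>

definition graph_dist :: "'a::euclidean_space graph \<Rightarrow> 'a graph \<Rightarrow> real" where
  "graph_dist G G' = Inf (insert (2 powr (- 1/2)) (agreement_radii G G'))"

definition locally_finite_graphs :: "'a::euclidean_space graph set" where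
  "locally_finite_graphs = {G. simple_graph G \<and> (\<forall>s. finite (verts G \<inter> ball 0 s))}"

definition graph_topology :: "'a::euclidean_space graph topology" where
  "graph_topology = Metric_space.mtopology locally_finite_graphs graph_dist"

definition graph_hull :: "'a::euclidean_space graph \<Rightarrow> 'a graph set" where
  "graph_hull G\<^sub>0 = graph_topology closure_of (range (\<lambda>x. translate x G\<^sub>0))"

definition hull_borel :: "'a::euclidean_space graph \<Rightarrow> 'a graph measure" where
  "hull_borel G\<^sub>0 = sigma (graph_hull G\<^sub>0) {U. openin (subtopology graph_topology (graph_hull G\<^sub>0)) U}"

definition ergodic_measure :: "'a::euclidean_space graph \<Rightarrow> 'a graph measure \<Rightarrow> bool" where
  "ergodic_measure G\<^sub>0 \<mu> \<longleftrightarrow>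
     prob_space \<mu> \<and> space \<mu> = graph_hull G\<^sub>0 \<and> sets \<mu> = sets (hull_borel G\<^sub>0) \<and>
     (\<forall>x. distr \<mu> \<mu> (translate x) = \<mu>) \<and>
     (\<forall>B\<in>sets \<mu>. (\<forall>x. translate x ` B = B) \<longrightarrow> emeasure \<mu> B = 0 \<or> emeasure \<mu> B = 1)"

definition mollifier :: "real \<Rightarrow> ('a::euclidean_space \<Rightarrow> real) \<Rightarrow> bool" where
  "mollifier r \<psi> \<longleftrightarrow>
     continuous_on UNIV \<psi> \<and> (\<forall>x. \<psi> x \<ge> 0) \<and> (\<forall>x. x \<notin> ball 0 r \<longrightarrow> \<psi> x = 0) \<and>
     integral\<^sup>L lborel \<psi> = 1"

text \<open>The sums over vertices below have at most one nonzero term when \<open>\<psi>\<close> is a mollifier,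
  as all graphs in the hull inherit the uniform discreteness.\<close>

definition infinite_cluster_density ::
    "('a::euclidean_space \<Rightarrow> real) \<Rightarrow> 'a graph measure \<Rightarrow> real" where
  "infinite_cluster_density \<psi> \<mu> = (\<integral>F. (\<Sum>\<^sub>\<infinity>v\<in>infinite_cluster_verts F. \<psi> v) \<partial>\<mu>)"


section \<open>Bond percolation\<close>

definition percolation :: "real \<Rightarrow> 'a graph \<Rightarrow> ('a set \<Rightarrow> bool) measure" where
  "percolation p G = (\<Pi>\<^sub>M e\<in>edges G. measure_pmf (bernoulli_pmf p))"

definition open_subgraph :: "'a graph \<Rightarrow> ('a set \<Rightarrow> bool) \<Rightarrow> 'a graph" where
  "open_subgraph G \<omega> = (verts G, {e \<in> edges G. \<omega> e})"


section \<open>Operators on the space of square-summable functions on a set\<close>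

text \<open>Elements of the Hilbert space over \<open>V\<close> are represented by functions on the ambient type
  that vanish outside \<open>V\<close>; operators only matter on this carrier.\<close>

definition l2 :: "'a set \<Rightarrow> ('a \<Rightarrow> complex) set" where
  "l2 V = {\<phi>. (\<forall>v. v \<notin> V \<longrightarrow> \<phi> v = 0) \<and> (\<lambda>v. (cmod (\<phi> v))\<^sup>2) summable_on V}"

definition l2_inner :: "'a set \<Rightarrow> ('a \<Rightarrow> complex) \<Rightarrow> ('a \<Rightarrow> complex) \<Rightarrow> complex" where
  "l2_inner V \<phi> \<xi> = (\<Sum>\<^sub>\<infinity>v\<in>V. cnj (\<phi> v) * \<xi> v)"

definition l2_norm :: "'a set \<Rightarrow> ('a \<Rightarrow> complex) \<Rightarrow> real" where
  "l2_norm V \<phi> = sqrt (\<Sum>\<^sub>\<infinity>v\<in>V. (cmod (\<phi> v))\<^sup>2)"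

definition l2_bounded_op :: "'a set \<Rightarrow> (('a \<Rightarrow> complex) \<Rightarrow> ('a \<Rightarrow> complex)) \<Rightarrow> bool" where
  "l2_bounded_op V T \<longleftrightarrow>
     (\<forall>\<phi>\<in>l2 V. T \<phi> \<in> l2 V) \<and>
     (\<forall>\<phi>\<in>l2 V. \<forall>\<xi>\<in>l2 V. \<forall>a b. T (\<lambda>v. a * \<phi> v + b * \<xi> v) = (\<lambda>v. a * T \<phi> v + b * T \<xi> v)) \<and>
     (\<exists>C. \<forall>\<phi>\<in>l2 V. l2_norm V (T \<phi>) \<le> C * l2_norm V \<phi>)"

definition l2_orthogonal_projection ::
    "'a set \<Rightarrow> (('a \<Rightarrow> complex) \<Rightarrow> ('a \<Rightarrow> complex)) \<Rightarrow> bool" where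
  "l2_orthogonal_projection V T \<longleftrightarrow>
     l2_bounded_op V T \<and> (\<forall>\<phi>\<in>l2 V. T (T \<phi>) = T \<phi>) \<and>
     (\<forall>\<phi>\<in>l2 V. \<forall>\<xi>\<in>l2 V. l2_inner V \<xi> (T \<phi>) = l2_inner V (T \<xi>) \<phi>)"

text \<open>Weak countable additivity of projections implies strong countable additivity, and, by
  polarization, it suffices to require it for the diagonal matrix elements.\<close>

definition projection_valued_measure ::
    "'a set \<Rightarrow> (real set \<Rightarrow> ('a \<Rightarrow> complex) \<Rightarrow> ('a \<Rightarrow> complex)) \<Rightarrow> bool" where
  "projection_valued_measure V P \<longleftrightarrow>
     (\<forall>B\<in>sets borel. l2_orthogonal_projection V (P B)) \<and>
     (\<forall>\<phi>\<in>l2 V. P UNIV \<phi> = \<phi>) \<and>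
     (\<forall>\<phi>\<in>l2 V. \<forall>B :: nat \<Rightarrow> real set. range B \<subseteq> sets borel \<longrightarrow> disjoint_family B \<longrightarrow>
        (\<lambda>n. l2_inner V \<phi> (P (B n) \<phi>)) sums l2_inner V \<phi> (P (\<Union>n. B n) \<phi>))"

definition diagonal_measure ::
    "'a set \<Rightarrow> (real set \<Rightarrow> ('a \<Rightarrow> complex) \<Rightarrow> ('a \<Rightarrow> complex)) \<Rightarrow> ('a \<Rightarrow> complex) \<Rightarrow> real measure"
  where
  "diagonal_measure V P \<phi> =
     measure_of UNIV (sets borel) (\<lambda>B. ennreal (Re (l2_inner V \<phi> (P B \<phi>))))"

text \<open>\<open>P\<close> is the spectral measure of the bounded self-adjoint operator \<open>A\<close>.\<close>

definition spectral_measure_of ::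
    "'a set \<Rightarrow> (('a \<Rightarrow> complex) \<Rightarrow> ('a \<Rightarrow> complex)) \<Rightarrow>
     (real set \<Rightarrow> ('a \<Rightarrow> complex) \<Rightarrow> ('a \<Rightarrow> complex)) \<Rightarrow> bool" where
  "spectral_measure_of V A P \<longleftrightarrow>
     projection_valued_measure V P \<and>
     (\<exists>R. \<forall>\<phi>\<in>l2 V. P {-R..R} \<phi> = \<phi>) \<and>
     (\<forall>\<phi>\<in>l2 V. l2_inner V \<phi> (A \<phi>) = complex_of_real (\<integral>x. x \<partial>diagonal_measure V P \<phi>))"

text \<open>Bounded Borel functional calculus: \<open>f(A) = \<integral> f dP\<close> for the spectral measure \<open>P\<close> of \<open>A\<close>.
  On a complex Hilbert space the quadratic form determines the operator, so the choice
  is unique on the carrier.\<close>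

definition functional_calculus ::
    "'a set \<Rightarrow> (('a \<Rightarrow> complex) \<Rightarrow> ('a \<Rightarrow> complex)) \<Rightarrow> (real \<Rightarrow> real) \<Rightarrow>
     ('a \<Rightarrow> complex) \<Rightarrow> ('a \<Rightarrow> complex)" where
  "functional_calculus V A f =
     (SOME T. \<exists>P. spectral_measure_of V A P \<and> l2_bounded_op V T \<and>
        (\<forall>\<phi>\<in>l2 V. l2_inner V \<phi> (T \<phi>) = complex_of_real (\<integral>x. f x \<partial>diagonal_measure V P \<phi>)))"


section \<open>The integrated density of states\<close>

definition laplacian :: "'a graph \<Rightarrow> ('a \<Rightarrow> complex) \<Rightarrow> ('a \<Rightarrow> complex)" where
  "laplacian G \<phi> = (\<lambda>v. if v \<in> verts G then \<Sum>w\<in>neighbours G v. \<phi> v - \<phi> w else 0)"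

definition delta :: "'a \<Rightarrow> 'a \<Rightarrow> complex" where
  "delta v = indicator {v}"

definition heaviside :: "real \<Rightarrow> real" where
  "heaviside = indicator {0..}"

text \<open>The matrix elements are real because the operator is self-adjoint.\<close>

definition integrated_density_of_states ::
    "('a::euclidean_space \<Rightarrow> real) \<Rightarrow> 'a graph measure \<Rightarrow> real \<Rightarrow> real \<Rightarrow> real" where
  "integrated_density_of_states \<psi> \<mu> p E =
     (\<integral>G. (\<integral>\<omega>. (\<Sum>\<^sub>\<infinity>v\<in>verts G. \<psi> v *
        Re (l2_inner (verts G) (delta v)
          (functional_calculus (verts G) (laplacian (open_subgraph G \<omega>))
             (\<lambda>x. heaviside (E - x)) (delta v)))) \<partial>percolation p G) \<partial>\<mu>)"


section \<open>The distance is a metric\<close>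

text \<open>This makes \<open>graph_topology\<close> the topology of a genuine metric space.\<close>

lemma translate_translate: "translate x (translate y G) = translate (x + y) G"
  by (auto simp: translate_def image_image add.assoc)

lemma translate_0 [simp]: "translate 0 G = G"
  by (simp add: translate_def)

lemma verts_translate_induced:
  "translate z (induced G B) = induced (translate z G) ((+) z ` B)"
  by (auto simp: translate_def induced_def inj_image_subset_iff)

lemma induced_induced: "C \<subseteq> B \<Longrightarrow> induced (induced G B) C = induced G C"
  by (auto simp: induced_def)

lemma agreement_radiiI:
  assumes "\<epsilon> > 0" "norm x < \<epsilon>" "norm y < \<epsilon>"
    "induced (translate x G) (ball 0 (1 / \<epsilon>)) = induced (translate y G') (ball 0 (1 / \<epsilon>))"
  shows "\<epsilon> \<in> agreement_radii G G'"
proof -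
  have "x \<in> ball 0 \<epsilon>" "y \<in> ball 0 \<epsilon>" using assms(2,3) by simp_all
  then show ?thesis
    unfolding agreement_radii_def by (intro CollectI conjI bexI assms(1)) (rule assms(4))
qed

lemma agreement_radiiE:
  assumes "\<epsilon> \<in> agreement_radii G G'"
  obtains x y where "\<epsilon> > 0" "norm x < \<epsilon>" "norm y < \<epsilon>"
    "induced (translate x G) (ball 0 (1 / \<epsilon>)) = induced (translate y G') (ball 0 (1 / \<epsilon>))"
  using assms that unfolding agreement_radii_def mem_Collect_eq mem_ball_0 Bex_def by iprover

lemma agreement_radii_sym: "agreement_radii G G' = agreement_radii G' G"
proof -
  have "agreement_radii G G' \<subseteq> agreement_radii G' G" for G G' :: "'a::euclidean_space graph"
  proof
    fix \<epsilon> assume "\<epsilon> \<in> agreement_radii G G'"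
    then show "\<epsilon> \<in> agreement_radii G' G"
      by (rule agreement_radiiE) (rule agreement_radiiI, assumption+, erule sym)
  qed
  then show ?thesis by (intro antisym)
qed

lemma agreement_radii_pos: "\<epsilon> \<in> agreement_radii G G' \<Longrightarrow> 0 < \<epsilon>"
  by (erule agreement_radiiE)

lemma bdd_below_agreement_radii: "bdd_below (insert (2 powr (- 1/2)) (agreement_radii G G'))"
  by (rule bdd_belowI[of _ 0]) (auto dest: agreement_radii_pos)

lemma graph_dist_le: "\<epsilon> \<in> agreement_radii G G' \<Longrightarrow> graph_dist G G' \<le> \<epsilon>"
  unfolding graph_dist_def by (intro cInf_lower bdd_below_agreement_radii insertI2)

lemma graph_dist_le_cutoff: "graph_dist G G' \<le> 2 powr (- 1/2)"
  unfolding graph_dist_def by (intro cInf_lower bdd_below_agreement_radii insertI1)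

lemma graph_dist_nonneg: "0 \<le> graph_dist G G'"
  unfolding graph_dist_def by (rule cInf_greatest) (auto dest: agreement_radii_pos)

lemma graph_dist_less_obtain:
  assumes "graph_dist G G' < c" "c \<le> 2 powr (- 1/2)"
  obtains \<epsilon> where "\<epsilon> \<in> agreement_radii G G'" "\<epsilon> < c"
proof -
  obtain \<epsilon> where "\<epsilon> \<in> insert (2 powr (- 1/2)) (agreement_radii G G')" "\<epsilon> < c"
    using cInf_lessD[OF insert_not_empty assms(1)[unfolded graph_dist_def]] by blast
  then show ?thesis using that assms(2) by auto
qed

lemma graph_dist_refl: "graph_dist G G = 0" for G :: "'a::euclidean_space graph"
proof -
  have "\<epsilon> \<in> agreement_radii G G" if "\<epsilon> > 0" for \<epsilon>
    by (rule agreement_radiiI[of _ 0 0]) (simp_all add: that)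
  then have "graph_dist G G \<le> \<epsilon>" if "\<epsilon> > 0" for \<epsilon>
    using that by (blast intro: graph_dist_le)
  then have "graph_dist G G \<le> 0" by (rule field_le_epsilon) simp
  with graph_dist_nonneg[of G G] show ?thesis by (rule antisym[rotated])
qed

lemma agreement_shift:
  assumes "induced G B = induced G' B" "(+) (- z) ` C \<subseteq> B"
  shows "induced (translate z G) C = induced (translate z G') C"
proof -
  have "C \<subseteq> (+) z ` B"
    using assms(2) by (force simp: image_subset_iff image_iff)
  moreover have "induced (translate z G) ((+) z ` B) = induced (translate z G') ((+) z ` B)"
    by (metis assms(1) verts_translate_induced)
  ultimately show ?thesis by (metis induced_induced)
qed

lemma agreement_radii_add:
  assumes e: "\<epsilon> \<in> agreement_radii G G'" and d: "\<delta> \<in> agreement_radii G' G''"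
    and le: "\<epsilon> + \<delta> \<le> 2 powr (- 1/2)"
  shows "\<epsilon> + \<delta> \<in> agreement_radii G G''"
proof -
  obtain x y where xy: "\<epsilon> > 0" "norm x < \<epsilon>" "norm y < \<epsilon>"
      "induced (translate x G) (ball 0 (1 / \<epsilon>)) = induced (translate y G') (ball 0 (1 / \<epsilon>))"
    using e by (rule agreement_radiiE)
  obtain y' z where yz: "\<delta> > 0" "norm y' < \<delta>" "norm z < \<delta>"
      "induced (translate y' G') (ball 0 (1 / \<delta>)) = induced (translate z G'') (ball 0 (1 / \<delta>))"
    using d by (rule agreement_radiiE)
  define s where "s = \<epsilon> + \<delta>"
  have "2 powr (- 1/2) \<le> (2::real) powr 0"
    by (intro powr_mono) auto
  then have s1: "0 < s" "s \<le> 1" using le xy yz by (auto simp: s_def)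
  have ineq: "1 / s + b \<le> 1 / a" if "0 < a" "0 < b" "s = a + b" for a b
  proof -
    have "a * s \<le> 1 * 1" using that s1 by (intro mult_mono) auto
    then have "b * (a * s) \<le> b * 1" using that by (intro mult_left_mono) auto
    then have "a + b * (a * s) \<le> s" using that by simp
    then show ?thesis using that s1 by (simp add: field_simps)
  qed
  have sub: "(+) (- t) ` ball 0 (1 / s) \<subseteq> ball 0 (1 / a)"
    if "norm t < b" "0 < a" "0 < b" "s = a + b" for t :: 'a and a b
  proof
    fix w assume "w \<in> (+) (- t) ` ball 0 (1 / s)"
    then obtain q where q: "w = - t + q" "norm q < 1 / s" by auto
    have "norm w \<le> norm t + norm q" using norm_triangle_ineq[of "- t" q] q by simp
    then show "w \<in> ball 0 (1 / a)" using ineq[OF that(2-4)] q that(1) by simp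
  qed
  have 1: "induced (translate y' (translate x G)) (ball 0 (1 / s)) =
      induced (translate y' (translate y G')) (ball 0 (1 / s))"
    by (rule agreement_shift[OF xy(4)], rule sub[OF yz(2) xy(1) yz(1)]) (simp add: s_def)
  have 2: "induced (translate y (translate y' G')) (ball 0 (1 / s)) =
      induced (translate y (translate z G'')) (ball 0 (1 / s))"
    by (rule agreement_shift[OF yz(4)], rule sub[OF xy(3) yz(1) xy(1)]) (simp add: s_def)
  have 3: "induced (translate (y' + x) G) (ball 0 (1 / s)) =
      induced (translate (y + z) G'') (ball 0 (1 / s))"
    using 1 2 by (simp add: translate_translate add.commute)
  have 4: "norm (y' + x) < s"
    using norm_triangle_ineq[of y' x] xy(2) yz(2) by (simp add: s_def)
  have 5: "norm (y + z) < s"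
    using norm_triangle_ineq[of y z] xy(3) yz(3) by (simp add: s_def)
  show ?thesis
    unfolding s_def[symmetric] by (rule agreement_radiiI[OF s1(1) 4 5 3])
qed

lemma graph_dist_triangle: "graph_dist G G'' \<le> graph_dist G G' + graph_dist G' G''"
proof (cases "graph_dist G G' + graph_dist G' G'' < 2 powr (- 1/2)")
  case False
  then show ?thesis using graph_dist_le_cutoff[of G G''] by linarith
next
  case True
  let ?a = "graph_dist G G'" and ?b = "graph_dist G' G''"
  have nn: "0 \<le> ?a" "0 \<le> ?b" by (auto simp: graph_dist_nonneg)
  define \<eta> where "\<eta> = 2 powr (- 1/2) - (?a + ?b)"
  have "\<eta> > 0" using True by (simp add: \<eta>_def)
  show ?thesis
  proof (rule field_le_epsilon)
    fix e :: real assume "e > 0"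
    define h where "h = min e \<eta> / 2"
    have h: "h > 0" "2 * h \<le> e" "2 * h \<le> \<eta>"
      using \<open>e > 0\<close> \<open>\<eta> > 0\<close> by (auto simp: h_def min_def)
    obtain \<epsilon> where \<epsilon>: "\<epsilon> \<in> agreement_radii G G'" "\<epsilon> < ?a + h"
      using graph_dist_less_obtain[of G G' "?a + h"] h nn by (auto simp: \<eta>_def)
    obtain \<delta> where \<delta>: "\<delta> \<in> agreement_radii G' G''" "\<delta> < ?b + h"
      using graph_dist_less_obtain[of G' G'' "?b + h"] h nn by (auto simp: \<eta>_def)
    have "\<epsilon> + \<delta> \<in> agreement_radii G G''"
      by (rule agreement_radii_add[OF \<epsilon>(1) \<delta>(1)]) (use \<epsilon> \<delta> h in \<open>simp add: \<eta>_def\<close>)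
    then show "graph_dist G G'' \<le> ?a + ?b + e"
      using graph_dist_le[of "\<epsilon> + \<delta>" G G''] \<epsilon> \<delta> h by linarith
  qed
qed

lemma graph_dist_zero_agree:
  assumes "graph_dist G G' = 0" "c > 0"
  obtains z \<epsilon> where "0 < \<epsilon>" "\<epsilon> < c" "norm z < 2 * \<epsilon>"
    "\<And>C. C \<subseteq> ball 0 (1 / \<epsilon> - \<epsilon>) \<Longrightarrow> induced (translate z G) C = induced G' C"
proof -
  obtain \<epsilon> where \<epsilon>: "\<epsilon> \<in> agreement_radii G G'" "\<epsilon> < min c (2 powr (- 1/2))"
    using graph_dist_less_obtain[of G G' "min c (2 powr (- 1/2))"] assms by auto
  obtain x y where xy: "\<epsilon> > 0" "norm x < \<epsilon>" "norm y < \<epsilon>"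
      "induced (translate x G) (ball 0 (1 / \<epsilon>)) = induced (translate y G') (ball 0 (1 / \<epsilon>))"
    using \<epsilon>(1) by (rule agreement_radiiE)
  have "induced (translate (x - y) G) C = induced G' C" if C: "C \<subseteq> ball 0 (1 / \<epsilon> - \<epsilon>)" for C
  proof -
    have "(+) (- (- y)) ` C \<subseteq> ball 0 (1 / \<epsilon>)"
    proof
      fix w assume "w \<in> (+) (- (- y)) ` C"
      then obtain q where q: "w = y + q" "q \<in> C" by auto
      then have "norm q < 1 / \<epsilon> - \<epsilon>" using C by auto
      then show "w \<in> ball 0 (1 / \<epsilon>)" using norm_triangle_ineq[of y q] q xy by simp
    qed
    from agreement_shift[OF xy(4) this] show ?thesis by (simp add: translate_translate)
  qed
  moreover have "norm (x - y) < 2 * \<epsilon>" using norm_triangle_ineq4[of x y] xy by linarith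
  ultimately show ?thesis using that \<epsilon> xy by auto
qed

lemma graph_dist_zero_subset:
  fixes G G' :: "'a::euclidean_space graph"
  assumes G: "simple_graph G" and G': "G' \<in> locally_finite_graphs" and 0: "graph_dist G G' = 0"
  shows "verts G \<subseteq> verts G'" "edges G \<subseteq> edges G'"
proof -
  have fin: "finite (verts G' \<inter> ball 0 s)" for s
    using G' by (simp add: locally_finite_graphs_def)
  have key: "u \<in> verts G' \<and> induced G (ball 0 R) = induced G' (ball 0 R)"
    if u: "u \<in> verts G" and R: "norm u + 2 \<le> R" for u R
  proof -
    let ?F = "verts G' \<inter> ball 0 R - {u}"
    obtain \<delta> where \<delta>: "\<delta> > 0" "\<And>v. v \<in> ?F \<Longrightarrow> \<delta> \<le> dist u v"
      using finite_set_avoid[of "verts G' \<inter> ball 0 R" u] fin[of R] by (auto simp: dist_commute)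
    define c where "c = min (\<delta> / 2) (1 / (R + 1))"
    have R2: "R \<ge> 2" using R norm_ge_zero[of u] by linarith
    have "c > 0" using \<delta> R2 by (simp add: c_def)
    then obtain z \<epsilon> where z: "0 < \<epsilon>" "\<epsilon> < c" "norm z < 2 * \<epsilon>"
      "\<And>C. C \<subseteq> ball 0 (1 / \<epsilon> - \<epsilon>) \<Longrightarrow> induced (translate z G) C = induced G' C"
      using graph_dist_zero_agree[OF 0] by metis
    have eR: "\<epsilon> < 1 / (R + 1)" using z by (simp add: c_def)
    then have "\<epsilon> * (R + 1) < 1" using R2 by (simp add: field_simps)
    then have "R + 1 < 1 / \<epsilon>" using z(1) by (simp add: field_simps)
    moreover have "1 / (R + 1) \<le> 1" using R2 by simp
    ultimately have le: "R \<le> 1 / \<epsilon> - \<epsilon>" "\<epsilon> \<le> 1" using eR by auto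
    then have agr: "induced (translate z G) (ball 0 R) = induced G' (ball 0 R)"
      by (intro z(4)) (auto simp: subset_ball)
    have "z + u \<in> ball 0 R" using norm_triangle_ineq[of z u] z le R by simp
    moreover have "z + u \<in> verts (translate z G)" using u by (simp add: translate_def)
    moreover have "verts (translate z G) \<inter> ball 0 R = verts G' \<inter> ball 0 R"
      using arg_cong[OF agr, of fst] by (simp add: induced_def)
    ultimately have zu: "z + u \<in> verts G' \<inter> ball 0 R" by blast
    have "dist u (z + u) < \<delta>" using z by (simp add: dist_norm c_def)
    then have "z + u = u" using \<delta>(2)[of "z + u"] zu by (meson DiffI not_le singletonD)
    then have "z = 0" by simp
    then have "induced G (ball 0 R) = induced G' (ball 0 R)" using agr by simp
    moreover have "u \<in> verts G'" using zu \<open>z = 0\<close> by simp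
    ultimately show ?thesis by blast
  qed
  show "verts G \<subseteq> verts G'" using key by blast
  show "edges G \<subseteq> edges G'"
  proof
    fix e assume e: "e \<in> edges G"
    then obtain u v where uv: "e = {u, v}" "u \<in> verts G"
      using G by (auto simp: simple_graph_def)
    define R where "R = norm u + norm v + 2"
    have "e \<in> edges (induced G (ball 0 R))"
      using e uv norm_ge_zero[of u] norm_ge_zero[of v]
      by (auto simp: induced_def R_def simp del: norm_ge_zero)
    moreover have "induced G (ball 0 R) = induced G' (ball 0 R)"
      using key[OF uv(2), of R] by (auto simp: R_def)
    ultimately have "e \<in> edges (induced G' (ball 0 R))" by simp
    then show "e \<in> edges G'" by (simp add: induced_def)
  qed
qed

lemma Metric_space_graph_dist: "Metric_space locally_finite_graphs graph_dist"
proof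
  fix G G' :: "'a graph"
  show "graph_dist G G' = graph_dist G' G"
    by (simp add: graph_dist_def agreement_radii_sym)
  assume "G \<in> locally_finite_graphs" "G' \<in> locally_finite_graphs"
  moreover have "graph_dist G G' = graph_dist G' G"
    by (simp add: graph_dist_def agreement_radii_sym)
  ultimately show "graph_dist G G' = 0 \<longleftrightarrow> G = G'"
    using graph_dist_zero_subset[of G G'] graph_dist_zero_subset[of G' G]
    by (auto simp: graph_dist_refl locally_finite_graphs_def intro!: prod_eqI)
qed (rule graph_dist_nonneg graph_dist_triangle)+

end

theory Submission
  imports Defs "HOL-Real_Asymp.Real_Asymp"
begin

text \<open>A nonzero eigenvalue of the Laplacian on a connected graph with \<open>n\<close> vertices is at least
  \<open>1 / (2 n\<^sup>2)\<close>, whereas a path with \<open>n\<close> vertices has the eigenvalue \<open>2 - 2 cos (\<pi> / n)\<close>. Hence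
  \<open>N E - N 0\<close> is bounded above by the probability that a cluster has at least of the order of
  \<open>1 / sqrt E\<close> vertices, which decays exponentially in the subcritical regime, and below by the
  probability that the cluster of a vertex of an infinite component of the graph is a path with about
  \<open>\<pi> / sqrt E\<close> vertices starting there. Both bounds are exponential in \<open>1 / sqrt E\<close>.

  Since the Bochner integral of a nonmeasurable function is 0, the integrands have to be shown to be
  measurable, including on the null set of configurations with infinite clusters. The spectral
  measure of \<open>\<delta>\<^sub>v\<close> is the solution of the Hausdorff moment problem for the moments
  \<open>\<langle>\<delta>\<^sub>v, \<Delta>\<^sup>k \<delta>\<^sub>v\<rangle>\<close>. These are local functions of the graph and of the configuration, so that
  measurability of all other spectral quantities follows by a functional monotone class argument.\<close>

subsection \<open>Integrals determined by their moments\<close>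

text \<open>The operator \<open>functional_calculus\<close> is picked by choice among all pairs of a
  spectral measure and a bounded operator, and a spectral measure is only asked to reproduce the
  quadratic form of the Laplacian, that is, the first moments. Two facts are therefore needed before
  anything can be computed: some spectral measure exists, which is built from the moment measures by
  polarization, and every other one has the same moments, because the form alone already determines
  all powers. The threshold for \<open>p\<close> enters in one place. A vertex reached through an
  open edge has at most \<open>d_max - 1\<close> edges left to reveal, so it leads to fewer than one
  further vertex on average, and this leaves room for an exponential weight on the size of the
  cluster. The constants in the two exponential bounds are far apart. This is harmless: after two
  logarithms both bounds are \<open>- 1/2 * ln E\<close> up to a bounded error.\<close>

definition bounded_borel :: "real \<Rightarrow> real \<Rightarrow> (real \<Rightarrow> real) \<Rightarrow> bool" where
  "bounded_borel a b f \<longleftrightarrow> f \<in> borel_measurable borel \<and> (\<exists>K. \<forall>x\<in>{a..b}. \<bar>f x\<bar> \<le> K)"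

lemma bounded_borelI:
  "f \<in> borel_measurable borel \<Longrightarrow> (\<And>x. x \<in> {a..b} \<Longrightarrow> \<bar>f x\<bar> \<le> K) \<Longrightarrow> bounded_borel a b f"
  unfolding bounded_borel_def by blast

lemma bounded_borelE:
  assumes "bounded_borel a b f"
  obtains K where "\<And>x. x \<in> {a..b} \<Longrightarrow> \<bar>f x\<bar> \<le> K"
  using assms unfolding bounded_borel_def by blast

lemma bounded_borel_measurable: "bounded_borel a b f \<Longrightarrow> f \<in> borel_measurable borel"
  by (simp add: bounded_borel_def)

lemma bounded_borel_mult:
  assumes "bounded_borel a b f" "bounded_borel a b g"
  shows "bounded_borel a b (\<lambda>x. f x * g x)"
proof -
  obtain K L where "\<And>x. x \<in> {a..b} \<Longrightarrow> \<bar>f x\<bar> \<le> K" "\<And>x. x \<in> {a..b} \<Longrightarrow> \<bar>g x\<bar> \<le> L"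
    using bounded_borelE[OF assms(1)] bounded_borelE[OF assms(2)] by metis
  then have "\<bar>f x * g x\<bar> \<le> \<bar>K\<bar> * \<bar>L\<bar>" if "x \<in> {a..b}" for x
    unfolding abs_mult using that by (intro mult_mono) force+
  with assms show ?thesis
    by (intro bounded_borelI[of _ _ _ "\<bar>K\<bar> * \<bar>L\<bar>"]) (auto simp: bounded_borel_def)
qed

lemma bounded_borel_linear:
  assumes "bounded_borel a b f" "bounded_borel a b g"
  shows "bounded_borel a b (\<lambda>x. c * f x + d * g x)"
proof -
  obtain K L where KL: "\<And>x. x \<in> {a..b} \<Longrightarrow> \<bar>f x\<bar> \<le> K" "\<And>x. x \<in> {a..b} \<Longrightarrow> \<bar>g x\<bar> \<le> L"
    using bounded_borelE[OF assms(1)] bounded_borelE[OF assms(2)] by metis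
  have "\<bar>c * f x + d * g x\<bar> \<le> \<bar>c\<bar> * K + \<bar>d\<bar> * L" if "x \<in> {a..b}" for x
  proof -
    have "\<bar>c * f x + d * g x\<bar> \<le> \<bar>c\<bar> * \<bar>f x\<bar> + \<bar>d\<bar> * \<bar>g x\<bar>"
      by (metis abs_mult abs_triangle_ineq)
    also have "\<dots> \<le> \<bar>c\<bar> * K + \<bar>d\<bar> * L" using KL that by (intro add_mono mult_left_mono) auto
    finally show ?thesis .
  qed
  then show ?thesis
    using assms by (intro bounded_borelI[of _ _ _ "\<bar>c\<bar> * K + \<bar>d\<bar> * L"]) (auto simp: bounded_borel_def)
qed

lemma bounded_borel_indicator: "B \<in> sets borel \<Longrightarrow> bounded_borel a b (indicator B)"
  by (rule bounded_borelI[of _ _ _ 1]) (auto simp: indicator_def)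

lemma bounded_borel_continuous:
  assumes "continuous_on UNIV f" shows "bounded_borel a b f"
proof -
  have "compact (f ` {a..b})"
    using assms by (intro compact_continuous_image continuous_on_subset[OF assms]) auto
  then have "bounded (f ` {a..b})" by (rule compact_imp_bounded)
  then obtain K where "\<And>x. x \<in> {a..b} \<Longrightarrow> \<bar>f x\<bar> \<le> K"
    unfolding bounded_iff by (metis image_eqI real_norm_def)
  moreover have "f \<in> borel_measurable borel" using assms by (rule borel_measurable_continuous_onI)
  ultimately show ?thesis by (rule bounded_borelI[rotated])
qed

lemma bounded_borel_power: "bounded_borel a b (\<lambda>x. x ^ k)"
  by (intro bounded_borel_continuous continuous_intros)

lemma bounded_borel_sum:
  assumes "finite I" "\<And>i. i \<in> I \<Longrightarrow> bounded_borel a b (f i)"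
  shows "bounded_borel a b (\<lambda>x. \<Sum>i\<in>I. c i * f i x)"
  using assms
proof (induction I rule: finite_induct)
  case empty
  show ?case by (rule bounded_borelI[of _ _ _ 0]) auto
next
  case (insert i I)
  then show ?case using bounded_borel_linear[of a b "f i" "\<lambda>x. \<Sum>i\<in>I. c i * f i x" "c i" 1] by simp
qed

text \<open>Boundedness is required on \<open>{a..b}\<close> only, so that monomials are admissible,
  and limits are tested only there. The predicate \<open>Q\<close> stays open because it is
  instantiated both by the equality of two functionals and by the measurability of an integral in a
  parameter.\<close>

locale monotone_class =
  fixes a b :: real and Q :: "(real \<Rightarrow> real) \<Rightarrow> bool"
  assumes linear: "\<And>f g c d. bounded_borel a b f \<Longrightarrow> bounded_borel a b g \<Longrightarrow> Q f \<Longrightarrow> Q g \<Longrightarrow>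
      Q (\<lambda>x. c * f x + d * g x)"
    and limit: "\<And>f g K. (\<And>n. bounded_borel a b (f n)) \<Longrightarrow> (\<And>n::nat. Q (f n)) \<Longrightarrow>
      bounded_borel a b g \<Longrightarrow> (\<And>n x. x \<in> {a..b} \<Longrightarrow> \<bar>f n x\<bar> \<le> K) \<Longrightarrow>
      (\<And>x. x \<in> {a..b} \<Longrightarrow> (\<lambda>n. f n x) \<longlonglongrightarrow> g x) \<Longrightarrow> Q g"
begin

lemma sum:
  assumes "finite I" "\<And>i. i \<in> I \<Longrightarrow> bounded_borel a b (f i) \<and> Q (f i)" "Q (\<lambda>x. 0)"
  shows "Q (\<lambda>x. \<Sum>i\<in>I. c i * f i x)"
  using assms
proof (induction I rule: finite_induct)
  case (insert i I)
  then show ?case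
    using linear[of "f i" "\<lambda>x. \<Sum>i\<in>I. c i * f i x" "c i" 1] bounded_borel_sum[of I a b f c] by simp
qed simp

text \<open>Rounding \<open>f\<close> down to multiples of \<open>1 / Suc n\<close> gives finite
  combinations of indicators that converge uniformly on the interval.\<close>

lemma from_indicators:
  assumes ind: "\<And>B. B \<in> sets borel \<Longrightarrow> Q (indicator B)" and f: "bounded_borel a b f"
  shows "Q f"
proof -
  obtain K where K: "\<And>x. x \<in> {a..b} \<Longrightarrow> \<bar>f x\<bar> \<le> K" and fm[measurable]: "f \<in> borel_measurable borel"
    using f unfolding bounded_borel_def by blast
  define B where "B n k = {x. \<lfloor>real (Suc n) * f x\<rfloor> = k}" for n :: nat and k :: int
  have B[measurable]: "B n k \<in> sets borel" for n k
    unfolding B_def by measurable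
  define I where "I n = {- \<lceil>real (Suc n) * K\<rceil> .. \<lceil>real (Suc n) * K\<rceil>}" for n
  define g where "g n x = (\<Sum>k\<in>I n. (k / real (Suc n)) * indicator (B n k) x)" for n x
  have gx: "g n x = \<lfloor>real (Suc n) * f x\<rfloor> / real (Suc n)" if x: "x \<in> {a..b}" for n x
  proof -
    have "\<bar>real (Suc n) * f x\<bar> \<le> real (Suc n) * K"
      unfolding abs_mult using K[OF x] by (intro mult_mono) auto
    then have "real (Suc n) * f x \<le> real (Suc n) * K" "- (real (Suc n) * K) \<le> real (Suc n) * f x"
      by (auto simp: abs_le_iff)
    moreover have "\<lfloor>- (real (Suc n) * K)\<rfloor> = - \<lceil>real (Suc n) * K\<rceil>"
      by (simp add: ceiling_def)
    ultimately have "\<lfloor>real (Suc n) * f x\<rfloor> \<in> I n"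
      unfolding I_def by (metis atLeastAtMost_iff floor_mono le_floor_iff ceiling_mono floor_le_ceiling order_trans)
    then have "g n x = (\<Sum>k\<in>{\<lfloor>real (Suc n) * f x\<rfloor>}. (k / real (Suc n)) * indicator (B n k) x)"
      unfolding g_def by (intro sum.mono_neutral_right) (auto simp: I_def B_def)
    then show ?thesis by (simp add: B_def)
  qed
  have close: "\<bar>g n x - f x\<bar> \<le> 1 / real (Suc n)" if "x \<in> {a..b}" for n x
  proof -
    have "\<bar>of_int \<lfloor>real (Suc n) * f x\<rfloor> - real (Suc n) * f x\<bar> \<le> 1" by linarith
    moreover have "g n x - f x = (of_int \<lfloor>real (Suc n) * f x\<rfloor> - real (Suc n) * f x) / real (Suc n)"
      unfolding gx[OF that] by (simp add: field_simps)
    ultimately show ?thesis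
      by (simp only: abs_divide) (simp add: divide_right_mono)
  qed
  have z: "Q (\<lambda>x. 0)"
    using ind[of "{}"] by (simp add: indicator_def[abs_def])
  have bg: "bounded_borel a b (g n)" for n
    unfolding g_def[abs_def] by (intro bounded_borel_sum bounded_borel_indicator B) (auto simp: I_def)
  have "Q (g n)" for n
    unfolding g_def[abs_def] using z by (intro sum conjI bounded_borel_indicator B ind) (auto simp: I_def)
  then show ?thesis
  proof (rule limit[OF bg _ f])
    fix n x assume x: "x \<in> {a..b}"
    have "1 / real (Suc n) \<le> 1" by simp
    then show "\<bar>g n x\<bar> \<le> K + 1" using close[OF x, of n] K[OF x] by linarith
  next
    fix x assume x: "x \<in> {a..b}"
    have "(\<lambda>n. g n x - f x) \<longlonglongrightarrow> 0"
      by (rule Lim_null_comparison[OF _ LIMSEQ_inverse_real_of_nat])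
         (use close[OF x] in \<open>auto simp: inverse_eq_divide\<close>)
    then show "(\<lambda>n. g n x) \<longlonglongrightarrow> f x" by (simp add: LIM_zero_iff)
  qed
qed

text \<open>Weierstrass approximation leads from monomials to continuous functions, piecewise linear
  ramps lead on to half-lines, and Dynkin's theorem to Borel sets; \<open>from_indicators\<close>
  does the rest.\<close>

lemma from_monomials:
  assumes mono: "\<And>k. Q (\<lambda>x. x ^ k)" and f: "bounded_borel a b f"
  shows "Q f"
proof -
  have z: "Q (\<lambda>x. 0)" using linear[OF bounded_borel_power bounded_borel_power mono mono, of 0 0 0 0] by simp
  have cont: "Q g" if g: "continuous_on UNIV g" for g
  proof -
    have "\<exists>h. (\<exists>c N. h = (\<lambda>x. \<Sum>i\<le>N. c i * x ^ i)) \<and> (\<forall>x\<in>{a..b}. \<bar>g x - h x\<bar> < 1 / real (Suc n))" for n :: nat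
    proof -
      have "compact {a..b}" "continuous_on {a..b} g" "(0::real) < 1 / real (Suc n)"
        using g by (auto intro: continuous_on_subset)
      then obtain h where "real_polynomial_function h" "\<And>x. x \<in> {a..b} \<Longrightarrow> \<bar>g x - h x\<bar> < 1 / real (Suc n)"
        using Stone_Weierstrass_real_polynomial_function by blast
      then show ?thesis using real_polynomial_function_imp_sum by metis
    qed
    then obtain h where h: "\<And>n. \<exists>c N. h n = (\<lambda>x. \<Sum>i\<le>N. c i * x ^ i)"
        "\<And>n x. x \<in> {a..b} \<Longrightarrow> \<bar>g x - h n x\<bar> < 1 / real (Suc n)" by metis
    have bh: "bounded_borel a b (h n) \<and> Q (h n)" for n
    proof -
      obtain c N where "h n = (\<lambda>x. \<Sum>i\<le>N. c i * x ^ i)" using h(1) by blast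
      then show ?thesis
        using z by (auto intro!: sum bounded_borel_sum bounded_borel_power mono)
    qed
    obtain K where K: "\<And>x. x \<in> {a..b} \<Longrightarrow> \<bar>g x\<bar> \<le> K"
      using bounded_borelE[OF bounded_borel_continuous[OF g]] by metis
    show "Q g"
    proof (rule limit[of h g "K + 1"])
      fix n x assume x: "x \<in> {a..b}"
      have "1 / real (Suc n) \<le> 1" by simp
      then show "\<bar>h n x\<bar> \<le> K + 1" using h(2)[OF x, of n] K[OF x] by linarith
    next
      fix x assume x: "x \<in> {a..b}"
      have "(\<lambda>n. h n x - g x) \<longlonglongrightarrow> 0"
        by (rule Lim_null_comparison[OF _ LIMSEQ_inverse_real_of_nat])
           (use h(2)[OF x] in \<open>auto simp: inverse_eq_divide abs_minus_commute less_imp_le\<close>)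
      then show "(\<lambda>n. h n x) \<longlonglongrightarrow> g x" by (simp add: LIM_zero_iff)
    qed (use bh g in \<open>auto intro: bounded_borel_continuous\<close>)
  qed
  \<comment> \<open>For positive \<open>n\<close> the ramp is 1 up to \<open>c\<close> and 0 from
    \<open>c + 1 / n\<close> on.\<close>
  have half: "Q (indicator {..c})" for c
  proof (rule limit[of "\<lambda>n x. max 0 (min 1 (1 - real n * (x - c)))" _ 1])
    fix x :: real
    show "(\<lambda>n. max 0 (min 1 (1 - real n * (x - c)))) \<longlonglongrightarrow> indicator {..c} x"
    proof (cases "x \<le> c")
      case True
      then have "real n * (x - c) \<le> 0" for n by (simp add: mult_nonneg_nonpos)
      then have "max 0 (min 1 (1 - real n * (x - c))) = 1" for n
        by (smt (verit))
      then show ?thesis using True by simp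
    next
      case False
      obtain N where N: "1 / (x - c) < real N" using reals_Archimedean2 by blast
      have "max 0 (min 1 (1 - real n * (x - c))) = 0" if "n \<ge> N" for n
      proof -
        have "1 < real N * (x - c)" using N False by (simp add: field_simps)
        also have "\<dots> \<le> real n * (x - c)" using that False by (intro mult_right_mono) auto
        finally show ?thesis by simp
      qed
      then have "eventually (\<lambda>n. max 0 (min 1 (1 - real n * (x - c))) = 0) sequentially"
        by (auto simp: eventually_sequentially)
      then show ?thesis using False by (simp add: tendsto_eventually)
    qed
  qed (auto intro!: cont bounded_borel_continuous bounded_borel_indicator continuous_intros)
  have ind: "Q (indicator B)" if "B \<in> sets borel" for B
  proof -
    have "Int_stable (range (\<lambda>c::real. {..c}))" by (auto simp: Int_stable_def)
    moreover have "range (\<lambda>c::real. {..c}) \<subseteq> Pow UNIV" by simp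
    moreover have "B \<in> sigma_sets UNIV (range (\<lambda>c::real. {..c}))"
      using that unfolding borel_eq_atMost by (simp add: sets_measure_of)
    ultimately show ?thesis
    proof (induction rule: sigma_sets_induct_disjoint)
      case (basic A) then show ?case using half by auto
    next
      case empty then show ?case using z by (simp add: indicator_def[abs_def])
    next
      case (compl A)
      then have A: "A \<in> sets borel" unfolding borel_eq_atMost by (simp add: sets_measure_of)
      have "Q (\<lambda>x. 1 * x ^ 0 + (- 1) * indicator A x)"
        using compl mono[of 0] A by (intro linear bounded_borel_indicator bounded_borel_power) auto
      moreover have "(\<lambda>x. 1 * x ^ 0 + (- 1) * indicator A x) = indicator (UNIV - A)"
        by (auto simp: indicator_def)
      ultimately show ?case by simp
    next
      case (union A)
      then have A: "A i \<in> sets borel" for i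
        unfolding borel_eq_atMost by (auto simp: sets_measure_of)
      show ?case
      proof (rule limit[of "\<lambda>n x. \<Sum>i<n. 1 * indicator (A i) x" _ 1])
        fix n x
        have "(\<Sum>i<n. indicator (A i) x) = (indicator (\<Union>i<n. A i) x :: real)"
          using union(1) by (subst indicator_UN_disjoint) (auto simp: disjoint_family_on_def)
        then show "\<bar>\<Sum>i<n. 1 * indicator (A i) x\<bar> \<le> (1::real)" by (simp add: indicator_def)
      next
        fix x
        show "(\<lambda>n. \<Sum>i<n. 1 * indicator (A i) x) \<longlonglongrightarrow> (indicator (\<Union>i. A i) x :: real)"
        proof (cases "\<exists>i. x \<in> A i")
          case True
          then obtain j where j: "x \<in> A j" by blast
          then have "(\<lambda>i. indicator (A i) x) = (\<lambda>i. if i = j then (1::real) else 0)"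
            using union(1) by (auto simp: fun_eq_iff indicator_def disjoint_family_on_def)
          then have "(\<lambda>i. indicator (A i) x) sums (1::real)" using sums_single[of j "\<lambda>_. 1::real"] by simp
          then show ?thesis using j by (auto simp: sums_def indicator_def)
        qed (simp add: indicator_def)
      qed (use A union z in \<open>auto intro!: sum[of _ _ "\<lambda>_. 1", simplified] bounded_borel_sum[of _ _ _ _ "\<lambda>_. 1", simplified] bounded_borel_indicator\<close>)
    qed
  qed
  show ?thesis using from_indicators[OF ind f] by simp
qed

end

text \<open>The properties of a complex combination of integrals over \<open>{a..b}\<close> that make it determined by
  its moments.\<close>

definition integral_like :: "real \<Rightarrow> real \<Rightarrow> ((real \<Rightarrow> real) \<Rightarrow> complex) \<Rightarrow> bool" where
  "integral_like a b \<Lambda> \<longleftrightarrow>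
     (\<forall>f g c d. bounded_borel a b f \<longrightarrow> bounded_borel a b g \<longrightarrow>
        \<Lambda> (\<lambda>x. c * f x + d * g x) = of_real c * \<Lambda> f + of_real d * \<Lambda> g) \<and>
     (\<forall>f g K. (\<forall>n. bounded_borel a b (f n)) \<longrightarrow> bounded_borel a b g \<longrightarrow>
        (\<forall>n. \<forall>x\<in>{a..b}. \<bar>f n x\<bar> \<le> K) \<longrightarrow> (\<forall>x\<in>{a..b}. (\<lambda>n. f n x) \<longlonglongrightarrow> g x) \<longrightarrow>
        (\<lambda>n. \<Lambda> (f n)) \<longlonglongrightarrow> \<Lambda> g)"

lemma integral_like_linear:
  "integral_like a b \<Lambda> \<Longrightarrow> bounded_borel a b f \<Longrightarrow> bounded_borel a b g \<Longrightarrow>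
    \<Lambda> (\<lambda>x. c * f x + d * g x) = of_real c * \<Lambda> f + of_real d * \<Lambda> g"
  by (simp add: integral_like_def)

lemma integral_like_limit:
  assumes "integral_like a b \<Lambda>" "\<And>n. bounded_borel a b (f n)" "bounded_borel a b g"
    "\<And>n x. x \<in> {a..b} \<Longrightarrow> \<bar>f n x\<bar> \<le> K" "\<And>x. x \<in> {a..b} \<Longrightarrow> (\<lambda>n. f n x) \<longlonglongrightarrow> g x"
  shows "(\<lambda>n. \<Lambda> (f n)) \<longlonglongrightarrow> \<Lambda> g"
  using assms unfolding integral_like_def by blast

text \<open>The constant sequence \<open>f\<close> converges to \<open>g\<close> on the interval, so
  the limit property already shows that such a functional only sees values on
  \<open>{a..b}\<close>.\<close>

lemma integral_like_cong:
  assumes "integral_like a b \<Lambda>" "bounded_borel a b f" "bounded_borel a b g" "\<And>x. x \<in> {a..b} \<Longrightarrow> f x = g x"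
  shows "\<Lambda> f = \<Lambda> g"
proof -
  obtain K where "\<And>x. x \<in> {a..b} \<Longrightarrow> \<bar>f x\<bar> \<le> K" using bounded_borelE[OF assms(2)] by metis
  then have "(\<lambda>n::nat. \<Lambda> f) \<longlonglongrightarrow> \<Lambda> g"
    by (intro integral_like_limit[OF assms(1), of "\<lambda>n. f" g K]) (use assms in auto)
  then show ?thesis using LIMSEQ_unique tendsto_const by blast
qed

lemma monotone_class_eq:
  assumes "integral_like a b \<Lambda>" "integral_like a b \<Lambda>'"
  shows "monotone_class a b (\<lambda>f. \<Lambda> f = \<Lambda>' f)"
proof
  fix f g :: "real \<Rightarrow> real" and c d
  assume "bounded_borel a b f" "bounded_borel a b g" "\<Lambda> f = \<Lambda>' f" "\<Lambda> g = \<Lambda>' g"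
  then show "\<Lambda> (\<lambda>x. c * f x + d * g x) = \<Lambda>' (\<lambda>x. c * f x + d * g x)"
    by (simp add: integral_like_linear[OF assms(1)] integral_like_linear[OF assms(2)])
next
  fix f g K
  assume *: "\<And>n. bounded_borel a b (f n)" "\<And>n::nat. \<Lambda> (f n) = \<Lambda>' (f n)" "bounded_borel a b g"
    "\<And>n x. x \<in> {a..b} \<Longrightarrow> \<bar>f n x\<bar> \<le> K" "\<And>x. x \<in> {a..b} \<Longrightarrow> (\<lambda>n. f n x) \<longlonglongrightarrow> g x"
  have "(\<lambda>n. \<Lambda> (f n)) \<longlonglongrightarrow> \<Lambda> g" "(\<lambda>n. \<Lambda>' (f n)) \<longlonglongrightarrow> \<Lambda>' g"
    using integral_like_limit[OF assms(1) *(1,3,4,5)] integral_like_limit[OF assms(2) *(1,3,4,5)] by auto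
  then show "\<Lambda> g = \<Lambda>' g" using *(2) LIMSEQ_unique by simp
qed

lemma integral_like_eq_moments:
  assumes "integral_like a b \<Lambda>" "integral_like a b \<Lambda>'" "\<And>k. \<Lambda> (\<lambda>x. x ^ k) = \<Lambda>' (\<lambda>x. x ^ k)"
    "bounded_borel a b f"
  shows "\<Lambda> f = \<Lambda>' f"
  using monotone_class.from_monomials[OF monotone_class_eq[OF assms(1,2)] assms(3,4)] .

lemma integral_like_eq_indicators:
  assumes "integral_like a b \<Lambda>" "integral_like a b \<Lambda>'"
    "\<And>B. B \<in> sets borel \<Longrightarrow> \<Lambda> (indicator B) = \<Lambda>' (indicator B)" "bounded_borel a b f"
  shows "\<Lambda> f = \<Lambda>' f"
  using monotone_class.from_indicators[OF monotone_class_eq[OF assms(1,2)] assms(3,4)] .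

text \<open>Closure under densities allows an identity between one functional and another with
  density \<open>h\<close> to be tested on monomials or indicators.\<close>

lemma integral_like_mult:
  assumes L: "integral_like a b \<Lambda>" and h: "bounded_borel a b h"
  shows "integral_like a b (\<lambda>f. \<Lambda> (\<lambda>x. h x * f x))"
  unfolding integral_like_def
proof (intro conjI allI impI)
  fix f g c d assume fg: "bounded_borel a b f" "bounded_borel a b g"
  have "(\<lambda>x. h x * (c * f x + d * g x)) = (\<lambda>x. c * (h x * f x) + d * (h x * g x))"
    by (auto simp: algebra_simps)
  then show "\<Lambda> (\<lambda>x. h x * (c * f x + d * g x)) =
      of_real c * \<Lambda> (\<lambda>x. h x * f x) + of_real d * \<Lambda> (\<lambda>x. h x * g x)"
    using integral_like_linear[OF L bounded_borel_mult[OF h fg(1)] bounded_borel_mult[OF h fg(2)]] by simp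
next
  fix f g K
  assume *: "\<forall>n::nat. bounded_borel a b (f n)" "bounded_borel a b g"
    "\<forall>n. \<forall>x\<in>{a..b}. \<bar>f n x\<bar> \<le> K" "\<forall>x\<in>{a..b}. (\<lambda>n. f n x) \<longlonglongrightarrow> g x"
  obtain L where "\<And>x. x \<in> {a..b} \<Longrightarrow> \<bar>h x\<bar> \<le> L" using bounded_borelE[OF h] by metis
  then have "\<bar>h x * f n x\<bar> \<le> \<bar>L\<bar> * K" if "x \<in> {a..b}" for x n
    unfolding abs_mult using that * by (intro mult_mono) force+
  with * show "(\<lambda>n. \<Lambda> (\<lambda>x. h x * f n x)) \<longlonglongrightarrow> \<Lambda> (\<lambda>x. h x * g x)"
    by (intro integral_like_limit[OF L, where K = "\<bar>L\<bar> * K"] bounded_borel_mult h)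
       (auto intro!: tendsto_intros)
qed

lemma integral_like_combination:
  assumes "integral_like a b \<Lambda>" "integral_like a b \<Lambda>'"
  shows "integral_like a b (\<lambda>f. c * \<Lambda> f + c' * \<Lambda>' f)"
  unfolding integral_like_def
proof (intro conjI allI impI)
  fix f g C D assume "bounded_borel a b f" "bounded_borel a b g"
  then show "c * \<Lambda> (\<lambda>x. C * f x + D * g x) + c' * \<Lambda>' (\<lambda>x. C * f x + D * g x) =
      of_real C * (c * \<Lambda> f + c' * \<Lambda>' f) + of_real D * (c * \<Lambda> g + c' * \<Lambda>' g)"
    by (simp add: integral_like_linear[OF assms(1)] integral_like_linear[OF assms(2)] algebra_simps)
next
  fix f g K
  assume "\<forall>n::nat. bounded_borel a b (f n)" "bounded_borel a b g"
    "\<forall>n. \<forall>x\<in>{a..b}. \<bar>f n x\<bar> \<le> K" "\<forall>x\<in>{a..b}. (\<lambda>n. f n x) \<longlonglongrightarrow> g x"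
  then show "(\<lambda>n. c * \<Lambda> (f n) + c' * \<Lambda>' (f n)) \<longlonglongrightarrow> c * \<Lambda> g + c' * \<Lambda>' g"
    by (intro tendsto_intros integral_like_limit[OF assms(1), where K = K] integral_like_limit[OF assms(2), where K = K]) auto
qed

definition interval_measure_on :: "real \<Rightarrow> real \<Rightarrow> real measure \<Rightarrow> bool" where
  "interval_measure_on a b M \<longleftrightarrow> finite_measure M \<and> sets M = sets borel \<and> (AE x in M. x \<in> {a..b})"

lemma interval_measure_on_integrable:
  assumes M: "interval_measure_on a b M" and f: "bounded_borel a b f"
  shows "integrable M f"
proof -
  interpret finite_measure M using M by (simp add: interval_measure_on_def)
  have s: "sets M = sets borel" using M by (simp add: interval_measure_on_def)
  obtain K where K: "\<And>x. x \<in> {a..b} \<Longrightarrow> \<bar>f x\<bar> \<le> K" and "f \<in> borel_measurable borel"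
    using f unfolding bounded_borel_def by blast
  then have "f \<in> borel_measurable M" by (simp add: measurable_cong_sets[OF s refl])
  moreover have "AE x in M. x \<in> {a..b}" using M by (simp add: interval_measure_on_def)
  then have "AE x in M. norm (f x) \<le> K" by eventually_elim (use K in auto)
  ultimately show ?thesis by (intro integrable_const_bound[of f K]) auto
qed

lemma interval_measure_on_limit:
  assumes M: "interval_measure_on a b M" and f: "\<And>n. bounded_borel a b (f n)" and g: "bounded_borel a b g"
    and K: "\<And>n x. x \<in> {a..b} \<Longrightarrow> \<bar>f n x\<bar> \<le> K"
    and l: "\<And>x. x \<in> {a..b} \<Longrightarrow> (\<lambda>n. f n x) \<longlonglongrightarrow> g x"
  shows "(\<lambda>n. \<integral>x. f n x \<partial>M) \<longlonglongrightarrow> (\<integral>x. g x \<partial>M)"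
proof -
  interpret finite_measure M using M by (simp add: interval_measure_on_def)
  have s: "sets M = sets borel" and ae: "AE x in M. x \<in> {a..b}"
    using M by (auto simp: interval_measure_on_def)
  have m: "bounded_borel a b h \<Longrightarrow> h \<in> borel_measurable M" for h
    by (auto simp: bounded_borel_def measurable_cong_sets[OF s refl])
  show ?thesis
  proof (rule integral_dominated_convergence[where w = "\<lambda>_. K"])
    show "AE x in M. (\<lambda>n. f n x) \<longlonglongrightarrow> g x" using ae by eventually_elim (use l in auto)
    show "AE x in M. norm (f n x) \<le> K" for n using ae by eventually_elim (use K in auto)
  qed (use m f g in auto)
qed

lemma integral_like_integral:
  assumes M: "interval_measure_on a b M"
  shows "integral_like a b (\<lambda>f. complex_of_real (\<integral>x. f x \<partial>M))"
  unfolding integral_like_def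
proof (intro conjI allI impI)
  fix f g c d assume "bounded_borel a b f" "bounded_borel a b g"
  then have "integrable M f" "integrable M g" using interval_measure_on_integrable[OF M] by auto
  then show "complex_of_real (\<integral>x. c * f x + d * g x \<partial>M) = complex_of_real c * complex_of_real (\<integral>x. f x \<partial>M)
      + complex_of_real d * complex_of_real (\<integral>x. g x \<partial>M)" by simp
next
  fix f g K
  assume "\<forall>n::nat. bounded_borel a b (f n)" "bounded_borel a b g"
    "\<forall>n. \<forall>x\<in>{a..b}. \<bar>f n x\<bar> \<le> K" "\<forall>x\<in>{a..b}. (\<lambda>n. f n x) \<longlonglongrightarrow> g x"
  then show "(\<lambda>n. complex_of_real (\<integral>x. f n x \<partial>M)) \<longlonglongrightarrow> complex_of_real (\<integral>x. g x \<partial>M)"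
    by (intro tendsto_of_real interval_measure_on_limit[OF M, where K = K]) auto
qed

lemma interval_measure_on_mono:
  assumes "interval_measure_on a b M" "a' \<le> a" "b \<le> b'"
  shows "interval_measure_on a' b' M"
proof -
  have "AE x in M. x \<in> {a..b}" using assms(1) by (simp add: interval_measure_on_def)
  then have "AE x in M. x \<in> {a'..b'}" by (rule eventually_mono) (use assms in auto)
  with assms show ?thesis by (simp add: interval_measure_on_def)
qed

lemma interval_measure_on_eq_moments:
  assumes "interval_measure_on a b M" "interval_measure_on a b M'"
    "\<And>k. (\<integral>x. x ^ k \<partial>M) = (\<integral>x. x ^ k \<partial>M')" "bounded_borel a b f"
  shows "(\<integral>x. f x \<partial>M) = (\<integral>x. f x \<partial>M')"
  using integral_like_eq_moments[OF integral_like_integral[OF assms(1)] integral_like_integral[OF assms(2)] _ assms(4)]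
    assms(3) by simp

subsection \<open>The Hausdorff moment problem\<close>

text \<open>Think of \<open>a k j\<close> as the integral of \<open>x ^ k * (1 - x) ^ j\<close>. The
  recursion expresses \<open>x + (1 - x) = 1\<close>, and the claim is the binomial expansion of the
  \<open>n\<close>-th power of this identity.\<close>

lemma hausdorff_expand:
  fixes a :: "nat \<Rightarrow> nat \<Rightarrow> real"
  assumes rec: "\<And>k j. a k j = a (Suc k) j + a k (Suc j)"
  shows "a m l = (\<Sum>k\<le>n. real (n choose k) * a (m + k) (l + (n - k)))"
proof (induction n arbitrary: m l)
  case 0 show ?case by simp
next
  case (Suc n)
  define f where "f k = a (m + k) (l + (Suc n - k))" for k
  have 1: "a (Suc m) l = (\<Sum>k\<le>n. real (n choose k) * f (Suc k))"
    unfolding f_def by (subst Suc.IH) simp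
  have "a m (Suc l) = (\<Sum>k\<le>n. real (n choose k) * f k)"
    unfolding f_def by (subst Suc.IH, intro sum.cong refl) (simp add: Suc_diff_le)
  also have "\<dots> = (\<Sum>k\<le>Suc n. real (n choose k) * f k)" by simp
  also have "\<dots> = f 0 + (\<Sum>k\<le>n. real (n choose Suc k) * f (Suc k))"
    by (subst sum.atMost_Suc_shift) simp
  finally have 2: "a m (Suc l) = f 0 + (\<Sum>k\<le>n. real (n choose Suc k) * f (Suc k))" .
  have "(\<Sum>k\<le>Suc n. real (Suc n choose k) * f k) = f 0 + (\<Sum>k\<le>n. real (Suc n choose Suc k) * f (Suc k))"
    by (subst sum.atMost_Suc_shift) simp
  also have "\<dots> = a (Suc m) l + a m (Suc l)"
    unfolding 1 2 by (simp add: sum.distrib[symmetric] algebra_simps)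
  finally show ?case using rec[of m l] by (simp add: f_def)
qed

text \<open>In the same picture, if \<open>a 0 0 = 1\<close>, the weights
  \<open>(n choose k) * a k (n - k)\<close> are the distribution of the number \<open>k\<close> of
  successes in \<open>n\<close> trials with a random success probability \<open>x\<close>. The
  binomial moments of \<open>k\<close> are exact multiples of the moments of \<open>x\<close>, for
  every \<open>n\<close>.\<close>

lemma hausdorff_factorial_moment:
  fixes a :: "nat \<Rightarrow> nat \<Rightarrow> real"
  assumes rec: "\<And>k j. a k j = a (Suc k) j + a k (Suc j)" and mn: "m \<le> n"
  shows "(\<Sum>k\<le>n. real (k choose m) * (real (n choose k) * a k (n - k))) = real (n choose m) * a m 0"
proof -
  have "(\<Sum>k\<le>n. real (k choose m) * (real (n choose k) * a k (n - k))) =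
      (\<Sum>k\<in>{m..n}. real (k choose m) * (real (n choose k) * a k (n - k)))"
    by (rule sum.mono_neutral_right) auto
  also have "\<dots> = (\<Sum>k\<in>{m..n}. real (n choose m) * (real (n - m choose (k - m)) * a k (n - k)))"
  proof (rule sum.cong[OF refl])
    fix k assume "k \<in> {m..n}"
    then have "real (n choose k) * real (k choose m) = real (n choose m) * real (n - m choose (k - m))"
      using choose_mult[of m k n] by (metis atLeastAtMost_iff of_nat_mult)
    then show "real (k choose m) * (real (n choose k) * a k (n - k)) =
        real (n choose m) * (real (n - m choose (k - m)) * a k (n - k))"
      by (metis mult.assoc mult.commute)
  qed
  also have "\<dots> = (\<Sum>k\<le>n - m. real (n choose m) * (real (n - m choose k) * a (m + k) (n - m - k)))"
    by (rule sum.reindex_bij_witness[of _ "\<lambda>k. k + m" "\<lambda>k. k - m"]) (use mn in auto)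
  also have "\<dots> = real (n choose m) * a m 0"
    using hausdorff_expand[of a m 0 "n - m", OF rec] by (simp add: sum_distrib_left)
  finally show ?thesis .
qed

text \<open>Drawing with and without replacement: both quantities are products of \<open>m\<close>
  factors in the unit interval, which are compared one by one. For fixed \<open>m\<close> the bound
  tends to 0 as \<open>n\<close> grows, uniformly in \<open>k\<close>.\<close>

lemma binomial_ratio_approx:
  assumes "k \<le> n" "m < n"
  shows "\<bar>(real k / real n) ^ m - real (k choose m) / real (n choose m)\<bar> \<le> real m * (real m / real (n - m))"
proof -
  have ratio: "real (k choose m) / real (n choose m) = (\<Prod>i<m. real (k - i) / real (n - i))"
  proof (cases "m \<le> k")
    case True
    have "real (k choose m) = (\<Prod>i<m. real (k - i) / real (m - i))"
      using binomial_altdef_of_nat[OF True, where 'a=real] by (simp add: atLeast0LessThan)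
    moreover have "real (n choose m) = (\<Prod>i<m. real (n - i) / real (m - i))"
      using binomial_altdef_of_nat[of m n, where 'a=real] assms by (simp add: atLeast0LessThan)
    ultimately show ?thesis
      by (simp add: prod_dividef[symmetric])
  next
    case False
    \<comment> \<open>The factor with \<open>i = k\<close> vanishes.\<close>
    then have z: "(\<Prod>i<m. real (k - i) / real (n - i)) = 0"
      by (intro prod_zero) (auto intro: bexI[of _ k])
    show ?thesis unfolding z using False by simp
  qed
  have "norm ((\<Prod>i<m. real k / real n) - (\<Prod>i<m. real (k - i) / real (n - i))) \<le>
      (\<Sum>i<m. norm (real k / real n - real (k - i) / real (n - i)))"
    by (rule norm_prod_diff) (use assms in \<open>auto simp: divide_le_eq_1\<close>)
  also have "\<dots> \<le> (\<Sum>i<m. real m / real (n - m))"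
  proof (rule sum_mono)
    fix i assume "i \<in> {..<m}"
    then have i: "i < m" by simp
    have "norm (real k / real n - real (k - i) / real (n - i)) \<le> real i / real (n - i)"
    proof (cases "i \<le> k")
      case True
      have e: "real k / real n - real (k - i) / real (n - i) = real i / real (n - i) * ((real n - real k) / real n)"
        using True i assms by (simp add: field_simps of_nat_diff)
      have "(real n - real k) / real n \<le> 1" "0 \<le> (real n - real k) / real n" using assms by auto
      then have "real i / real (n - i) * ((real n - real k) / real n) \<le> real i / real (n - i) * 1"
        by (intro mult_left_mono) auto
      moreover have "0 \<le> real i / real (n - i) * ((real n - real k) / real n)" using assms by auto
      ultimately show ?thesis unfolding e by (simp only: real_norm_def abs_of_nonneg mult_1_right)
    next
      case False
      then have "real k / real n \<le> real i / real (n - i)"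
        using i assms by (intro frac_le) auto
      with False show ?thesis by simp
    qed
    also have "\<dots> \<le> real m / real (n - m)"
      using i assms by (intro frac_le) auto
    finally show "norm (real k / real n - real (k - i) / real (n - i)) \<le> real m / real (n - m)" .
  qed
  finally show ?thesis unfolding ratio by simp
qed

text \<open>The weights \<open>w n\<close>, placed at the points \<open>k / n\<close>, form
  probability measures whose moments approach \<open>a m 0\<close> by the two preceding lemmas. All
  of them live on the unit interval, so tightness yields a weak limit along a subsequence, and this
  limit has the required moments.\<close>

lemma hausdorff_moments_unit:
  fixes a :: "nat \<Rightarrow> nat \<Rightarrow> real"
  assumes nonneg: "\<And>k j. 0 \<le> a k j" and rec: "\<And>k j. a k j = a (Suc k) j + a k (Suc j)" and one: "a 0 0 = 1"
  obtains M where "interval_measure_on 0 1 M" "\<And>m. (\<integral>x. x ^ m \<partial>M) = a m 0"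
proof -
  define w where "w n k = (if k \<le> n then real (n choose k) * a k (n - k) else 0)" for n k
  have w0: "0 \<le> w n k" for n k using nonneg by (simp add: w_def)
  have w1: "(\<Sum>k\<le>n. w n k) = 1" for n
    using hausdorff_expand[of a 0 0 n, OF rec] one by (simp add: w_def)
  define q where "q n = embed_pmf (w n)" for n
  have pmf_q: "pmf (q n) k = w n k" for n k
    unfolding q_def
  proof (rule pmf_embed_pmf)
    have "(\<integral>\<^sup>+x. ennreal (w n x) \<partial>count_space UNIV) = (\<Sum>k\<le>n. ennreal (w n k))"
      by (rule nn_integral_count_space') (auto simp: w_def)
    then show "(\<integral>\<^sup>+x. ennreal (w n x) \<partial>count_space UNIV) = 1"
      using w1[of n] w0 by (simp add: sum_ennreal)
  qed (rule w0)
  \<comment> \<open>The index \<open>Suc n\<close> avoids a division by 0 in the grid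
    points.\<close>
  define \<mu> where "\<mu> n = distr (measure_pmf (q (Suc n))) borel (\<lambda>k. real k / real (Suc n))" for n
  have supp: "k \<le> n" if "k \<in> set_pmf (q n)" for k n
    using that by (auto simp: set_pmf_eq pmf_q w_def split: if_splits)
  have int: "(\<integral>x. f x \<partial>\<mu> n) = (\<Sum>k\<le>Suc n. f (real k / real (Suc n)) * w (Suc n) k)"
    if "f \<in> borel_measurable borel" for f :: "real \<Rightarrow> real" and n
    unfolding \<mu>_def using that
    by (subst integral_distr) (auto simp: pmf_q[symmetric] simp del: sum.atMost_Suc of_nat_Suc dest: supp intro!: integral_measure_pmf_real)
  have rd: "real_distribution (\<mu> n)" for n
  proof -
    interpret prob_space "\<mu> n" unfolding \<mu>_def by (intro measure_pmf.prob_space_distr) simp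
    show ?thesis by standard (simp add: \<mu>_def)
  qed
  \<comment> \<open>Tightness is formulated with half-open intervals; starting at \<open>- 1\<close>
    keeps the point 0 inside.\<close>
  have "measure (\<mu> n) {-1<..1} = 1" for n
  proof -
    have "measure (\<mu> n) {-1<..1} = (\<integral>x. indicator {-1<..1} x \<partial>\<mu> n)" by (simp add: \<mu>_def)
    also have "\<dots> = (\<Sum>k\<le>Suc n. indicator {-1<..1} (real k / real (Suc n)) * w (Suc n) k)"
      by (rule int) simp
    also have "\<dots> = (\<Sum>k\<le>Suc n. w (Suc n) k)"
    proof (rule sum.cong[OF refl])
      fix k assume "k \<in> {..Suc n}"
      then have "real k / real (Suc n) \<le> 1" "-1 < real k / real (Suc n)"
        by (auto simp: less_le_trans[of "-1" 0])
      then show "indicator {-1<..1} (real k / real (Suc n)) * w (Suc n) k = w (Suc n) k" by simp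
    qed
    finally show ?thesis unfolding w1 .
  qed
  then have "tight \<mu>"
    unfolding tight_def using rd
    by (intro conjI allI impI) (simp, rule exI[of _ "-1"], rule exI[of _ 1], simp)
  from tight_imp_convergent_subsubsequence[OF this strict_mono_id]
  obtain r M where r: "strict_mono r" "real_distribution M" "weak_conv_m (\<mu> \<circ> r) M" by auto
  interpret M: real_distribution M by fact
  have wc: "(\<lambda>n. \<integral>x. f x \<partial>\<mu> (r n)) \<longlonglongrightarrow> (\<integral>x. f x \<partial>M)"
    if "continuous_on UNIV f" "\<And>x. \<bar>f x\<bar> \<le> B" for f :: "real \<Rightarrow> real" and B
    using weak_conv_imp_integral_bdd_continuous_conv[of "\<mu> \<circ> r" M f B] rd r that
    by (auto simp: continuous_on_eq_continuous_at)
  \<comment> \<open>Weak convergence tests bounded functions, but monomials are unbounded on the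
    line. Clamping to the unit interval changes nothing on the supports.\<close>
  define cl where "cl x = max 0 (min 1 x)" for x :: real
  have cl_cont: "continuous_on UNIV cl" unfolding cl_def[abs_def] by (intro continuous_intros)
  have cl_id: "cl (real k / real (Suc n)) = real k / real (Suc n)" if "k \<le> Suc n" for k n
    using that by (simp add: cl_def)
  \<comment> \<open>This bounded continuous function vanishes exactly on \<open>{0..1}\<close>, so
    its integral detects any mass that the limit might have outside.\<close>
  have "(\<lambda>n. \<integral>x. min 1 \<bar>x - cl x\<bar> \<partial>\<mu> (r n)) \<longlonglongrightarrow> (\<integral>x. min 1 \<bar>x - cl x\<bar> \<partial>M)"
    by (rule wc[of _ 1]) (auto intro!: continuous_intros cl_cont)
  moreover have "(\<integral>x. min 1 \<bar>x - cl x\<bar> \<partial>\<mu> n) = 0" for n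
    by (subst int) (auto simp: cl_id simp del: sum.atMost_Suc of_nat_Suc intro!: sum.neutral borel_measurable_continuous_onI continuous_intros cl_cont)
  ultimately have "(\<integral>x. min 1 \<bar>x - cl x\<bar> \<partial>M) = 0"
    using LIMSEQ_unique[OF _ tendsto_const] by force
  moreover have m: "(\<lambda>x. min 1 \<bar>x - cl x\<bar>) \<in> borel_measurable M"
    by (subst measurable_cong_sets[OF M.events_eq_borel refl])
       (intro borel_measurable_continuous_onI continuous_intros cl_cont)
  moreover have "integrable M (\<lambda>x. min 1 \<bar>x - cl x\<bar>)"
    by (rule M.integrable_const_bound[of _ 1]) (use m in auto)
  ultimately have "AE x in M. min 1 \<bar>x - cl x\<bar> = 0"
    by (subst integral_nonneg_eq_0_iff_AE[symmetric]) auto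
  then have ae: "AE x in M. x \<in> {0..1}" 
    by (rule eventually_mono) (auto simp: cl_def min_def max_def split: if_splits)
  have "(\<integral>x. x ^ m \<partial>M) = a m 0" for m
  proof -
    have "(\<lambda>n. \<integral>x. cl x ^ m \<partial>\<mu> (r n)) \<longlonglongrightarrow> (\<integral>x. cl x ^ m \<partial>M)"
      by (rule wc[of _ 1]) (auto intro!: continuous_intros cl_cont power_le_one simp: cl_def)
    moreover have "(\<integral>x. cl x ^ m \<partial>M) = (\<integral>x. x ^ m \<partial>M)"
      using ae by (intro integral_cong_AE) (auto simp: cl_def)
    moreover have lim: "(\<lambda>n. \<integral>x. cl x ^ m \<partial>\<mu> n) \<longlonglongrightarrow> a m 0"
    proof (rule LIM_zero_cancel, rule Lim_null_comparison)
      show "\<forall>\<^sub>F n in sequentially. norm ((\<integral>x. cl x ^ m \<partial>\<mu> n) - a m 0) \<le> real m * (real m / real (Suc n - m))"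
      proof (rule eventually_sequentiallyI[of m])
        fix n assume n: "m \<le> n"
        have "(\<integral>x. cl x ^ m \<partial>\<mu> n) = (\<Sum>k\<le>Suc n. (real k / real (Suc n)) ^ m * w (Suc n) k)"
          by (subst int) (auto simp: cl_id simp del: sum.atMost_Suc of_nat_Suc intro!: borel_measurable_continuous_onI continuous_intros cl_cont)
        moreover have "a m 0 = (\<Sum>k\<le>Suc n. real (k choose m) / real (Suc n choose m) * w (Suc n) k)"
        proof -
          have "(\<Sum>k\<le>Suc n. real (k choose m) / real (Suc n choose m) * w (Suc n) k) =
              (\<Sum>k\<le>Suc n. real (k choose m) * (real (Suc n choose k) * a k (Suc n - k))) / real (Suc n choose m)"
            by (simp add: w_def sum_divide_distrib del: sum.atMost_Suc)
          also have "\<dots> = a m 0"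
            using hausdorff_factorial_moment[of a m "Suc n", OF rec] n by simp
          finally show ?thesis by simp
        qed
        ultimately have "norm ((\<integral>x. cl x ^ m \<partial>\<mu> n) - a m 0) =
            norm (\<Sum>k\<le>Suc n. ((real k / real (Suc n)) ^ m - real (k choose m) / real (Suc n choose m)) * w (Suc n) k)"
          by (simp only: sum_subtractf[symmetric] left_diff_distrib)
        also have "\<dots> \<le> (\<Sum>k\<le>Suc n. real m * (real m / real (Suc n - m)) * w (Suc n) k)"
        proof (rule sum_norm_le)
          fix k assume k: "k \<in> {..Suc n}"
          have "\<bar>(real k / real (Suc n)) ^ m - real (k choose m) / real (Suc n choose m)\<bar> \<le> real m * (real m / real (Suc n - m))"
            by (rule binomial_ratio_approx) (use k n in auto)
          then show "norm (((real k / real (Suc n)) ^ m - real (k choose m) / real (Suc n choose m)) * w (Suc n) k)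
             \<le> real m * (real m / real (Suc n - m)) * w (Suc n) k"
            unfolding real_norm_def abs_mult abs_of_nonneg[OF w0] by (rule mult_right_mono) (rule w0)
        qed
        also have "\<dots> = real m * (real m / real (Suc n - m)) * (\<Sum>k\<le>Suc n. w (Suc n) k)"
          by (simp only: sum_distrib_left)
        finally show "norm ((\<integral>x. cl x ^ m \<partial>\<mu> n) - a m 0) \<le> real m * (real m / real (Suc n - m))"
          by (simp only: w1 mult_1_right)
      qed
      have "(\<lambda>n. real m * (real m / (real (Suc n) - real m))) \<longlonglongrightarrow> 0" by real_asymp
      moreover have "\<forall>\<^sub>F n in sequentially. real m * (real m / (real (Suc n) - real m)) = real m * (real m / real (Suc n - m))"
        by (rule eventually_sequentiallyI[of m]) (auto simp: of_nat_diff)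
      ultimately show "(\<lambda>n. real m * (real m / real (Suc n - m))) \<longlonglongrightarrow> 0"
        by (rule Lim_transform_eventually)
    qed
    moreover have "(\<lambda>n. \<integral>x. cl x ^ m \<partial>\<mu> (r n)) \<longlonglongrightarrow> a m 0"
      using LIMSEQ_subseq_LIMSEQ[OF lim r(1)] by (simp add: o_def)
    ultimately show ?thesis by (metis LIMSEQ_unique)
  qed
  moreover have "interval_measure_on 0 1 M"
    unfolding interval_measure_on_def using ae M.finite_measure_axioms by simp
  ultimately show ?thesis using that by blast
qed

text \<open>Scaling by \<open>R\<close> and by the total mass \<open>a 0 0\<close> reduces this to
  the unit case. If \<open>a 0 0\<close> is 0, nonnegativity and the recursion force every
  \<open>a k j\<close> to be 0, and the zero measure serves.\<close>

lemma hausdorff_moments: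
  fixes a :: "nat \<Rightarrow> nat \<Rightarrow> real"
  assumes nonneg: "\<And>k j. 0 \<le> a k j" and rec: "\<And>k j. R * a k j = a (Suc k) j + a k (Suc j)" and R: "R > 0"
  obtains M where "interval_measure_on 0 R M" "\<And>m. (\<integral>x. x ^ m \<partial>M) = a m 0"
proof (cases "a 0 0 = 0")
  case True
  have "a m j = 0" for m j
  proof (induction "m + j" arbitrary: m j)
    case 0 then show ?case using True by simp
  next
    case (Suc n)
    show ?case
    proof (cases m)
      case 0
      then obtain j' where "j = Suc j'" using Suc by (cases j) auto
      then show ?thesis using Suc(1)[of m j'] Suc(2) rec[of m j'] nonneg[of "Suc m" j'] nonneg[of m j] by auto
    next
      case (Suc m')
      then show ?thesis using \<open>\<And>m j. n = m + j \<Longrightarrow> a m j = 0\<close>[of m' j] \<open>Suc n = m + j\<close> rec[of m' j]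
          nonneg[of m j] nonneg[of m' "Suc j"] by auto
    qed
  qed
  moreover have "interval_measure_on 0 R (null_measure borel)"
    by (auto simp: interval_measure_on_def intro: finite_measureI)
       (auto simp: eventually_ae_filter null_sets_def)
  moreover have "(\<integral>x. f x \<partial>null_measure borel) = 0" for f :: "real \<Rightarrow> real"
    by (rule integral_eq_zero_AE) (auto simp: eventually_ae_filter null_sets_def)
  ultimately show ?thesis using that by metis
next
  case False
  then have a0: "a 0 0 > 0" using nonneg[of 0 0] by linarith
  define b where "b k j = a k j / (R ^ (k + j) * a 0 0)" for k j
  obtain M where M: "interval_measure_on 0 1 M" "\<And>m. (\<integral>x. x ^ m \<partial>M) = b m 0"
  proof (rule hausdorff_moments_unit[of b])
    show "0 \<le> b k j" for k j using nonneg R a0 by (simp add: b_def)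
    show "b 0 0 = 1" using a0 by (simp add: b_def)
    show "b k j = b (Suc k) j + b k (Suc j)" for k j
    proof -
      have "b (Suc k) j + b k (Suc j) = (a (Suc k) j + a k (Suc j)) / (R * R ^ (k + j) * a 0 0)"
        by (simp add: b_def add_divide_distrib)
      also have "\<dots> = b k j" using R unfolding rec[symmetric] by (simp add: b_def)
      finally show ?thesis by simp
    qed
  qed (rule that)
  interpret M: finite_measure M using M by (simp add: interval_measure_on_def)
  have sM[measurable_cong]: "sets M = sets borel" and ae: "AE x in M. x \<in> {0..1}"
    using M by (auto simp: interval_measure_on_def)
  define N where "N = density (distr M borel (\<lambda>x. R * x)) (\<lambda>_. ennreal (a 0 0))"
  have "emeasure N (space N) < \<infinity>"
    using finite_measure.emeasure_finite[OF M.finite_measure_distr[of "\<lambda>x. R * x" borel], of UNIV]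
    unfolding N_def by (simp add: emeasure_density nn_integral_cmult ennreal_mult_less_top less_top)
  then have "finite_measure N" by (intro finite_measureI) auto
  moreover have "AE x in N. x \<in> {0..R}"
  proof -
    have "AE x in distr M borel (\<lambda>x. R * x). x \<in> {0..R}"
      using ae by (subst AE_distr_iff) (use R in \<open>auto elim!: eventually_mono\<close>)
    then show ?thesis unfolding N_def by (subst AE_density) (auto elim!: eventually_mono)
  qed
  moreover have "sets N = sets borel" by (simp add: N_def)
  ultimately have "interval_measure_on 0 R N"
    by (simp add: interval_measure_on_def)
  moreover have "(\<integral>x. x ^ m \<partial>N) = a m 0" for m
  proof -
    have "(\<integral>x. x ^ m \<partial>N) = a 0 0 * (\<integral>x. x ^ m \<partial>distr M borel (\<lambda>x. R * x))"
      unfolding N_def using a0 by (subst integral_density) auto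
    also have "(\<integral>x. x ^ m \<partial>distr M borel (\<lambda>x. R * x)) = (\<integral>x. (R * x) ^ m \<partial>M)"
      by (rule integral_distr) auto
    also have "\<dots> = R ^ m * b m 0" by (simp add: power_mult_distrib M(2))
    finally show ?thesis using a0 R by (simp add: b_def)
  qed
  ultimately show ?thesis using that by blast
qed

subsection \<open>Square-summable functions\<close>

text \<open>A constant for linear combinations lets linearity be applied by first-order rewriting,
  which the bare lambda term would not permit.\<close>

definition lc :: "complex \<Rightarrow> ('a \<Rightarrow> complex) \<Rightarrow> complex \<Rightarrow> ('a \<Rightarrow> complex) \<Rightarrow> 'a \<Rightarrow> complex" where
  "lc a \<phi> b \<xi> = (\<lambda>v. a * \<phi> v + b * \<xi> v)"

lemma l2_outside: "\<phi> \<in> l2 V \<Longrightarrow> v \<notin> V \<Longrightarrow> \<phi> v = 0"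
  by (simp add: l2_def)

lemma l2_summable: "\<phi> \<in> l2 V \<Longrightarrow> (\<lambda>v. (cmod (\<phi> v))\<^sup>2) summable_on V"
  by (simp add: l2_def)

lemma l2I: "(\<And>v. v \<notin> V \<Longrightarrow> \<phi> v = 0) \<Longrightarrow> (\<lambda>v. (cmod (\<phi> v))\<^sup>2) summable_on V \<Longrightarrow> \<phi> \<in> l2 V"
  by (simp add: l2_def)

lemma l2_finite_support:
  assumes "finite F" "F \<subseteq> V" "\<And>v. v \<notin> F \<Longrightarrow> \<phi> v = 0"
  shows "\<phi> \<in> l2 V"
proof (rule l2I)
  have "(\<lambda>v. (cmod (\<phi> v))\<^sup>2) summable_on F" using assms by simp
  then show "(\<lambda>v. (cmod (\<phi> v))\<^sup>2) summable_on V"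
    by (rule summable_on_cong_neutral[THEN iffD1, rotated -1]) (use assms in auto)
qed (use assms in auto)

lemma l2_inner_finite_support:
  assumes "finite F" "F \<subseteq> V" "\<And>v. v \<notin> F \<Longrightarrow> \<phi> v = 0"
  shows "l2_inner V \<phi> \<xi> = (\<Sum>v\<in>F. cnj (\<phi> v) * \<xi> v)"
proof -
  have "l2_inner V \<phi> \<xi> = (\<Sum>\<^sub>\<infinity>v\<in>F. cnj (\<phi> v) * \<xi> v)"
    unfolding l2_inner_def by (rule infsum_cong_neutral) (use assms in auto)
  then show ?thesis using assms by simp
qed

lemma delta_apply: "delta v w = (if w = v then 1 else 0)"
  by (simp add: delta_def indicator_def)

lemma delta_l2: "v \<in> V \<Longrightarrow> delta v \<in> l2 V"
  by (rule l2_finite_support[of "{v}"]) (auto simp: delta_apply)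

lemma l2_inner_delta: "v \<in> V \<Longrightarrow> l2_inner V (delta v) \<xi> = \<xi> v"
  by (subst l2_inner_finite_support[of "{v}"]) (auto simp: delta_apply)

lemma norm_add_square_le: "(norm (x + y))\<^sup>2 \<le> 2 * (norm x)\<^sup>2 + 2 * (norm y)\<^sup>2"
  for x y :: "'b::real_normed_vector"
proof -
  have "(norm (x + y))\<^sup>2 \<le> (norm x + norm y)\<^sup>2" by (intro power_mono norm_triangle_ineq) simp
  moreover have "(norm x + norm y)\<^sup>2 + (norm x - norm y)\<^sup>2 = 2 * (norm x)\<^sup>2 + 2 * (norm y)\<^sup>2"
    by (simp add: power2_eq_square algebra_simps)
  ultimately show ?thesis by (smt (verit) zero_le_power2)
qed

lemma l2_lc: 
  assumes "\<phi> \<in> l2 V" "\<xi> \<in> l2 V" shows "lc a \<phi> b \<xi> \<in> l2 V"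
proof (rule l2I)
  have "(\<lambda>v. 2 * (cmod a)\<^sup>2 * (cmod (\<phi> v))\<^sup>2 + 2 * (cmod b)\<^sup>2 * (cmod (\<xi> v))\<^sup>2) summable_on V"
    using assms by (intro summable_on_add summable_on_cmult_right l2_summable)
  then show "(\<lambda>v. (cmod (lc a \<phi> b \<xi> v))\<^sup>2) summable_on V"
  proof (rule summable_on_comparison_test)
    fix v
    show "(cmod (lc a \<phi> b \<xi> v))\<^sup>2 \<le> 2 * (cmod a)\<^sup>2 * (cmod (\<phi> v))\<^sup>2 + 2 * (cmod b)\<^sup>2 * (cmod (\<xi> v))\<^sup>2"
      using norm_add_square_le[of "a * \<phi> v" "b * \<xi> v"]
      by (simp add: lc_def norm_mult power_mult_distrib mult.assoc)
  qed simp
qed (use assms in \<open>auto simp: lc_def l2_outside\<close>)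

lemma l2_prod_abs_summable:
  assumes "\<phi> \<in> l2 V" "\<xi> \<in> l2 V" shows "(\<lambda>v. cmod (cnj (\<phi> v) * \<xi> v)) summable_on V"
proof -
  have "(\<lambda>v. (cmod (\<phi> v))\<^sup>2 + (cmod (\<xi> v))\<^sup>2) summable_on V"
    using assms by (intro summable_on_add l2_summable)
  moreover have "cmod x * cmod y \<le> (cmod x)\<^sup>2 + (cmod y)\<^sup>2" for x y
    using sum_squares_bound[of "cmod x" "cmod y"] mult_nonneg_nonneg[OF norm_ge_zero[of x] norm_ge_zero[of y]]
    by linarith
  ultimately show ?thesis
    by (elim summable_on_comparison_test) (auto simp: norm_mult)
qed

lemma l2_prod_summable:
  "\<phi> \<in> l2 V \<Longrightarrow> \<xi> \<in> l2 V \<Longrightarrow> (\<lambda>v. cnj (\<phi> v) * \<xi> v) summable_on V"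
  by (rule Infinite_Sum.abs_summable_summable[OF l2_prod_abs_summable])

lemma l2_inner_lc_right:
  assumes "\<eta> \<in> l2 V" "\<phi> \<in> l2 V" "\<xi> \<in> l2 V"
  shows "l2_inner V \<eta> (lc a \<phi> b \<xi>) = a * l2_inner V \<eta> \<phi> + b * l2_inner V \<eta> \<xi>"
proof -
  have "l2_inner V \<eta> (lc a \<phi> b \<xi>) = (\<Sum>\<^sub>\<infinity>v\<in>V. a * (cnj (\<eta> v) * \<phi> v) + b * (cnj (\<eta> v) * \<xi> v))"
    unfolding l2_inner_def lc_def by (rule infsum_cong) (simp add: algebra_simps)
  also have "\<dots> = (\<Sum>\<^sub>\<infinity>v\<in>V. a * (cnj (\<eta> v) * \<phi> v)) + (\<Sum>\<^sub>\<infinity>v\<in>V. b * (cnj (\<eta> v) * \<xi> v))"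
    using assms by (intro infsum_add summable_on_cmult_right l2_prod_summable)
  finally show ?thesis by (simp add: l2_inner_def infsum_cmult_right')
qed

lemma l2_inner_cnj: "l2_inner V \<xi> \<phi> = cnj (l2_inner V \<phi> \<xi>)"
  unfolding l2_inner_def infsum_cnj[symmetric] by (rule infsum_cong) (simp add: mult.commute)

lemma l2_inner_lc_left:
  assumes "\<eta> \<in> l2 V" "\<phi> \<in> l2 V" "\<xi> \<in> l2 V"
  shows "l2_inner V (lc a \<phi> b \<xi>) \<eta> = cnj a * l2_inner V \<phi> \<eta> + cnj b * l2_inner V \<xi> \<eta>"
  using l2_inner_lc_right[OF assms, of a b]
  unfolding l2_inner_cnj[of V "lc a \<phi> b \<xi>" \<eta>] l2_inner_cnj[of V \<phi> \<eta>] l2_inner_cnj[of V \<xi> \<eta>] by simp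

lemma l2_norm_square: "(l2_norm V \<phi>)\<^sup>2 = (\<Sum>\<^sub>\<infinity>v\<in>V. (cmod (\<phi> v))\<^sup>2)"
  by (simp add: l2_norm_def infsum_nonneg)

lemma l2_norm_nonneg: "0 \<le> l2_norm V \<phi>"
  by (simp add: l2_norm_def infsum_nonneg)

lemma l2_inner_self:
  assumes "\<phi> \<in> l2 V" shows "l2_inner V \<phi> \<phi> = complex_of_real ((l2_norm V \<phi>)\<^sup>2)"
proof -
  have "((\<lambda>v. complex_of_real ((cmod (\<phi> v))\<^sup>2)) has_sum complex_of_real ((l2_norm V \<phi>)\<^sup>2)) V"
    unfolding l2_norm_square by (intro has_sum_of_real has_sum_infsum l2_summable assms)
  moreover have "complex_of_real ((cmod (\<phi> v))\<^sup>2) = cnj (\<phi> v) * \<phi> v" for v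
    by (metis complex_norm_square mult.commute)
  ultimately show ?thesis unfolding l2_inner_def by (simp add: infsumI)
qed

lemma l2_norm_eq_0:
  assumes "\<phi> \<in> l2 V" "l2_norm V \<phi> = 0" shows "\<phi> = (\<lambda>v. 0)"
proof
  fix v
  have "(\<Sum>\<^sub>\<infinity>v\<in>V. (cmod (\<phi> v))\<^sup>2) \<le> 0" using l2_norm_square[of V \<phi>] assms by simp
  then have "v \<in> V \<Longrightarrow> (cmod (\<phi> v))\<^sup>2 = 0"
    by (rule nonneg_infsum_le_0D) (use l2_summable[OF assms(1)] in auto)
  then show "\<phi> v = 0" using l2_outside[OF assms(1)] by auto
qed

lemma l2_eqI:
  assumes "\<phi> \<in> l2 V" "\<xi> \<in> l2 V" "\<And>\<eta>. \<eta> \<in> l2 V \<Longrightarrow> l2_inner V \<eta> \<phi> = l2_inner V \<eta> \<xi>"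
  shows "\<phi> = \<xi>"
proof
  fix v show "\<phi> v = \<xi> v"
    using assms(3)[OF delta_l2, of v] l2_outside[OF assms(1), of v] l2_outside[OF assms(2), of v]
    by (cases "v \<in> V") (auto simp: l2_inner_delta)
qed

section \<open>Sesquilinear forms and the operators that they represent\<close>

locale sesquilinear_form =
  fixes V :: "'a set" and h :: "('a \<Rightarrow> complex) \<Rightarrow> ('a \<Rightarrow> complex) \<Rightarrow> complex"
  assumes right: "\<And>\<eta> \<phi> \<xi> a b. \<eta> \<in> l2 V \<Longrightarrow> \<phi> \<in> l2 V \<Longrightarrow> \<xi> \<in> l2 V \<Longrightarrow>
      h \<eta> (lc a \<phi> b \<xi>) = a * h \<eta> \<phi> + b * h \<eta> \<xi>"
    and left: "\<And>\<eta> \<phi> \<xi> a b. \<eta> \<in> l2 V \<Longrightarrow> \<phi> \<in> l2 V \<Longrightarrow> \<xi> \<in> l2 V \<Longrightarrow>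
      h (lc a \<phi> b \<xi>) \<eta> = cnj a * h \<phi> \<eta> + cnj b * h \<xi> \<eta>"

text \<open>The polarization formula for forms that are antilinear in the first argument. It takes
  an arbitrary \<open>q\<close>, since it is also applied to functions that are recognized as
  quadratic forms only afterwards.\<close>

definition polar ::
    "(('a \<Rightarrow> complex) \<Rightarrow> complex) \<Rightarrow> ('a \<Rightarrow> complex) \<Rightarrow> ('a \<Rightarrow> complex) \<Rightarrow> complex" where
  "polar q \<phi> \<xi> = (q (lc 1 \<phi> 1 \<xi>) - \<i> * q (lc 1 \<phi> \<i> \<xi>) - q (lc 1 \<phi> (- 1) \<xi>) + \<i> * q (lc 1 \<phi> (- \<i>) \<xi>)) / 4"

lemma polar_cong:
  assumes "\<And>\<eta>. \<eta> \<in> l2 V \<Longrightarrow> q \<eta> = q' \<eta>" "\<phi> \<in> l2 V" "\<xi> \<in> l2 V"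
  shows "polar q \<phi> \<xi> = polar q' \<phi> \<xi>"
  unfolding polar_def using assms by (simp add: l2_lc)

context sesquilinear_form
begin

lemma polarization:
  assumes "\<phi> \<in> l2 V" "\<xi> \<in> l2 V"
  shows "polar (\<lambda>\<eta>. h \<eta> \<eta>) \<phi> \<xi> = h \<phi> \<xi>"
  unfolding polar_def using assms
  by (simp add: left right l2_lc field_simps)

text \<open>The form is only semidefinite, so the usual division by its value at
  \<open>\<xi>\<close> leaves a degenerate case. The phase \<open>c\<close> turns the cross term
  into the real number \<open>m\<close>, and what remains is a nonnegative real polynomial in
  \<open>s\<close> of degree at most 2.\<close>

lemma cauchy_schwarz:
  assumes herm: "\<And>\<phi> \<xi>. \<phi> \<in> l2 V \<Longrightarrow> \<xi> \<in> l2 V \<Longrightarrow> h \<xi> \<phi> = cnj (h \<phi> \<xi>)"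
    and pos: "\<And>\<phi>. \<phi> \<in> l2 V \<Longrightarrow> 0 \<le> Re (h \<phi> \<phi>)"
    and l2: "\<phi> \<in> l2 V" "\<xi> \<in> l2 V"
  shows "(cmod (h \<phi> \<xi>))\<^sup>2 \<le> Re (h \<phi> \<phi>) * Re (h \<xi> \<xi>)"
proof (cases "h \<phi> \<xi> = 0")
  case True
  then show ?thesis using pos l2 by simp
next
  case False
  define m where "m = cmod (h \<phi> \<xi>)"
  have m: "m > 0" using False by (simp add: m_def)
  define c where "c = cnj (h \<phi> \<xi>) / m"
  have c: "cmod c = 1" "c * h \<phi> \<xi> = m"
    using m by (simp_all add: c_def m_def norm_divide mult.commute[of "cnj _"] flip: complex_norm_square)
      (simp add: power2_eq_square)
  have quad: "0 \<le> Re (h \<phi> \<phi>) + 2 * s * m + s\<^sup>2 * Re (h \<xi> \<xi>)" for s :: real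
  proof -
    have "h (lc 1 \<phi> (s * c) \<xi>) (lc 1 \<phi> (s * c) \<xi>) =
        h \<phi> \<phi> + s * (c * h \<phi> \<xi>) + s * cnj (c * h \<phi> \<xi>) + s * s * (c * cnj c) * h \<xi> \<xi>"
      using l2 herm[of \<phi> \<xi>] by (simp add: left right l2_lc algebra_simps)
    also have "c * cnj c = 1" using c by (simp add: complex_norm_square[symmetric])
    finally have "Re (h (lc 1 \<phi> (s * c) \<xi>) (lc 1 \<phi> (s * c) \<xi>)) = Re (h \<phi> \<phi>) + 2 * s * m + s\<^sup>2 * Re (h \<xi> \<xi>)"
      unfolding c by (simp add: power2_eq_square)
    then show ?thesis using pos[of "lc 1 \<phi> (s * c) \<xi>"] l2 by (simp add: l2_lc)
  qed
  show ?thesis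
  proof (cases "Re (h \<xi> \<xi>) = 0")
    case True
    \<comment> \<open>At this \<open>s\<close> the polynomial, which is affine in the present case,
      takes the value \<open>- 1\<close>, contrary to \<open>quad\<close>.\<close>
    have "- (Re (h \<phi> \<phi>) + 1) / (2 * m) * m * 2 = - (Re (h \<phi> \<phi>) + 1)" using m by simp
    then show ?thesis using quad[of "- (Re (h \<phi> \<phi>) + 1) / (2 * m)"] True m by (simp add: field_simps)
  next
    case False
    then have B: "Re (h \<xi> \<xi>) > 0" using pos[OF l2(2)] by simp
    \<comment> \<open>The polynomial is evaluated at its minimizer.\<close>
    have "0 \<le> Re (h \<phi> \<phi>) - m\<^sup>2 / Re (h \<xi> \<xi>)"
      using quad[of "- m / Re (h \<xi> \<xi>)"] B by (simp add: power2_eq_square field_simps)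
    then show ?thesis using B by (simp add: m_def field_simps)
  qed
qed

end

lemma sesquilinear_form_l2_inner: "sesquilinear_form V (l2_inner V)"
  by standard (auto simp: l2_inner_lc_left l2_inner_lc_right)

lemma l2_cauchy_schwarz:
  assumes "\<phi> \<in> l2 V" "\<xi> \<in> l2 V"
  shows "cmod (l2_inner V \<phi> \<xi>) \<le> l2_norm V \<phi> * l2_norm V \<xi>"
proof -
  interpret sesquilinear_form V "l2_inner V" by (rule sesquilinear_form_l2_inner)
  have "(cmod (l2_inner V \<phi> \<xi>))\<^sup>2 \<le> Re (l2_inner V \<phi> \<phi>) * Re (l2_inner V \<xi> \<xi>)"
    by (rule cauchy_schwarz[OF l2_inner_cnj _ assms]) (simp add: l2_inner_self)
  also have "\<dots> = (l2_norm V \<phi> * l2_norm V \<xi>)\<^sup>2"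
    using assms by (simp add: l2_inner_self power_mult_distrib)
  finally show ?thesis
    by (rule power2_le_imp_le) (simp add: l2_norm_nonneg)
qed

definition linear_op :: "'a set \<Rightarrow> (('a \<Rightarrow> complex) \<Rightarrow> 'a \<Rightarrow> complex) \<Rightarrow> bool" where
  "linear_op V T \<longleftrightarrow> (\<forall>\<phi>\<in>l2 V. T \<phi> \<in> l2 V) \<and>
     (\<forall>\<phi>\<in>l2 V. \<forall>\<xi>\<in>l2 V. \<forall>a b. T (lc a \<phi> b \<xi>) = lc a (T \<phi>) b (T \<xi>))"

lemma linear_op_l2: "linear_op V T \<Longrightarrow> \<phi> \<in> l2 V \<Longrightarrow> T \<phi> \<in> l2 V"
  by (simp add: linear_op_def)

lemma linear_op_lc:
  "linear_op V T \<Longrightarrow> \<phi> \<in> l2 V \<Longrightarrow> \<xi> \<in> l2 V \<Longrightarrow> T (lc a \<phi> b \<xi>) = lc a (T \<phi>) b (T \<xi>)"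
  by (simp add: linear_op_def)

lemma linear_op_comp: "linear_op V S \<Longrightarrow> linear_op V T \<Longrightarrow> linear_op V (\<lambda>\<phi>. S (T \<phi>))"
  by (simp add: linear_op_def)

lemma linear_op_funpow: "linear_op V T \<Longrightarrow> linear_op V (T ^^ n)"
  by (induction n) (auto simp: linear_op_def)

lemma l2_bounded_op_iff:
  "l2_bounded_op V T \<longleftrightarrow> linear_op V T \<and> (\<exists>C. \<forall>\<phi>\<in>l2 V. l2_norm V (T \<phi>) \<le> C * l2_norm V \<phi>)"
  by (simp add: l2_bounded_op_def linear_op_def lc_def)

lemma sesquilinear_form_op:
  assumes "linear_op V T" shows "sesquilinear_form V (\<lambda>\<phi> \<xi>. l2_inner V \<phi> (T \<xi>))"
  by standard (auto simp: l2_inner_lc_left l2_inner_lc_right linear_op_lc[OF assms] linear_op_l2[OF assms])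

lemma polarization_op:
  assumes "linear_op V T" "\<phi> \<in> l2 V" "\<xi> \<in> l2 V"
  shows "polar (\<lambda>\<eta>. l2_inner V \<eta> (T \<eta>)) \<phi> \<xi> = l2_inner V \<phi> (T \<xi>)"
  using sesquilinear_form.polarization[OF sesquilinear_form_op[OF assms(1)] assms(2,3)] .

lemma (in sesquilinear_form) finite_support:
  assumes "finite F" "F \<subseteq> V" "\<And>v. v \<notin> F \<Longrightarrow> \<phi> v = 0" "\<xi> \<in> l2 V"
  shows "h \<phi> \<xi> = (\<Sum>v\<in>F. cnj (\<phi> v) * h (delta v) \<xi>)"
  using assms
proof (induction F arbitrary: \<phi> rule: finite_induct)
  case empty
  then have e: "\<phi> = lc 0 \<xi> 0 \<xi>" by (auto simp: lc_def)
  have "h (lc 0 \<xi> 0 \<xi>) \<xi> = 0" using empty left[of \<xi> \<xi> \<xi> 0 0] by simp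
  then show ?case unfolding e by simp
next
  case (insert x F)
  define \<phi>' where "\<phi>' = \<phi>(x := 0)"
  have l2: "\<phi>' \<in> l2 V" "delta x \<in> l2 V"
    using insert by (auto simp: \<phi>'_def intro!: l2_finite_support[of F] delta_l2)
  have "\<phi> = lc 1 \<phi>' (\<phi> x) (delta x)" by (auto simp: lc_def \<phi>'_def delta_apply)
  then have "h \<phi> \<xi> = h \<phi>' \<xi> + cnj (\<phi> x) * h (delta x) \<xi>"
    using left[OF insert.prems(3) l2, of 1 "\<phi> x"] by simp
  also have "h \<phi>' \<xi> = (\<Sum>v\<in>F. cnj (\<phi>' v) * h (delta v) \<xi>)"
    using insert by (intro insert.IH) (auto simp: \<phi>'_def)
  also have "\<dots> = (\<Sum>v\<in>F. cnj (\<phi> v) * h (delta v) \<xi>)"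
    using insert by (intro sum.cong) (auto simp: \<phi>'_def)
  finally show ?case using insert by (simp add: add.commute)
qed

text \<open>The Riesz representation in coordinates: the image of \<open>\<xi>\<close> is read off
  from the values of the form at the canonical basis.\<close>

definition form_op :: "'a set \<Rightarrow> (('a \<Rightarrow> complex) \<Rightarrow> ('a \<Rightarrow> complex) \<Rightarrow> complex) \<Rightarrow>
    ('a \<Rightarrow> complex) \<Rightarrow> 'a \<Rightarrow> complex" where
  "form_op V h \<xi> = (\<lambda>v. if v \<in> V then h (delta v) \<xi> else 0)"

locale contractive_form = sesquilinear_form +
  assumes bound: "\<And>\<phi> \<xi>. \<phi> \<in> l2 V \<Longrightarrow> \<xi> \<in> l2 V \<Longrightarrow> cmod (h \<phi> \<xi>) \<le> l2_norm V \<phi> * l2_norm V \<xi>"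
begin

text \<open>Testing the form with the truncation \<open>\<eta>\<close> of the candidate to
  \<open>F\<close> yields the sum \<open>s\<close> itself, whereas contractivity bounds it by
  \<open>sqrt s\<close> times the norm of \<open>\<xi>\<close>.\<close>

lemma form_op_sum_le:
  assumes "finite F" "F \<subseteq> V" "\<xi> \<in> l2 V"
  shows "(\<Sum>v\<in>F. (cmod (form_op V h \<xi> v))\<^sup>2) \<le> (l2_norm V \<xi>)\<^sup>2"
proof -
  define \<eta> where "\<eta> v = (if v \<in> F then form_op V h \<xi> v else 0)" for v
  have l2: "\<eta> \<in> l2 V" using assms by (intro l2_finite_support[of F]) (auto simp: \<eta>_def)
  define s where "s = (\<Sum>v\<in>F. (cmod (form_op V h \<xi> v))\<^sup>2)"
  have s0: "0 \<le> s" by (simp add: s_def sum_nonneg)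
  have "complex_of_real ((l2_norm V \<eta>)\<^sup>2) = (\<Sum>v\<in>F. cnj (\<eta> v) * \<eta> v)"
    unfolding l2_inner_self[OF l2, symmetric] using assms by (intro l2_inner_finite_support) (auto simp: \<eta>_def)
  also have "\<dots> = (\<Sum>v\<in>F. complex_of_real ((cmod (form_op V h \<xi> v))\<^sup>2))"
    by (intro sum.cong refl) (simp add: \<eta>_def complex_norm_square mult.commute del: of_real_power)
  also have "\<dots> = complex_of_real s" by (simp add: s_def)
  finally have n: "(l2_norm V \<eta>)\<^sup>2 = s" by (simp only: of_real_eq_iff)
  have "h \<eta> \<xi> = (\<Sum>v\<in>F. cnj (\<eta> v) * h (delta v) \<xi>)"
    using assms by (intro finite_support) (auto simp: \<eta>_def)
  also have "\<dots> = (\<Sum>v\<in>F. complex_of_real ((cmod (form_op V h \<xi> v))\<^sup>2))"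
    using assms(2)
    by (intro sum.cong refl) (auto simp: \<eta>_def form_op_def complex_norm_square mult.commute simp del: of_real_power)
  finally have "h \<eta> \<xi> = complex_of_real s" by (simp add: s_def)
  then have "s \<le> l2_norm V \<eta> * l2_norm V \<xi>" using bound[OF l2 assms(3)] s0 by simp
  then have "s\<^sup>2 \<le> (l2_norm V \<eta> * l2_norm V \<xi>)\<^sup>2" using s0 by (rule power_mono)
  then have "s * s \<le> s * (l2_norm V \<xi>)\<^sup>2" by (simp add: power_mult_distrib n power2_eq_square[of s])
  then have "s \<le> (l2_norm V \<xi>)\<^sup>2" using s0 by (cases "s = 0") auto
  then show ?thesis by (simp add: s_def)
qed

lemma form_op_l2: assumes "\<xi> \<in> l2 V" shows "form_op V h \<xi> \<in> l2 V"
proof (rule l2I)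
  show "(\<lambda>v. (cmod (form_op V h \<xi> v))\<^sup>2) summable_on V"
    by (rule nonneg_bdd_above_summable_on)
       (auto intro!: bdd_aboveI[of _ "(l2_norm V \<xi>)\<^sup>2"] form_op_sum_le assms)
qed (simp add: form_op_def)

lemma form_op_norm: assumes "\<xi> \<in> l2 V" shows "l2_norm V (form_op V h \<xi>) \<le> l2_norm V \<xi>"
proof (rule power2_le_imp_le)
  show "(l2_norm V (form_op V h \<xi>))\<^sup>2 \<le> (l2_norm V \<xi>)\<^sup>2"
    unfolding l2_norm_square[of V "form_op V h \<xi>"]
    by (rule infsum_le_finite_sums) (use form_op_sum_le form_op_l2[OF assms] assms in \<open>auto intro: l2_summable\<close>)
qed (rule l2_norm_nonneg)

text \<open>Both sides agree when \<open>\<phi>\<close> has finite support. The rest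
  \<open>\<beta>\<close> of a general \<open>\<phi>\<close> can be made small in norm, and both
  sides at \<open>\<beta>\<close> are bounded by the product of the norms of \<open>\<beta>\<close>
  and \<open>\<xi>\<close>.\<close>

lemma l2_inner_form_op:
  assumes \<phi>: "\<phi> \<in> l2 V" and \<xi>: "\<xi> \<in> l2 V"
  shows "l2_inner V \<phi> (form_op V h \<xi>) = h \<phi> \<xi>"
proof -
  let ?T = "form_op V h \<xi>" and ?n = "l2_norm V \<xi>"
  note T = form_op_l2[OF \<xi>]
  have eps: "cmod (l2_inner V \<phi> ?T - h \<phi> \<xi>) \<le> 2 * e * ?n" if e: "e > 0" for e
  proof -
    have "\<exists>F. finite F \<and> F \<subseteq> V \<and> dist (\<Sum>v\<in>F. (cmod (\<phi> v))\<^sup>2) (\<Sum>\<^sub>\<infinity>v\<in>V. (cmod (\<phi> v))\<^sup>2) \<le> e\<^sup>2"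
      using l2_summable[OF \<phi>] e by (intro infsum_finite_approximation) auto
    then obtain F where F: "finite F" "F \<subseteq> V"
        "dist (\<Sum>v\<in>F. (cmod (\<phi> v))\<^sup>2) (\<Sum>\<^sub>\<infinity>v\<in>V. (cmod (\<phi> v))\<^sup>2) \<le> e\<^sup>2" by blast
    define \<alpha> where "\<alpha> v = (if v \<in> F then \<phi> v else 0)" for v
    define \<beta> where "\<beta> v = (if v \<in> F then 0 else \<phi> v)" for v
    have \<alpha>: "\<alpha> \<in> l2 V" using F by (intro l2_finite_support[of F]) (auto simp: \<alpha>_def)
    have "\<beta> = lc 1 \<phi> (- 1) \<alpha>" by (auto simp: lc_def \<alpha>_def \<beta>_def)
    then have \<beta>: "\<beta> \<in> l2 V" using l2_lc[OF \<phi> \<alpha>] by simp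
    have \<phi>e: "\<phi> = lc 1 \<alpha> 1 \<beta>" by (auto simp: lc_def \<alpha>_def \<beta>_def)
    have "(l2_norm V \<beta>)\<^sup>2 = (\<Sum>\<^sub>\<infinity>v\<in>V - F. (cmod (\<phi> v))\<^sup>2)"
      unfolding l2_norm_square by (rule infsum_cong_neutral) (use F in \<open>auto simp: \<beta>_def\<close>)
    also have "\<dots> = (\<Sum>\<^sub>\<infinity>v\<in>V. (cmod (\<phi> v))\<^sup>2) - (\<Sum>v\<in>F. (cmod (\<phi> v))\<^sup>2)"
      using F l2_summable[OF \<phi>] by (subst infsum_Diff) auto
    also have "\<dots> \<le> e\<^sup>2" using F(3) unfolding dist_real_def by linarith
    finally have ne: "l2_norm V \<beta> \<le> e" by (rule power2_le_imp_le) (use e in simp)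
    have "l2_inner V \<alpha> ?T = (\<Sum>v\<in>F. cnj (\<alpha> v) * ?T v)"
      using F by (intro l2_inner_finite_support) (auto simp: \<alpha>_def)
    also have "\<dots> = (\<Sum>v\<in>F. cnj (\<alpha> v) * h (delta v) \<xi>)"
      using F by (intro sum.cong) (auto simp: form_op_def)
    also have "\<dots> = h \<alpha> \<xi>"
      using F \<xi> by (intro finite_support[symmetric]) (auto simp: \<alpha>_def)
    finally have "l2_inner V \<phi> ?T - h \<phi> \<xi> = l2_inner V \<beta> ?T - h \<beta> \<xi>"
      unfolding \<phi>e by (simp add: l2_inner_lc_left[OF T \<alpha> \<beta>] left[OF \<xi> \<alpha> \<beta>])
    also have "cmod \<dots> \<le> cmod (l2_inner V \<beta> ?T) + cmod (h \<beta> \<xi>)" by (rule norm_triangle_ineq4)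
    also have "cmod (l2_inner V \<beta> ?T) \<le> l2_norm V \<beta> * l2_norm V ?T" by (rule l2_cauchy_schwarz[OF \<beta> T])
    also have "\<dots> \<le> e * ?n" using form_op_norm[OF \<xi>] ne e by (intro mult_mono) (auto simp: l2_norm_nonneg)
    also have "cmod (h \<beta> \<xi>) \<le> l2_norm V \<beta> * ?n" by (rule bound[OF \<beta> \<xi>])
    also have "\<dots> \<le> e * ?n" using ne by (intro mult_right_mono) (auto simp: l2_norm_nonneg)
    finally show ?thesis by simp
  qed
  have "cmod (l2_inner V \<phi> ?T - h \<phi> \<xi>) \<le> 0 + d" if d: "d > 0" for d
  proof -
    \<comment> \<open>The summand 1 keeps \<open>m\<close> positive when \<open>\<xi>\<close> is
      0.\<close>
    define m where "m = 2 * ?n + 1"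
    have m: "m > 0" "2 * ?n \<le> m" using l2_norm_nonneg[of V \<xi>] by (auto simp: m_def)
    then have "d / m > 0" using d by simp
    then have "cmod (l2_inner V \<phi> ?T - h \<phi> \<xi>) \<le> d / m * (2 * ?n)" using eps[of "d / m"] by (simp add: mult_ac)
    also have "\<dots> \<le> d / m * m" using m d by (intro mult_left_mono) auto
    also have "\<dots> = d" using m by simp
    finally show ?thesis by simp
  qed
  then have "cmod (l2_inner V \<phi> ?T - h \<phi> \<xi>) \<le> 0" by (rule field_le_epsilon)
  then show ?thesis by simp
qed

lemma linear_op_form_op: "linear_op V (form_op V h)"
  unfolding linear_op_def
proof (intro conjI ballI allI)
  fix \<phi> \<xi> a b assume "\<phi> \<in> l2 V" "\<xi> \<in> l2 V"
  then show "form_op V h (lc a \<phi> b \<xi>) = lc a (form_op V h \<phi>) b (form_op V h \<xi>)"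
    by (intro ext) (simp add: form_op_def right delta_l2, simp add: lc_def)
qed (rule form_op_l2)

end

subsection \<open>Moments of a projection-valued measure\<close>

lemma integral_like_polar:
  assumes "\<And>\<eta>. \<eta> \<in> l2 V \<Longrightarrow> integral_like a b (\<Lambda> \<eta>)" "\<phi> \<in> l2 V" "\<xi> \<in> l2 V"
  shows "integral_like a b (\<lambda>f. polar (\<lambda>\<eta>. \<Lambda> \<eta> f) \<phi> \<xi>)"
proof -
  have e: "polar (\<lambda>\<eta>. \<Lambda> \<eta> f) \<phi> \<xi> = 1 * (1 / 4 * \<Lambda> (lc 1 \<phi> 1 \<xi>) f + (- \<i> / 4) * \<Lambda> (lc 1 \<phi> \<i> \<xi>) f) +
      1 * ((- 1 / 4) * \<Lambda> (lc 1 \<phi> (- 1) \<xi>) f + (\<i> / 4) * \<Lambda> (lc 1 \<phi> (- \<i>) \<xi>) f)" for f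
    unfolding polar_def by (simp add: field_simps)
  have "integral_like a b (\<lambda>f. 1 * (1 / 4 * \<Lambda> (lc 1 \<phi> 1 \<xi>) f + (- \<i> / 4) * \<Lambda> (lc 1 \<phi> \<i> \<xi>) f) +
      1 * ((- 1 / 4) * \<Lambda> (lc 1 \<phi> (- 1) \<xi>) f + (\<i> / 4) * \<Lambda> (lc 1 \<phi> (- \<i>) \<xi>) f))"
    using assms by (intro integral_like_combination) (auto simp: l2_lc)
  then show ?thesis unfolding e .
qed

lemma integral_like_cnj:
  assumes "integral_like a b \<Lambda>" shows "integral_like a b (\<lambda>f. cnj (\<Lambda> f))"
  unfolding integral_like_def
proof (intro conjI allI impI)
  fix f g c d assume "bounded_borel a b f" "bounded_borel a b g"
  then show "cnj (\<Lambda> (\<lambda>x. c * f x + d * g x)) = of_real c * cnj (\<Lambda> f) + of_real d * cnj (\<Lambda> g)"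
    by (simp add: integral_like_linear[OF assms])
next
  fix f g K
  assume "\<forall>n::nat. bounded_borel a b (f n)" "bounded_borel a b g"
    "\<forall>n. \<forall>x\<in>{a..b}. \<bar>f n x\<bar> \<le> K" "\<forall>x\<in>{a..b}. (\<lambda>n. f n x) \<longlonglongrightarrow> g x"
  then show "(\<lambda>n. cnj (\<Lambda> (f n))) \<longlonglongrightarrow> cnj (\<Lambda> g)"
    by (intro tendsto_cnj integral_like_limit[OF assms, where K = K]) auto
qed

locale pvm =
  fixes V :: "'a set" and P :: "real set \<Rightarrow> ('a \<Rightarrow> complex) \<Rightarrow> 'a \<Rightarrow> complex"
  assumes pvm: "projection_valued_measure V P"
begin

lemma linear: "B \<in> sets borel \<Longrightarrow> linear_op V (P B)"
  using pvm by (simp add: projection_valued_measure_def l2_orthogonal_projection_def l2_bounded_op_iff)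

lemma l2: "B \<in> sets borel \<Longrightarrow> \<phi> \<in> l2 V \<Longrightarrow> P B \<phi> \<in> l2 V"
  using linear linear_op_l2 by blast

lemma idem: "B \<in> sets borel \<Longrightarrow> \<phi> \<in> l2 V \<Longrightarrow> P B (P B \<phi>) = P B \<phi>"
  using pvm by (simp add: projection_valued_measure_def l2_orthogonal_projection_def)

lemma sym: "B \<in> sets borel \<Longrightarrow> \<phi> \<in> l2 V \<Longrightarrow> \<xi> \<in> l2 V \<Longrightarrow> l2_inner V \<xi> (P B \<phi>) = l2_inner V (P B \<xi>) \<phi>"
  using pvm by (simp add: projection_valued_measure_def l2_orthogonal_projection_def)

lemma P_UNIV: "\<phi> \<in> l2 V \<Longrightarrow> P UNIV \<phi> = \<phi>"
  using pvm by (simp add: projection_valued_measure_def)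

lemma sigma_additive:
  "\<phi> \<in> l2 V \<Longrightarrow> range B \<subseteq> sets borel \<Longrightarrow> disjoint_family B \<Longrightarrow>
    (\<lambda>n::nat. l2_inner V \<phi> (P (B n) \<phi>)) sums l2_inner V \<phi> (P (\<Union>n. B n) \<phi>)"
  using pvm by (simp add: projection_valued_measure_def)

lemma inner_P:
  assumes "B \<in> sets borel" "\<phi> \<in> l2 V"
  shows "l2_inner V \<phi> (P B \<phi>) = complex_of_real ((l2_norm V (P B \<phi>))\<^sup>2)"
proof -
  have "l2_inner V \<phi> (P B \<phi>) = l2_inner V \<phi> (P B (P B \<phi>))" using assms by (simp add: idem)
  also have "\<dots> = l2_inner V (P B \<phi>) (P B \<phi>)" using assms by (intro sym l2)
  finally show ?thesis using assms by (simp add: l2_inner_self l2)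
qed

definition \<nu> :: "('a \<Rightarrow> complex) \<Rightarrow> real measure" where "\<nu> = diagonal_measure V P"

lemma sets_\<nu> [simp, measurable_cong]: "sets (\<nu> \<phi>) = sets borel"
  by (simp add: \<nu>_def diagonal_measure_def sets_measure_of sets.sigma_sets_eq[of borel, simplified])

lemma space_\<nu> [simp]: "space (\<nu> \<phi>) = UNIV"
  by (simp add: \<nu>_def diagonal_measure_def space_measure_of_conv)

text \<open>Countable additivity for the constant family of empty sets makes a constant series
  convergent, which forces its term to be 0.\<close>

lemma P_empty: assumes "\<phi> \<in> l2 V" shows "l2_inner V \<phi> (P {} \<phi>) = 0"
proof -
  have "(\<lambda>n::nat. l2_inner V \<phi> (P {} \<phi>)) sums l2_inner V \<phi> (P (\<Union>n::nat. {}) \<phi>)"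
    by (rule sigma_additive[OF assms]) (auto simp: disjoint_family_on_def)
  then show ?thesis using sums_summable summable_const_iff by blast
qed

lemma emeasure_\<nu>:
  assumes "\<phi> \<in> l2 V" "B \<in> sets borel"
  shows "emeasure (\<nu> \<phi>) B = ennreal ((l2_norm V (P B \<phi>))\<^sup>2)"
proof -
  have r: "Re (l2_inner V \<phi> (P B \<phi>)) = (l2_norm V (P B \<phi>))\<^sup>2" if "B \<in> sets borel" for B
    using that assms by (simp add: inner_P)
  have "emeasure (\<nu> \<phi>) B = ennreal (Re (l2_inner V \<phi> (P B \<phi>)))"
    unfolding \<nu>_def diagonal_measure_def
  proof (rule emeasure_measure_of_sigma)
    show "sigma_algebra UNIV (sets borel)" using sets.sigma_algebra_axioms[of borel] by simp
    show "positive (sets borel) (\<lambda>B. ennreal (Re (l2_inner V \<phi> (P B \<phi>))))"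
      by (simp add: positive_def P_empty assms)
    show "countably_additive (sets borel) (\<lambda>B. ennreal (Re (l2_inner V \<phi> (P B \<phi>))))"
      unfolding countably_additive_def
    proof (intro allI impI)
      fix A :: "nat \<Rightarrow> real set"
      assume A: "range A \<subseteq> sets borel" "disjoint_family A" "\<Union> (range A) \<in> sets borel"
      have "(\<lambda>n. Re (l2_inner V \<phi> (P (A n) \<phi>))) sums Re (l2_inner V \<phi> (P (\<Union>n. A n) \<phi>))"
        by (intro sums_Re sigma_additive assms A)
      moreover have "0 \<le> Re (l2_inner V \<phi> (P (A n) \<phi>))" for n using A by (subst r) auto
      ultimately show "(\<Sum>n. ennreal (Re (l2_inner V \<phi> (P (A n) \<phi>)))) = ennreal (Re (l2_inner V \<phi> (P (\<Union> (range A)) \<phi>)))"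
        by (intro suminf_ennreal_eq)
    qed
  qed (use assms in auto)
  then show ?thesis using r assms by simp
qed

lemma finite_\<nu>: "\<phi> \<in> l2 V \<Longrightarrow> finite_measure (\<nu> \<phi>)"
  by (intro finite_measureI) (simp add: emeasure_\<nu>)

lemma measure_\<nu>: "\<phi> \<in> l2 V \<Longrightarrow> B \<in> sets borel \<Longrightarrow> measure (\<nu> \<phi>) B = (l2_norm V (P B \<phi>))\<^sup>2"
  by (simp add: measure_def emeasure_\<nu>)

lemma inner_P': "\<phi> \<in> l2 V \<Longrightarrow> B \<in> sets borel \<Longrightarrow> l2_inner V \<phi> (P B \<phi>) = complex_of_real (measure (\<nu> \<phi>) B)"
  by (simp add: inner_P measure_\<nu>)

text \<open>The diagonal measure of \<open>P B \<phi>\<close> has its whole mass on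
  \<open>B\<close>, since \<open>P B\<close> fixes this vector; nothing is left for
  \<open>D\<close>.\<close>

lemma disjoint_0:
  assumes B: "B \<in> sets borel" "D \<in> sets borel" "B \<inter> D = {}" and \<phi>: "\<phi> \<in> l2 V"
  shows "P D (P B \<phi>) = (\<lambda>v. 0)"
proof -
  define \<eta> where "\<eta> = P B \<phi>"
  have \<eta>: "\<eta> \<in> l2 V" using B \<phi> by (simp add: \<eta>_def l2)
  interpret finite_measure "\<nu> \<eta>" by (rule finite_\<nu>[OF \<eta>])
  have "measure (\<nu> \<eta>) B = (l2_norm V \<eta>)\<^sup>2"
    using B \<phi> \<eta> by (simp add: measure_\<nu>) (simp add: \<eta>_def idem)
  moreover have "measure (\<nu> \<eta>) UNIV = (l2_norm V \<eta>)\<^sup>2" using \<eta> by (simp add: measure_\<nu> P_UNIV)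
  moreover have "measure (\<nu> \<eta>) (B \<union> D) = measure (\<nu> \<eta>) B + measure (\<nu> \<eta>) D"
    using B by (intro finite_measure_Union) auto
  moreover have "measure (\<nu> \<eta>) (B \<union> D) \<le> measure (\<nu> \<eta>) UNIV" by (rule finite_measure_mono) auto
  ultimately have "(l2_norm V (P D \<eta>))\<^sup>2 \<le> 0" using B \<eta> by (simp add: measure_\<nu>)
  then have "l2_norm V (P D \<eta>) = 0" by simp
  then have "P D \<eta> = (\<lambda>v. 0)" by (rule l2_norm_eq_0[OF l2[OF B(2) \<eta>]])
  then show ?thesis by (simp add: \<eta>_def)
qed

text \<open>Additivity is given for diagonal matrix elements, and polarization extends it to all the
  others.\<close>

lemma union:
  assumes B: "B \<in> sets borel" "D \<in> sets borel" "B \<inter> D = {}" and \<phi>: "\<phi> \<in> l2 V"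
  shows "P (B \<union> D) \<phi> = lc 1 (P B \<phi>) 1 (P D \<phi>)"
proof (rule l2_eqI)
  have lin: "linear_op V (\<lambda>\<phi>. lc 1 (P B \<phi>) 1 (P D \<phi>))"
    unfolding linear_op_def using B
    by (auto simp: l2 l2_lc linear_op_lc[OF linear]) (auto simp: lc_def algebra_simps)
  fix \<eta> assume \<eta>: "\<eta> \<in> l2 V"
  have "l2_inner V \<eta> (P (B \<union> D) \<phi>) = polar (\<lambda>\<eta>. l2_inner V \<eta> (P (B \<union> D) \<eta>)) \<eta> \<phi>"
    using B \<eta> \<phi> by (intro polarization_op[symmetric] linear) auto
  also have "\<dots> = polar (\<lambda>\<eta>. l2_inner V \<eta> (lc 1 (P B \<eta>) 1 (P D \<eta>))) \<eta> \<phi>"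
  proof (rule polar_cong[OF _ \<eta> \<phi>])
    fix \<eta> assume \<eta>: "\<eta> \<in> l2 V"
    interpret finite_measure "\<nu> \<eta>" by (rule finite_\<nu>[OF \<eta>])
    show "l2_inner V \<eta> (P (B \<union> D) \<eta>) = l2_inner V \<eta> (lc 1 (P B \<eta>) 1 (P D \<eta>))"
      using B \<eta> by (simp add: l2_inner_lc_right l2 inner_P' finite_measure_Union)
  qed
  also have "\<dots> = l2_inner V \<eta> (lc 1 (P B \<phi>) 1 (P D \<phi>))" using \<eta> \<phi> by (rule polarization_op[OF lin])
  finally show "l2_inner V \<eta> (P (B \<union> D) \<phi>) = l2_inner V \<eta> (lc 1 (P B \<phi>) 1 (P D \<phi>))" .
qed (use B \<phi> in \<open>auto simp: l2 l2_lc\<close>)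

lemma subset_comp:
  assumes "B \<in> sets borel" "D \<in> sets borel" "D \<subseteq> B" and \<phi>: "\<phi> \<in> l2 V"
  shows "P D (P B \<phi>) = P D \<phi>"
proof -
  have "lc 1 (P B \<phi>) 1 (P (- B) \<phi>) = \<phi>"
    using union[of B "- B" \<phi>] assms P_UNIV by (simp add: Compl_partition borel_comp)
  then have "P D \<phi> = P D (lc 1 (P B \<phi>) 1 (P (- B) \<phi>))" by simp
  also have "\<dots> = lc 1 (P D (P B \<phi>)) 1 (P D (P (- B) \<phi>))"
    using assms by (intro linear_op_lc[OF linear[OF assms(2)]] l2) (auto simp: borel_comp)
  also have "P D (P (- B) \<phi>) = (\<lambda>v. 0)" using assms by (intro disjoint_0) (auto simp: borel_comp)
  finally show ?thesis by (simp add: lc_def)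
qed

lemma comp:
  assumes "B \<in> sets borel" "C \<in> sets borel" and \<phi>: "\<phi> \<in> l2 V"
  shows "P C (P B \<phi>) = P (C \<inter> B) \<phi>"
proof -
  have "P C (P B \<phi>) = P ((C \<inter> B) \<union> (C - B)) (P B \<phi>)" by (simp add: Int_Diff_Un)
  also have "\<dots> = lc 1 (P (C \<inter> B) (P B \<phi>)) 1 (P (C - B) (P B \<phi>))"
    using assms by (intro union l2) auto
  also have "P (C \<inter> B) (P B \<phi>) = P (C \<inter> B) \<phi>" using assms by (intro subset_comp) auto
  also have "P (C - B) (P B \<phi>) = (\<lambda>v. 0)" using assms by (intro disjoint_0) auto
  finally show ?thesis by (simp add: lc_def)
qed

lemma measure_\<nu>_P:
  assumes "B \<in> sets borel" "C \<in> sets borel" "\<phi> \<in> l2 V"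
  shows "measure (\<nu> (P B \<phi>)) C = measure (\<nu> \<phi>) (B \<inter> C)"
  using assms by (simp add: measure_\<nu> l2 comp Int_commute)

end

locale pvm_of = pvm +
  fixes A :: "('a \<Rightarrow> complex) \<Rightarrow> 'a \<Rightarrow> complex" and R :: real
  assumes linA: "linear_op V A"
    and conc: "\<And>\<phi>. \<phi> \<in> l2 V \<Longrightarrow> P {-R..R} \<phi> = \<phi>"
    and form: "\<And>\<phi>. \<phi> \<in> l2 V \<Longrightarrow> l2_inner V \<phi> (A \<phi>) = complex_of_real (\<integral>x. x \<partial>\<nu> \<phi>)"
begin

lemma interval_\<nu>: assumes "\<phi> \<in> l2 V" shows "interval_measure_on (- R) R (\<nu> \<phi>)"
proof -
  interpret finite_measure "\<nu> \<phi>" by (rule finite_\<nu>[OF assms])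
  have "P (- {-R..R}) (P {-R..R} \<phi>) = (\<lambda>v. 0)" using assms by (intro disjoint_0) auto
  then have "P (- {-R..R}) \<phi> = (\<lambda>v. 0)" using conc assms by simp
  then have "emeasure (\<nu> \<phi>) (- {-R..R}) = 0"
    by (subst emeasure_\<nu>) (auto simp: assms borel_comp l2_norm_def)
  then have "AE x in \<nu> \<phi>. x \<in> {-R..R}"
    by (subst AE_iff_null) (auto simp: null_sets_def Compl_eq borel_comp)
  then show ?thesis using finite_measure_axioms by (simp add: interval_measure_on_def)
qed

definition \<Lambda> :: "('a \<Rightarrow> complex) \<Rightarrow> (real \<Rightarrow> real) \<Rightarrow> complex" where
  "\<Lambda> \<phi> f = complex_of_real (\<integral>x. f x \<partial>\<nu> \<phi>)"

lemma integral_like_\<Lambda>: "\<phi> \<in> l2 V \<Longrightarrow> integral_like (- R) R (\<Lambda> \<phi>)"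
  using integral_like_integral[OF interval_\<nu>] by (simp add: \<Lambda>_def[abs_def])

lemma \<Lambda>_indicator: "\<phi> \<in> l2 V \<Longrightarrow> B \<in> sets borel \<Longrightarrow> \<Lambda> \<phi> (indicator B) = l2_inner V \<phi> (P B \<phi>)"
  by (simp add: \<Lambda>_def inner_P')

text \<open>\<open>P B\<close> restricts the diagonal measure to \<open>B\<close>; for sets this is
  \<open>measure_\<nu>_P\<close>.\<close>

lemma \<Lambda>_P:
  assumes B: "B \<in> sets borel" and \<phi>: "\<phi> \<in> l2 V" and f: "bounded_borel (- R) R f"
  shows "\<Lambda> (P B \<phi>) f = \<Lambda> \<phi> (\<lambda>x. indicator B x * f x)"
proof (rule integral_like_eq_indicators[OF _ _ _ f])
  show "integral_like (- R) R (\<Lambda> (P B \<phi>))" "integral_like (- R) R (\<lambda>f. \<Lambda> \<phi> (\<lambda>x. indicator B x * f x))"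
    using B \<phi> by (auto intro!: integral_like_\<Lambda> integral_like_mult bounded_borel_indicator l2)
  fix C :: "real set" assume C: "C \<in> sets borel"
  have "(\<lambda>x. indicator B x * indicator C x) = (indicator (B \<inter> C) :: real \<Rightarrow> real)"
    by (auto simp: indicator_def)
  then show "\<Lambda> (P B \<phi>) (indicator C) = \<Lambda> \<phi> (\<lambda>x. indicator B x * indicator C x)"
    using measure_\<nu>_P[OF B C \<phi>] by (simp add: \<Lambda>_def)
qed

text \<open>The diagonal measure of \<open>\<psi> + t \<psi>'\<close> is the sum of those of \<open>\<psi>\<close> and \<open>\<psi>'\<close> for \<open>\<psi>\<close>, \<open>\<psi>'\<close> in the
  ranges of projections of disjoint sets and \<open>\<bar>t\<bar> = 1\<close>, so the quadratic form of \<open>A\<close> is additive on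
  them and has no cross terms.\<close>

lemma A_off_diagonal:
  assumes B: "B \<in> sets borel" "D \<in> sets borel" "B \<inter> D = {}" and \<alpha>: "\<alpha> \<in> l2 V" and \<beta>: "\<beta> \<in> l2 V"
  shows "l2_inner V (P B \<alpha>) (A (P D \<beta>)) = 0"
proof -
  define \<psi> \<psi>' where "\<psi> = P B \<alpha>" and "\<psi>' = P D \<beta>"
  have l2s: "\<psi> \<in> l2 V" "\<psi>' \<in> l2 V" "A \<psi> \<in> l2 V" "A \<psi>' \<in> l2 V"
    using assms by (auto simp: \<psi>_def \<psi>'_def l2 linear_op_l2[OF linA])
  have cross: "l2_inner V \<psi> (P C \<psi>') = 0" "l2_inner V \<psi>' (P C \<psi>) = 0" if C: "C \<in> sets borel" for C
  proof -
    have "P C \<psi>' = P (C \<inter> D) \<beta>" "P C \<psi> = P (C \<inter> B) \<alpha>"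
      using assms C by (auto simp: \<psi>_def \<psi>'_def comp)
    moreover have "P B (P (C \<inter> D) \<beta>) = (\<lambda>v. 0)" "P D (P (C \<inter> B) \<alpha>) = (\<lambda>v. 0)"
      using assms C by (auto intro!: disjoint_0)
    ultimately have "P B (P C \<psi>') = (\<lambda>v. 0)" "P D (P C \<psi>) = (\<lambda>v. 0)" by simp_all
    then show "l2_inner V \<psi> (P C \<psi>') = 0" "l2_inner V \<psi>' (P C \<psi>) = 0"
      using sym[OF B(1) l2[OF C l2s(2)] \<alpha>] sym[OF B(2) l2[OF C l2s(1)] \<beta>]
      unfolding \<psi>_def[symmetric] \<psi>'_def[symmetric] by (simp_all add: l2_inner_def)
  qed
  have key: "t * l2_inner V \<psi> (A \<psi>') + cnj t * l2_inner V \<psi>' (A \<psi>) = 0" if t: "cnj t * t = 1" for t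
  proof -
    have l: "lc 1 \<psi> t \<psi>' \<in> l2 V" using l2s by (simp add: l2_lc)
    have "\<Lambda> (lc 1 \<psi> t \<psi>') (\<lambda>x. x ^ 1) = 1 * \<Lambda> \<psi> (\<lambda>x. x ^ 1) + 1 * \<Lambda> \<psi>' (\<lambda>x. x ^ 1)"
    proof (rule integral_like_eq_indicators[where \<Lambda>' = "\<lambda>f. 1 * \<Lambda> \<psi> f + 1 * \<Lambda> \<psi>' f" and a = "- R" and b = R])
      fix C :: "real set" assume C: "C \<in> sets borel"
      have "l2_inner V (lc 1 \<psi> t \<psi>') (P C (lc 1 \<psi> t \<psi>')) =
          l2_inner V \<psi> (P C \<psi>) + (cnj t * t) * l2_inner V \<psi>' (P C \<psi>')"
        using l2s C by (simp add: linear_op_lc[OF linear] l2_inner_lc_left l2_inner_lc_right l2 l2_lc cross algebra_simps)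
      then show "\<Lambda> (lc 1 \<psi> t \<psi>') (indicator C) = 1 * \<Lambda> \<psi> (indicator C) + 1 * \<Lambda> \<psi>' (indicator C)"
        using l2s C l t by (simp add: \<Lambda>_indicator)
    qed (intro integral_like_\<Lambda> integral_like_combination bounded_borel_power l2s l)+
    then have "l2_inner V (lc 1 \<psi> t \<psi>') (A (lc 1 \<psi> t \<psi>')) = l2_inner V \<psi> (A \<psi>) + l2_inner V \<psi>' (A \<psi>')"
      using l2s l by (simp add: form \<Lambda>_def)
    moreover have "l2_inner V (lc 1 \<psi> t \<psi>') (A (lc 1 \<psi> t \<psi>')) =
        l2_inner V \<psi> (A \<psi>) + (cnj t * t) * l2_inner V \<psi>' (A \<psi>') +
        (t * l2_inner V \<psi> (A \<psi>') + cnj t * l2_inner V \<psi>' (A \<psi>))"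
      using l2s by (simp add: linear_op_lc[OF linA] l2_inner_lc_left l2_inner_lc_right l2_lc algebra_simps)
    ultimately show ?thesis using t by simp
  qed
  \<comment> \<open>The phases 1 and \<open>\<i>\<close> yield the sum and the difference of the two
    cross terms, so each of them vanishes.\<close>
  have "l2_inner V \<psi> (A \<psi>') + l2_inner V \<psi>' (A \<psi>) = 0" using key[of 1] by simp
  moreover have "\<i> * (l2_inner V \<psi> (A \<psi>') - l2_inner V \<psi>' (A \<psi>)) = 0"
    using key[of \<i>] by (simp add: algebra_simps)
  then have "l2_inner V \<psi> (A \<psi>') - l2_inner V \<psi>' (A \<psi>) = 0" by simp
  ultimately have "2 * l2_inner V \<psi> (A \<psi>') = 0" by (simp add: algebra_simps)
  then show ?thesis by (simp add: \<psi>_def \<psi>'_def)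
qed

text \<open>The off-diagonal blocks of \<open>A\<close> vanish, so the pairing of
  \<open>P B \<phi>\<close> with \<open>A \<phi>\<close> only sees \<open>A\<close> on the range of
  \<open>P B\<close>, where the form is the first moment of the restricted measure.\<close>

lemma inner_P_A:
  assumes B: "B \<in> sets borel" and \<phi>: "\<phi> \<in> l2 V"
  shows "l2_inner V \<phi> (P B (A \<phi>)) = \<Lambda> \<phi> (\<lambda>x. indicator B x * x)"
proof -
  have cB: "- B \<in> sets borel" using B by (rule borel_comp)
  note l2s = l2[OF B \<phi>] l2[OF cB \<phi>]
  have "\<phi> = lc 1 (P B \<phi>) 1 (P (- B) \<phi>)"
    using union[of B "- B" \<phi>] B cB \<phi> P_UNIV by (simp add: Compl_partition)
  then have "A \<phi> = lc 1 (A (P B \<phi>)) 1 (A (P (- B) \<phi>))"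
    using linear_op_lc[OF linA l2s] by metis
  then have "l2_inner V (P B \<phi>) (A \<phi>) = l2_inner V (P B \<phi>) (A (P B \<phi>))"
    using l2s A_off_diagonal[OF B cB _ \<phi> \<phi>] by (simp add: l2_inner_lc_right linear_op_l2[OF linA])
  also have "\<dots> = \<Lambda> (P B \<phi>) (\<lambda>x. x ^ 1)" using l2s by (simp add: form \<Lambda>_def)
  also have "\<dots> = \<Lambda> \<phi> (\<lambda>x. indicator B x * x ^ 1)" by (rule \<Lambda>_P[OF B \<phi> bounded_borel_power])
  finally show ?thesis using sym[OF B linear_op_l2[OF linA \<phi>] \<phi>] by simp
qed

text \<open>\<open>\<Gamma> \<eta> \<xi>\<close> is the complex spectral measure of a pair of
  vectors. Applying \<open>A\<close> to \<open>\<xi>\<close> multiplies this measure by the density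
  \<open>x\<close>, as is checked on indicators, and iteration produces the powers. This is how the
  quadratic form alone determines all moments.\<close>

lemma moments:
  assumes \<phi>: "\<phi> \<in> l2 V"
  shows "complex_of_real (\<integral>x. x ^ k \<partial>\<nu> \<phi>) = l2_inner V \<phi> ((A ^^ k) \<phi>)"
proof -
  define \<Gamma> where "\<Gamma> \<eta> \<xi> f = polar (\<lambda>\<eta>. \<Lambda> \<eta> f) \<eta> \<xi>" for \<eta> \<xi> f
  have il: "integral_like (- R) R (\<Gamma> \<eta> \<xi>)" if "\<eta> \<in> l2 V" "\<xi> \<in> l2 V" for \<eta> \<xi>
    unfolding \<Gamma>_def[abs_def] using that by (intro integral_like_polar[of V] integral_like_\<Lambda>)
  have ind: "\<Gamma> \<eta> \<xi> (indicator B) = l2_inner V \<eta> (P B \<xi>)" if "\<eta> \<in> l2 V" "\<xi> \<in> l2 V" "B \<in> sets borel" for \<eta> \<xi> B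
  proof -
    have "\<Gamma> \<eta> \<xi> (indicator B) = polar (\<lambda>\<eta>. l2_inner V \<eta> (P B \<eta>)) \<eta> \<xi>"
      unfolding \<Gamma>_def by (rule polar_cong[OF _ that(1,2)]) (simp add: \<Lambda>_indicator that)
    then show ?thesis using that by (simp add: polarization_op linear)
  qed
  have step: "\<Gamma> \<eta> (A \<xi>) f = \<Gamma> \<eta> \<xi> (\<lambda>x. x ^ 1 * f x)"
    if l2s: "\<eta> \<in> l2 V" "\<xi> \<in> l2 V" and f: "bounded_borel (- R) R f" for \<eta> \<xi> f
  proof (rule integral_like_eq_indicators[OF _ _ _ f])
    have A\<xi>: "A \<xi> \<in> l2 V" using l2s linear_op_l2[OF linA] by simp
    show "integral_like (- R) R (\<Gamma> \<eta> (A \<xi>))" by (rule il[OF l2s(1) A\<xi>])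
    show "integral_like (- R) R (\<lambda>f. \<Gamma> \<eta> \<xi> (\<lambda>x. x ^ 1 * f x))"
      by (intro integral_like_mult il l2s bounded_borel_power)
    fix B :: "real set" assume B: "B \<in> sets borel"
    have "\<Gamma> \<eta> (A \<xi>) (indicator B) = l2_inner V \<eta> (P B (A \<xi>))" by (rule ind[OF l2s(1) A\<xi> B])
    also have "\<dots> = polar (\<lambda>\<eta>. l2_inner V \<eta> (P B (A \<eta>))) \<eta> \<xi>"
      by (rule polarization_op[OF linear_op_comp[OF linear[OF B] linA] l2s, symmetric])
    also have "\<dots> = \<Gamma> \<eta> \<xi> (\<lambda>x. x ^ 1 * indicator B x)"
      unfolding \<Gamma>_def by (rule polar_cong[OF _ l2s]) (simp add: inner_P_A B mult.commute)
    finally show "\<Gamma> \<eta> (A \<xi>) (indicator B) = \<Gamma> \<eta> \<xi> (\<lambda>x. x ^ 1 * indicator B x)" .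
  qed
  have pow: "\<Gamma> \<eta> \<xi> (\<lambda>x. x ^ k) = l2_inner V \<eta> ((A ^^ k) \<xi>)" if "\<eta> \<in> l2 V" "\<xi> \<in> l2 V" for \<eta> \<xi>
    using that
  proof (induction k arbitrary: \<xi>)
    case 0
    then show ?case using ind[of \<eta> \<xi> UNIV] by (simp add: P_UNIV indicator_def[abs_def])
  next
    case (Suc k)
    have "\<Gamma> \<eta> \<xi> (\<lambda>x. x ^ Suc k) = \<Gamma> \<eta> (A \<xi>) (\<lambda>x. x ^ k)"
      using Suc step[of \<eta> \<xi> "\<lambda>x. x ^ k"] bounded_borel_power by simp
    also have "\<dots> = l2_inner V \<eta> ((A ^^ k) (A \<xi>))" using Suc linear_op_l2[OF linA] by simp
    finally show ?case by (simp add: funpow_swap1)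
  qed
  have "\<Gamma> \<phi> \<phi> (\<lambda>x. x ^ k) = \<Lambda> \<phi> (\<lambda>x. x ^ k)"
    by (rule integral_like_eq_indicators[OF il integral_like_\<Lambda>])
       (use \<phi> in \<open>auto simp: ind \<Lambda>_indicator bounded_borel_power\<close>)
  then show ?thesis using pow[OF \<phi> \<phi>] by (simp add: \<Lambda>_def)
qed

end

subsection \<open>The spectral theorem for bounded positive operators\<close>

locale positive_op =
  fixes V :: "'a set" and A :: "('a \<Rightarrow> complex) \<Rightarrow> 'a \<Rightarrow> complex" and R :: real
  assumes R: "R > 0"
    and lin: "linear_op V A"
    and sym: "\<And>\<phi> \<xi>. \<phi> \<in> l2 V \<Longrightarrow> \<xi> \<in> l2 V \<Longrightarrow> l2_inner V \<phi> (A \<xi>) = l2_inner V (A \<phi>) \<xi>"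
    and pos: "\<And>\<phi>. \<phi> \<in> l2 V \<Longrightarrow> 0 \<le> Re (l2_inner V \<phi> (A \<phi>))"
    and upper: "\<And>\<phi>. \<phi> \<in> l2 V \<Longrightarrow> Re (l2_inner V \<phi> (A \<phi>)) \<le> R * Re (l2_inner V \<phi> \<phi>)"
begin

text \<open>\<open>A\<close> and \<open>B\<close> stand for \<open>x\<close> and
  \<open>R - x\<close> in the moment problem; both are positive, and they commute.\<close>

definition B :: "('a \<Rightarrow> complex) \<Rightarrow> 'a \<Rightarrow> complex" where
  "B \<phi> = lc (complex_of_real R) \<phi> (- 1) (A \<phi>)"

lemma A_l2 [simp]: "\<phi> \<in> l2 V \<Longrightarrow> A \<phi> \<in> l2 V"
  by (rule linear_op_l2[OF lin])

lemma A_pow_l2 [simp]: "\<phi> \<in> l2 V \<Longrightarrow> (A ^^ k) \<phi> \<in> l2 V"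
  by (rule linear_op_l2[OF linear_op_funpow[OF lin]])

lemma B_l2 [simp]: "\<phi> \<in> l2 V \<Longrightarrow> B \<phi> \<in> l2 V"
  by (simp add: B_def l2_lc)

lemma B_pow_l2 [simp]: "\<phi> \<in> l2 V \<Longrightarrow> (B ^^ k) \<phi> \<in> l2 V"
  by (induction k) auto

lemma AB: "\<phi> \<in> l2 V \<Longrightarrow> A (B \<phi>) = B (A \<phi>)"
  by (simp add: B_def linear_op_lc[OF lin])

lemma A_B_pow: "\<phi> \<in> l2 V \<Longrightarrow> A ((B ^^ j) \<phi>) = (B ^^ j) (A \<phi>)"
  by (induction j) (auto simp: AB)

lemma A_pow_B: "\<phi> \<in> l2 V \<Longrightarrow> (A ^^ k) (B \<phi>) = B ((A ^^ k) \<phi>)"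
  by (induction k) (auto simp: AB)

lemma symB:
  assumes "\<phi> \<in> l2 V" "\<xi> \<in> l2 V" shows "l2_inner V \<phi> (B \<xi>) = l2_inner V (B \<phi>) \<xi>"
  using assms by (simp add: B_def l2_inner_lc_left l2_inner_lc_right sym)

lemma posB: "\<phi> \<in> l2 V \<Longrightarrow> 0 \<le> Re (l2_inner V \<phi> (B \<phi>))"
  using upper[of \<phi>] by (simp add: B_def l2_inner_lc_right)

lemma sym_pow:
  "\<phi> \<in> l2 V \<Longrightarrow> \<xi> \<in> l2 V \<Longrightarrow> l2_inner V \<phi> ((A ^^ k) \<xi>) = l2_inner V ((A ^^ k) \<phi>) \<xi>"
  by (induction k arbitrary: \<phi>) (auto simp: sym funpow_swap1[symmetric])

definition mom :: "('a \<Rightarrow> complex) \<Rightarrow> nat \<Rightarrow> nat \<Rightarrow> real" where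
  "mom \<phi> k j = Re (l2_inner V \<phi> ((A ^^ k) ((B ^^ j) \<phi>)))"

lemma mom_rec: assumes \<phi>: "\<phi> \<in> l2 V" shows "R * mom \<phi> k j = mom \<phi> (Suc k) j + mom \<phi> k (Suc j)"
proof -
  let ?x = "(B ^^ j) \<phi>"
  have x: "?x \<in> l2 V" using \<phi> by simp
  have "(A ^^ k) (B ?x) = lc R ((A ^^ k) ?x) (- 1) ((A ^^ k) (A ?x))"
    unfolding B_def[of ?x] by (rule linear_op_lc[OF linear_op_funpow[OF lin] x A_l2[OF x]])
  then have "mom \<phi> k (Suc j) = R * mom \<phi> k j - mom \<phi> (Suc k) j"
    using \<phi> x by (simp add: mom_def l2_inner_lc_right funpow_swap1[of A])
  then show ?thesis by simp
qed

lemma mom_Suc2_left: assumes \<phi>: "\<phi> \<in> l2 V" shows "mom \<phi> (Suc (Suc k)) j = mom (A \<phi>) k j"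
proof -
  have "(A ^^ Suc (Suc k)) ((B ^^ j) \<phi>) = A ((A ^^ k) (A ((B ^^ j) \<phi>)))" by (simp add: funpow_swap1)
  then have "(A ^^ Suc (Suc k)) ((B ^^ j) \<phi>) = A ((A ^^ k) ((B ^^ j) (A \<phi>)))"
    using \<phi> by (simp only: A_B_pow)
  then show ?thesis using \<phi> by (simp add: mom_def sym del: funpow.simps)
qed

lemma mom_Suc2_right: assumes \<phi>: "\<phi> \<in> l2 V" shows "mom \<phi> k (Suc (Suc j)) = mom (B \<phi>) k j"
proof -
  have "(B ^^ Suc (Suc j)) \<phi> = B ((B ^^ j) (B \<phi>))" by (simp add: funpow_swap1)
  then have "(A ^^ k) ((B ^^ Suc (Suc j)) \<phi>) = B ((A ^^ k) ((B ^^ j) (B \<phi>)))"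
    using \<phi> by (simp only: A_pow_B B_pow_l2 B_l2)
  then show ?thesis using \<phi> by (simp add: mom_def symB del: funpow.simps)
qed

text \<open>Of two equal factors one is moved to the other side of the inner product; this lowers an
  exponent by 2 and leaves exponents at most 1. For the mixed case the recursion helps:
  \<open>R\<close> times the value is the form of \<open>B\<close> at \<open>A \<phi>\<close> plus
  the form of \<open>A\<close> at \<open>B \<phi>\<close>.\<close>

lemma mom_nonneg: "\<phi> \<in> l2 V \<Longrightarrow> 0 \<le> mom \<phi> k j"
proof (induction "k + j" arbitrary: k j \<phi> rule: less_induct)
  case less
  consider k' where "k = Suc (Suc k')" | j' where "j = Suc (Suc j')" | "k = 0" "j = 0"
    | "k = 1" "j = 0" | "k = 0" "j = 1" | "k = 1" "j = 1"
    by (metis One_nat_def not0_implies_Suc)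
  then show ?case
  proof cases
    case 1 then show ?thesis using less by (simp add: mom_Suc2_left)
  next
    case 2 then show ?thesis using less by (simp add: mom_Suc2_right)
  next
    case 3 then show ?thesis using less by (simp add: mom_def l2_inner_self)
  next
    case 4 then show ?thesis using less pos by (simp add: mom_def)
  next
    case 5 then show ?thesis using less posB by (simp add: mom_def)
  next
    case 6
    have 1: "mom \<phi> (Suc 1) 1 = mom (A \<phi>) 0 1" using less by (simp only: One_nat_def mom_Suc2_left)
    have 2: "mom \<phi> 1 (Suc 1) = mom (B \<phi>) 1 0" using less by (simp only: One_nat_def mom_Suc2_right)
    have "0 \<le> mom (A \<phi>) 0 1" "0 \<le> mom (B \<phi>) 1 0"
      using less posB[of "A \<phi>"] pos[of "B \<phi>"] by (simp_all add: mom_def)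
    then have "0 \<le> R * mom \<phi> 1 1" using mom_rec[of \<phi> 1 1] 1 2 less by simp
    then show ?thesis using R 6 by (simp add: zero_le_mult_iff)
  qed
qed

section \<open>The spectral measure constructed from the moments\<close>

definition is_moment_measure :: "('a \<Rightarrow> complex) \<Rightarrow> real measure \<Rightarrow> bool" where
  "is_moment_measure \<phi> M \<longleftrightarrow> interval_measure_on 0 R M \<and>
     (\<forall>k. (\<integral>x. x ^ k \<partial>M) = Re (l2_inner V \<phi> ((A ^^ k) \<phi>)))"

definition \<mu> :: "('a \<Rightarrow> complex) \<Rightarrow> real measure" where
  "\<mu> \<phi> = (SOME M. is_moment_measure \<phi> M)"

lemma is_moment_measure_\<mu>: assumes "\<phi> \<in> l2 V" shows "is_moment_measure \<phi> (\<mu> \<phi>)"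
proof -
  obtain M where "interval_measure_on 0 R M" "\<And>m. (\<integral>x. x ^ m \<partial>M) = mom \<phi> m 0"
    using hausdorff_moments[of "mom \<phi>" R, OF mom_nonneg mom_rec R] assms by blast
  then have "is_moment_measure \<phi> M" by (simp add: is_moment_measure_def mom_def)
  then show ?thesis unfolding \<mu>_def by (rule someI)
qed

lemma interval_\<mu>: "\<phi> \<in> l2 V \<Longrightarrow> interval_measure_on 0 R (\<mu> \<phi>)"
  using is_moment_measure_\<mu> by (simp add: is_moment_measure_def)

lemma inner_pow_real:
  assumes "\<phi> \<in> l2 V"
  shows "complex_of_real (Re (l2_inner V \<phi> ((A ^^ k) \<phi>))) = l2_inner V \<phi> ((A ^^ k) \<phi>)"
proof -
  have "cnj (l2_inner V \<phi> ((A ^^ k) \<phi>)) = l2_inner V \<phi> ((A ^^ k) \<phi>)"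
    using sym_pow[OF assms assms, of k] l2_inner_cnj[of V "(A ^^ k) \<phi>" \<phi>] by simp
  then have "l2_inner V \<phi> ((A ^^ k) \<phi>) \<in> \<real>" by (simp add: Reals_cnj_iff)
  then show ?thesis by (rule of_real_Re)
qed

definition I :: "(real \<Rightarrow> real) \<Rightarrow> ('a \<Rightarrow> complex) \<Rightarrow> complex" where
  "I f \<phi> = complex_of_real (\<integral>x. f x \<partial>\<mu> \<phi>)"

lemma integral_like_I: "\<phi> \<in> l2 V \<Longrightarrow> integral_like 0 R (\<lambda>f. I f \<phi>)"
  using integral_like_integral[OF interval_\<mu>] by (simp add: I_def[abs_def])

lemma I_power: "\<phi> \<in> l2 V \<Longrightarrow> I (\<lambda>x. x ^ k) \<phi> = l2_inner V \<phi> ((A ^^ k) \<phi>)"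
  using is_moment_measure_\<mu>[of \<phi>] inner_pow_real[of \<phi> k] by (simp add: I_def is_moment_measure_def)

text \<open>The measures \<open>\<mu> \<phi>\<close> are chosen vector by vector, so nothing is
  known at first about their dependence on \<open>\<phi>\<close>. The algebraic properties of
  \<open>C\<close> are checked on monomials, where \<open>C\<close> is a matrix element of a power
  of \<open>A\<close>, and carried over by moment determinacy.\<close>

definition C :: "(real \<Rightarrow> real) \<Rightarrow> ('a \<Rightarrow> complex) \<Rightarrow> ('a \<Rightarrow> complex) \<Rightarrow> complex" where
  "C f = polar (I f)"

lemma integral_like_C: "\<phi> \<in> l2 V \<Longrightarrow> \<xi> \<in> l2 V \<Longrightarrow> integral_like 0 R (\<lambda>f. C f \<phi> \<xi>)"
  unfolding C_def by (rule integral_like_polar[of V _ _ "\<lambda>\<eta> f. I f \<eta>"]) (rule integral_like_I)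

lemma C_power:
  assumes "\<phi> \<in> l2 V" "\<xi> \<in> l2 V" shows "C (\<lambda>x. x ^ k) \<phi> \<xi> = l2_inner V \<phi> ((A ^^ k) \<xi>)"
proof -
  have "C (\<lambda>x. x ^ k) \<phi> \<xi> = polar (\<lambda>\<eta>. l2_inner V \<eta> ((A ^^ k) \<eta>)) \<phi> \<xi>"
    unfolding C_def by (rule polar_cong[OF I_power assms])
  then show ?thesis using polarization_op[OF linear_op_funpow[OF lin] assms] by simp
qed

context
  fixes f assumes f: "bounded_borel 0 R f"
begin

lemma C_form: "sesquilinear_form V (C f)"
proof
  fix \<eta> \<phi> \<xi> a b assume l2s: "\<eta> \<in> l2 V" "\<phi> \<in> l2 V" "\<xi> \<in> l2 V"
  show "C f \<eta> (lc a \<phi> b \<xi>) = a * C f \<eta> \<phi> + b * C f \<eta> \<xi>"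
    by (rule integral_like_eq_moments[OF integral_like_C integral_like_combination[OF integral_like_C integral_like_C] _ f])
       (use l2s in \<open>auto simp: l2_lc C_power linear_op_lc[OF linear_op_funpow[OF lin]] l2_inner_lc_right\<close>)
  show "C f (lc a \<phi> b \<xi>) \<eta> = cnj a * C f \<phi> \<eta> + cnj b * C f \<xi> \<eta>"
    by (rule integral_like_eq_moments[OF integral_like_C integral_like_combination[OF integral_like_C integral_like_C] _ f])
       (use l2s in \<open>auto simp: l2_lc C_power l2_inner_lc_left\<close>)
qed

lemma C_herm: assumes l2s: "\<phi> \<in> l2 V" "\<xi> \<in> l2 V" shows "C f \<xi> \<phi> = cnj (C f \<phi> \<xi>)"
proof (rule integral_like_eq_moments[OF integral_like_C integral_like_cnj[OF integral_like_C] _ f])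
  fix k
  have "l2_inner V \<xi> ((A ^^ k) \<phi>) = cnj (l2_inner V ((A ^^ k) \<phi>) \<xi>)" by (rule l2_inner_cnj)
  then show "C (\<lambda>x. x ^ k) \<xi> \<phi> = cnj (C (\<lambda>x. x ^ k) \<phi> \<xi>)" using l2s by (simp add: C_power sym_pow)
qed (use l2s in auto)

lemma C_diag: assumes "\<phi> \<in> l2 V" shows "C f \<phi> \<phi> = I f \<phi>"
  by (rule integral_like_eq_moments[OF integral_like_C integral_like_I _ f]) (use assms in \<open>auto simp: C_power I_power\<close>)

end

lemma I_indicator: "\<phi> \<in> l2 V \<Longrightarrow> D \<in> sets borel \<Longrightarrow> I (indicator D) \<phi> = measure (\<mu> \<phi>) D"
  using interval_\<mu>[of \<phi>] sets_eq_imp_space_eq[of "\<mu> \<phi>" borel]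
  by (simp add: I_def interval_measure_on_def)

lemma measure_\<mu>_UNIV: assumes "\<phi> \<in> l2 V" shows "measure (\<mu> \<phi>) UNIV = (l2_norm V \<phi>)\<^sup>2"
proof -
  have "complex_of_real (measure (\<mu> \<phi>) UNIV) = I (\<lambda>x. x ^ 0) \<phi>"
    using I_indicator[OF assms, of UNIV] by (simp add: indicator_def[abs_def])
  then show ?thesis using I_power[OF assms, of 0] assms by (simp add: l2_inner_self del: of_real_power)
qed

text \<open>On the diagonal the form is the measure of \<open>D\<close>, which is at most the full
  mass, the squared norm; Cauchy-Schwarz covers the rest.\<close>

lemma C_contractive: assumes D: "D \<in> sets borel" shows "contractive_form V (C (indicator D))"
proof -
  note bD = bounded_borel_indicator[OF D, of 0 R]
  interpret sesquilinear_form V "C (indicator D)" by (rule C_form[OF bD])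
  show ?thesis
  proof
    fix \<phi> \<xi> assume l2s: "\<phi> \<in> l2 V" "\<xi> \<in> l2 V"
    have diag: "0 \<le> Re (C (indicator D) \<phi> \<phi>)" "Re (C (indicator D) \<phi> \<phi>) \<le> (l2_norm V \<phi>)\<^sup>2"
      if "\<phi> \<in> l2 V" for \<phi>
    proof -
      interpret finite_measure "\<mu> \<phi>" using interval_\<mu>[OF that] by (simp add: interval_measure_on_def)
      have "measure (\<mu> \<phi>) D \<le> measure (\<mu> \<phi>) UNIV"
        using interval_\<mu>[OF that] by (intro finite_measure_mono) (auto simp: interval_measure_on_def)
      then show "0 \<le> Re (C (indicator D) \<phi> \<phi>)" "Re (C (indicator D) \<phi> \<phi>) \<le> (l2_norm V \<phi>)\<^sup>2"
        using that D by (auto simp: C_diag[OF bD] I_indicator measure_\<mu>_UNIV)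
    qed
    have "(cmod (C (indicator D) \<phi> \<xi>))\<^sup>2 \<le> Re (C (indicator D) \<phi> \<phi>) * Re (C (indicator D) \<xi> \<xi>)"
      by (rule cauchy_schwarz[OF C_herm[OF bD] diag(1) l2s])
    also have "\<dots> \<le> (l2_norm V \<phi>)\<^sup>2 * (l2_norm V \<xi>)\<^sup>2" using diag l2s by (intro mult_mono) auto
    finally show "cmod (C (indicator D) \<phi> \<xi>) \<le> l2_norm V \<phi> * l2_norm V \<xi>"
      by (intro power2_le_imp_le[of "cmod _"] mult_nonneg_nonneg l2_norm_nonneg) (simp only: power_mult_distrib)
  qed
qed

definition P :: "real set \<Rightarrow> ('a \<Rightarrow> complex) \<Rightarrow> 'a \<Rightarrow> complex" where
  "P D = form_op V (C (indicator D))"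

context
  fixes D :: "real set" assumes D: "D \<in> sets borel"
begin

interpretation contractive_form V "C (indicator D)" by (rule C_contractive[OF D])

lemma P_linear: "linear_op V (P D)"
  unfolding P_def by (rule linear_op_form_op)

lemma P_l2: "\<phi> \<in> l2 V \<Longrightarrow> P D \<phi> \<in> l2 V"
  by (rule linear_op_l2[OF P_linear])

lemma inner_P: "\<phi> \<in> l2 V \<Longrightarrow> \<xi> \<in> l2 V \<Longrightarrow> l2_inner V \<phi> (P D \<xi>) = C (indicator D) \<phi> \<xi>"
  unfolding P_def by (rule l2_inner_form_op)

lemma P_bounded: "l2_bounded_op V (P D)"
  unfolding l2_bounded_op_iff by (rule conjI[OF P_linear], rule exI[of _ 1]) (simp add: P_def form_op_norm)

lemma P_sym: assumes "\<phi> \<in> l2 V" "\<xi> \<in> l2 V" shows "l2_inner V \<xi> (P D \<phi>) = l2_inner V (P D \<xi>) \<phi>"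
  using assms C_herm[OF bounded_borel_indicator[OF D] assms] l2_inner_cnj[of V "P D \<xi>" \<phi>]
  by (simp add: inner_P)

text \<open>Moment determinacy is used twice: first to reduce \<open>f\<close> to a monomial, whose
  power of \<open>A\<close> passes to the left argument, and then to reduce the indicator of
  \<open>D\<close> to a monomial. With an indicator for \<open>f\<close> this gives the idempotence
  of \<open>P D\<close>.\<close>

lemma C_P:
  assumes l2s: "\<phi> \<in> l2 V" "\<xi> \<in> l2 V" and f: "bounded_borel 0 R f"
  shows "C f \<phi> (P D \<xi>) = C (\<lambda>x. indicator D x * f x) \<phi> \<xi>"
proof (rule integral_like_eq_moments[OF _ _ _ f])
  note bD = bounded_borel_indicator[OF D, of 0 R]
  show "integral_like 0 R (\<lambda>f. C f \<phi> (P D \<xi>))" using l2s by (intro integral_like_C P_l2)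
  show "integral_like 0 R (\<lambda>f. C (\<lambda>x. indicator D x * f x) \<phi> \<xi>)"
    using l2s by (intro integral_like_mult[OF integral_like_C bD])
  fix k
  have "C (\<lambda>x. x ^ k) \<phi> (P D \<xi>) = l2_inner V ((A ^^ k) \<phi>) (P D \<xi>)"
    using l2s by (simp add: C_power P_l2 sym_pow)
  also have "\<dots> = C (indicator D) ((A ^^ k) \<phi>) \<xi>" using l2s by (simp add: inner_P)
  also have "\<dots> = C (\<lambda>x. x ^ k * indicator D x) \<phi> \<xi>"
  proof (rule integral_like_eq_moments[OF _ _ _ bD])
    show "integral_like 0 R (\<lambda>f. C f ((A ^^ k) \<phi>) \<xi>)" using l2s by (intro integral_like_C) auto
    show "integral_like 0 R (\<lambda>f. C (\<lambda>x. x ^ k * f x) \<phi> \<xi>)"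
      using l2s by (intro integral_like_mult[OF integral_like_C bounded_borel_power])
    fix j
    show "C (\<lambda>x. x ^ j) ((A ^^ k) \<phi>) \<xi> = C (\<lambda>x. x ^ k * x ^ j) \<phi> \<xi>"
      using l2s by (simp add: C_power sym_pow[symmetric] power_add[symmetric] funpow_add)
  qed
  finally show "C (\<lambda>x. x ^ k) \<phi> (P D \<xi>) = C (\<lambda>x. indicator D x * x ^ k) \<phi> \<xi>"
    by (simp add: mult.commute)
qed

lemma P_idem: assumes \<phi>: "\<phi> \<in> l2 V" shows "P D (P D \<phi>) = P D \<phi>"
proof (rule l2_eqI)
  fix \<eta> assume \<eta>: "\<eta> \<in> l2 V"
  have "(\<lambda>x. indicator D x * indicator D x) = (indicator D :: real \<Rightarrow> real)" by (auto simp: indicator_def)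
  then show "l2_inner V \<eta> (P D (P D \<phi>)) = l2_inner V \<eta> (P D \<phi>)"
    using \<eta> \<phi> C_P[OF \<eta> \<phi> bounded_borel_indicator[OF D]] by (simp add: inner_P P_l2)
qed (use \<phi> in \<open>auto intro: P_l2\<close>)

lemma inner_P_diag: "\<phi> \<in> l2 V \<Longrightarrow> l2_inner V \<phi> (P D \<phi>) = complex_of_real (measure (\<mu> \<phi>) D)"
  using D by (simp add: inner_P C_diag bounded_borel_indicator I_indicator)

lemma P_full: assumes "{0..R} \<subseteq> D" "\<phi> \<in> l2 V" shows "P D \<phi> = \<phi>"
proof (rule l2_eqI[OF P_l2])
  fix \<eta> assume \<eta>: "\<eta> \<in> l2 V"
  have "C (indicator D) \<eta> \<phi> = C (\<lambda>x. x ^ 0) \<eta> \<phi>"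
    using assms \<eta>
    by (intro integral_like_cong[OF integral_like_C[OF \<eta> assms(2)]] bounded_borel_indicator[OF D] bounded_borel_power) auto
  also have "\<dots> = l2_inner V \<eta> ((A ^^ 0) \<phi>)" by (rule C_power[OF \<eta> assms(2)])
  finally show "l2_inner V \<eta> (P D \<phi>) = l2_inner V \<eta> \<phi>" using \<eta> assms by (simp add: inner_P)
qed (use assms in auto)

end

lemma projection_valued_measure_P: "projection_valued_measure V P"
  unfolding projection_valued_measure_def l2_orthogonal_projection_def
proof (intro conjI ballI allI impI)
  fix \<phi> and E :: "nat \<Rightarrow> real set"
  assume \<phi>: "\<phi> \<in> l2 V" and E: "range E \<subseteq> sets borel" "disjoint_family E"
  interpret finite_measure "\<mu> \<phi>" using interval_\<mu>[OF \<phi>] by (simp add: interval_measure_on_def)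
  have "(\<lambda>n. measure (\<mu> \<phi>) (E n)) sums measure (\<mu> \<phi>) (\<Union>n. E n)"
    using E interval_\<mu>[OF \<phi>] by (intro finite_measure_UNION) (auto simp: interval_measure_on_def)
  then have "(\<lambda>n. complex_of_real (measure (\<mu> \<phi>) (E n))) sums complex_of_real (measure (\<mu> \<phi>) (\<Union>n. E n))"
    by (rule sums_of_real)
  moreover have "(\<Union>n. E n) \<in> sets borel" using E by auto
  ultimately show "(\<lambda>n. l2_inner V \<phi> (P (E n) \<phi>)) sums l2_inner V \<phi> (P (\<Union>n. E n) \<phi>)"
    using \<phi> E by (simp add: inner_P_diag range_subsetD)
qed (auto simp: P_bounded P_idem P_sym P_full)

lemma diagonal_measure_P: assumes "\<phi> \<in> l2 V" shows "diagonal_measure V P \<phi> = \<mu> \<phi>"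
proof -
  have s: "sets (\<mu> \<phi>) = sets borel" "space (\<mu> \<phi>) = UNIV"
    using interval_\<mu>[OF assms] sets_eq_imp_space_eq[of "\<mu> \<phi>" borel] by (auto simp: interval_measure_on_def)
  interpret finite_measure "\<mu> \<phi>" using interval_\<mu>[OF assms] by (simp add: interval_measure_on_def)
  have "diagonal_measure V P \<phi> = measure_of UNIV (sets borel) (emeasure (\<mu> \<phi>))"
    unfolding diagonal_measure_def
    by (rule measure_of_eq)
       (auto simp: sets.sigma_sets_eq[of borel, simplified] inner_P_diag assms emeasure_eq_measure)
  also have "\<dots> = \<mu> \<phi>" using measure_of_of_measure[of "\<mu> \<phi>"] s by simp
  finally show ?thesis .
qed

lemma spectral_measure_of_P: "spectral_measure_of V A P"
  unfolding spectral_measure_of_def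
proof (intro conjI exI[of _ R] ballI projection_valued_measure_P)
  fix \<phi> assume \<phi>: "\<phi> \<in> l2 V"
  show "P {-R..R} \<phi> = \<phi>" using \<phi> R by (intro P_full) auto
  show "l2_inner V \<phi> (A \<phi>) = complex_of_real (\<integral>x. x \<partial>diagonal_measure V P \<phi>)"
    using I_power[OF \<phi>, of 1] by (simp add: diagonal_measure_P \<phi> I_def)
qed

text \<open>By \<open>moments\<close> the diagonal measures of every spectral measure of
  \<open>A\<close> have the moments of \<open>M\<close>, and on a compact interval these determine
  the integrals.\<close>

lemma spectral_measure_unique:
  fixes f :: "real \<Rightarrow> real"
  assumes Q: "spectral_measure_of V A Q" and \<phi>: "\<phi> \<in> l2 V" and M: "is_moment_measure \<phi> M"
    and f: "f \<in> borel_measurable borel" "\<And>x. \<bar>f x\<bar> \<le> K"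
  shows "(\<integral>x. f x \<partial>diagonal_measure V Q \<phi>) = (\<integral>x. f x \<partial>M)"
proof -
  obtain S where S: "\<forall>\<phi>\<in>l2 V. Q {-S..S} \<phi> = \<phi>" using Q by (auto simp: spectral_measure_of_def)
  interpret pvm V Q by unfold_locales (use Q in \<open>simp add: spectral_measure_of_def\<close>)
  interpret pvm_of V Q A S
    by unfold_locales (use S Q in \<open>auto simp: lin spectral_measure_of_def \<nu>_def\<close>)
  \<comment> \<open>The support of \<open>Q\<close> is only known to lie in \<open>{- S..S}\<close>,
    so both measures are placed on a common interval.\<close>
  define T where "T = max R \<bar>S\<bar>"
  have 1: "interval_measure_on (- T) T (\<nu> \<phi>)"
    using interval_\<nu>[OF \<phi>] by (rule interval_measure_on_mono) (auto simp: T_def)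
  have 2: "interval_measure_on (- T) T M"
    by (rule interval_measure_on_mono[of 0 R M]) (use M R in \<open>auto simp: T_def is_moment_measure_def\<close>)
  have mm: "(\<integral>x. x ^ k \<partial>\<nu> \<phi>) = (\<integral>x. x ^ k \<partial>M)" for k
  proof -
    have "(\<integral>x. x ^ k \<partial>M) = Re (l2_inner V \<phi> ((A ^^ k) \<phi>))" using M by (simp add: is_moment_measure_def)
    then have "complex_of_real (\<integral>x. x ^ k \<partial>\<nu> \<phi>) = complex_of_real (\<integral>x. x ^ k \<partial>M)"
      by (simp only: moments[OF \<phi>] inner_pow_real[OF \<phi>])
    then show ?thesis by (simp only: of_real_eq_iff)
  qed
  have "(\<integral>x. f x \<partial>\<nu> \<phi>) = (\<integral>x. f x \<partial>M)"
    by (rule interval_measure_on_eq_moments[OF 1 2 mm bounded_borelI[OF f]])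
  then show ?thesis by (simp add: \<nu>_def)
qed

text \<open>The operator is chosen together with some spectral measure \<open>Q\<close>. The choice
  is possible because of \<open>P\<close>, and uniqueness makes the value independent of
  \<open>Q\<close> and computable from any moment measure \<open>M\<close>.\<close>

theorem functional_calculus_heaviside:
  assumes \<phi>: "\<phi> \<in> l2 V" and M: "is_moment_measure \<phi> M"
  shows "l2_inner V \<phi> (functional_calculus V A (\<lambda>x. heaviside (E - x)) \<phi>) = complex_of_real (measure M {..E})"
proof -
  have h: "(\<lambda>x. heaviside (E - x)) = indicator {..E}" by (auto simp: heaviside_def indicator_def)
  have "\<exists>T Q. spectral_measure_of V A Q \<and> l2_bounded_op V T \<and>
      (\<forall>\<phi>\<in>l2 V. l2_inner V \<phi> (T \<phi>) = complex_of_real (\<integral>x. heaviside (E - x) \<partial>diagonal_measure V Q \<phi>))"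
  proof (intro exI conjI ballI)
    show "spectral_measure_of V A P" by (rule spectral_measure_of_P)
    show "l2_bounded_op V (P {..E})" by (rule P_bounded) simp
    fix \<phi> assume \<phi>: "\<phi> \<in> l2 V"
    show "l2_inner V \<phi> (P {..E} \<phi>) = complex_of_real (\<integral>x. heaviside (E - x) \<partial>diagonal_measure V P \<phi>)"
      using \<phi> I_indicator[OF \<phi>, of "{..E}"] unfolding h by (simp add: inner_P_diag diagonal_measure_P I_def)
  qed
  from someI_ex[OF this] obtain Q where Q: "spectral_measure_of V A Q"
      "\<And>\<phi>. \<phi> \<in> l2 V \<Longrightarrow> l2_inner V \<phi> (functional_calculus V A (\<lambda>x. heaviside (E - x)) \<phi>) =
        complex_of_real (\<integral>x. heaviside (E - x) \<partial>diagonal_measure V Q \<phi>)"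
    unfolding functional_calculus_def by blast
  have "(\<integral>x. heaviside (E - x) \<partial>diagonal_measure V Q \<phi>) = (\<integral>x. indicator {..E} x \<partial>M)"
    unfolding h by (rule spectral_measure_unique[OF Q(1) \<phi> M, of _ 1]) (auto simp: indicator_def)
  also have "\<dots> = measure M {..E}"
    using M sets_eq_imp_space_eq[of M borel] by (simp add: is_moment_measure_def interval_measure_on_def)
  finally show ?thesis using Q(2)[OF \<phi>] by simp
qed

text \<open>If no power of \<open>A\<close> carries \<open>\<phi>\<close> to \<open>w\<close>, then
  all moments of the complex measure of \<open>delta w\<close> and \<open>\<phi>\<close> are 0, and
  so is the measure.\<close>

lemma P_support:
  assumes D: "D \<in> sets borel" and \<phi>: "\<phi> \<in> l2 V"
    and out: "\<And>k w. w \<notin> S \<Longrightarrow> (A ^^ k) \<phi> w = 0" and w: "w \<notin> S"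
  shows "P D \<phi> w = 0"
proof (cases "w \<in> V")
  case True
  \<comment> \<open>The combination with coefficients 0 presents the zero functional as
    \<open>integral_like\<close>.\<close>
  have "C (indicator D) (delta w) \<phi> = 0 * C (indicator D) (delta w) \<phi> + 0 * C (indicator D) (delta w) \<phi>"
    by (rule integral_like_eq_moments[OF integral_like_C integral_like_combination[OF integral_like_C integral_like_C]])
       (use True \<phi> D out[OF w] in \<open>auto simp: delta_l2 C_power l2_inner_delta bounded_borel_indicator\<close>)
  then show ?thesis by (simp add: P_def form_op_def)
qed (simp add: P_def form_op_def)

lemma integral_\<mu>_P:
  assumes D: "D \<in> sets borel" and \<phi>: "\<phi> \<in> l2 V"
  shows "complex_of_real (\<integral>x. indicator D x * x ^ k \<partial>\<mu> \<phi>) = l2_inner V (P D \<phi>) ((A ^^ k) (P D \<phi>))"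
proof -
  note b = bounded_borel_power[of 0 R k] bounded_borel_indicator[OF D, of 0 R]
  note b' = bounded_borel_mult[OF b(2,1)]
  have "l2_inner V (P D \<phi>) ((A ^^ k) (P D \<phi>)) = C (\<lambda>x. x ^ k) (P D \<phi>) (P D \<phi>)"
    using D \<phi> by (simp add: C_power P_l2)
  also have "\<dots> = C (\<lambda>x. indicator D x * x ^ k) (P D \<phi>) \<phi>" by (rule C_P[OF D P_l2[OF D \<phi>] \<phi> b(1)])
  also have "\<dots> = cnj (C (\<lambda>x. indicator D x * x ^ k) \<phi> (P D \<phi>))" by (rule C_herm[OF b' \<phi> P_l2[OF D \<phi>]])
  also have "C (\<lambda>x. indicator D x * x ^ k) \<phi> (P D \<phi>) = C (\<lambda>x. indicator D x * (indicator D x * x ^ k)) \<phi> \<phi>"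
    by (rule C_P[OF D \<phi> \<phi> b'])
  also have "(\<lambda>x. indicator D x * (indicator D x * x ^ k)) = (\<lambda>x. indicator D x * x ^ k :: real)"
    by (auto simp: indicator_def)
  also have "C (\<lambda>x. indicator D x * x ^ k) \<phi> \<phi> = I (\<lambda>x. indicator D x * x ^ k) \<phi>" by (rule C_diag[OF b' \<phi>])
  finally show ?thesis by (simp add: I_def)
qed

text \<open>The hypothesis \<open>gap\<close> says that the integral of
  \<open>x * (\<gamma> - x)\<close> over \<open>{0<..E}\<close> is at most 0, whereas the integrand
  is positive there. The inequality is asked of the single vector \<open>P {0<..E} \<phi>\<close>,
  which suits an operator that has a gap only on the functions supported in a finite
  cluster.\<close>

lemma spectral_gap:
  assumes \<phi>: "\<phi> \<in> l2 V" and E: "E < \<gamma>"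
    and gap: "\<gamma> * Re (l2_inner V (P {0<..E} \<phi>) (A (P {0<..E} \<phi>))) \<le> Re (l2_inner V (A (P {0<..E} \<phi>)) (A (P {0<..E} \<phi>)))"
  shows "measure (\<mu> \<phi>) {0<..E} = 0"
proof -
  let ?D = "{0<..E}" let ?\<eta> = "P ?D \<phi>"
  have \<eta>: "?\<eta> \<in> l2 V" using \<phi> by (simp add: P_l2)
  have M: "interval_measure_on 0 R (\<mu> \<phi>)" by (rule interval_\<mu>[OF \<phi>])
  have s[measurable_cong]: "sets (\<mu> \<phi>) = sets borel" using M by (simp add: interval_measure_on_def)
  have int: "integrable (\<mu> \<phi>) (\<lambda>x. indicator ?D x * x ^ k)" for k
    by (intro interval_measure_on_integrable[OF M] bounded_borel_mult bounded_borel_power bounded_borel_indicator) simp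
  have 1: "(\<integral>x. indicator ?D x * x ^ 1 \<partial>\<mu> \<phi>) = Re (l2_inner V ?\<eta> (A ?\<eta>))"
    using arg_cong[OF integral_\<mu>_P[of ?D \<phi> 1], of Re] \<phi> by simp
  have "l2_inner V ?\<eta> ((A ^^ 2) ?\<eta>) = l2_inner V (A ?\<eta>) (A ?\<eta>)"
    using \<eta> by (simp add: numeral_2_eq_2 sym)
  then have 2: "(\<integral>x. indicator ?D x * x ^ 2 \<partial>\<mu> \<phi>) = Re (l2_inner V (A ?\<eta>) (A ?\<eta>))"
    using arg_cong[OF integral_\<mu>_P[of ?D \<phi> 2], of Re] \<phi> by simp
  have "(\<integral>x. \<gamma> * (indicator ?D x * x ^ 1) - indicator ?D x * x ^ 2 \<partial>\<mu> \<phi>) \<le> 0"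
    using gap by (subst Bochner_Integration.integral_diff) (use int int[of 1, simplified] 1 2 in auto)
  moreover have nonneg: "0 \<le> \<gamma> * (indicator ?D x * x ^ 1) - indicator ?D x * x ^ 2" for x :: real
    using E by (auto simp: indicator_def power2_eq_square intro!: mult_right_mono)
  ultimately have "(\<integral>x. \<gamma> * (indicator ?D x * x ^ 1) - indicator ?D x * x ^ 2 \<partial>\<mu> \<phi>) = 0"
    by (intro antisym[OF _ Bochner_Integration.integral_nonneg])
  then have "AE x in \<mu> \<phi>. \<gamma> * (indicator ?D x * x ^ 1) - indicator ?D x * x ^ 2 = 0"
    by (subst (asm) integral_nonneg_eq_0_iff_AE) (use int int[of 1, simplified] nonneg in auto)
  then have "AE x in \<mu> \<phi>. x \<notin> ?D"
  proof eventually_elim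
    fix x assume *: "\<gamma> * (indicator ?D x * x ^ 1) - indicator ?D x * x ^ 2 = 0"
    show "x \<notin> ?D"
    proof
      assume "x \<in> ?D"
      then have "x * (\<gamma> - x) = 0" "x > 0" "x < \<gamma>" using * E by (auto simp: power2_eq_square algebra_simps)
      then show False by simp
    qed
  qed
  then have "emeasure (\<mu> \<phi>) ?D = 0"
    using sets_eq_imp_space_eq[OF s]
    by (subst (asm) AE_iff_null) (auto simp: null_sets_def greaterThanAtMost_def greaterThan_def atMost_def Collect_conj_eq)
  then show ?thesis by (simp add: measure_def)
qed

lemma integral_like_evaluation: assumes "x \<in> {a..b}" shows "integral_like a b (\<lambda>f. complex_of_real (f x) * c)"
  unfolding integral_like_def
  using assms by (auto simp: algebra_simps intro!: tendsto_intros)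

text \<open>The eigenvector lies in the range of \<open>P {l}\<close>, so \<open>\<phi> v\<close> is
  the inner product of \<open>P {l} (delta v)\<close> with \<open>\<phi>\<close>. The squared norm
  of \<open>P {l} (delta v)\<close> is the mass of the atom, and Cauchy-Schwarz applies.\<close>

lemma eigenvector_weight:
  assumes \<phi>: "\<phi> \<in> l2 V" and eig: "A \<phi> = (\<lambda>v. complex_of_real l * \<phi> v)" and v: "v \<in> V"
  shows "(cmod (\<phi> v))\<^sup>2 \<le> measure (\<mu> (delta v)) {l} * (l2_norm V \<phi>)\<^sup>2"
proof (cases "l2_norm V \<phi> = 0")
  case True
  then show ?thesis using l2_norm_eq_0[OF \<phi>] by simp
next
  case False
  then have n: "(l2_norm V \<phi>)\<^sup>2 > 0" by simp
  have pow: "(A ^^ k) \<phi> = lc (complex_of_real (l ^ k)) \<phi> 0 \<phi>" for k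
  proof (induction k)
    case 0 show ?case by (simp add: lc_def)
  next
    case (Suc k)
    have "(A ^^ Suc k) \<phi> = A (lc (complex_of_real (l ^ k)) \<phi> 0 \<phi>)" by (simp add: Suc)
    also have "\<dots> = lc (complex_of_real (l ^ k)) (A \<phi>) 0 (A \<phi>)" by (rule linear_op_lc[OF lin \<phi> \<phi>])
    finally show ?case by (simp add: eig lc_def mult_ac)
  qed
  have ip: "l2_inner V \<eta> ((A ^^ k) \<phi>) = complex_of_real (l ^ k) * l2_inner V \<eta> \<phi>" if "\<eta> \<in> l2 V" for \<eta> k
    unfolding pow using that \<phi> by (simp add: l2_inner_lc_right)
  have "Re (l2_inner V \<phi> (A \<phi>)) = l * (l2_norm V \<phi>)\<^sup>2"
    using ip[OF \<phi>, of 1] by (simp add: l2_inner_self[OF \<phi>] del: of_real_power)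
  then have "0 \<le> l * (l2_norm V \<phi>)\<^sup>2" "l * (l2_norm V \<phi>)\<^sup>2 \<le> R * (l2_norm V \<phi>)\<^sup>2"
    using pos[OF \<phi>] upper[OF \<phi>] by (simp_all add: l2_inner_self[OF \<phi>])
  then have l: "l \<in> {0..R}" using n by (auto simp: zero_le_mult_iff mult_le_cancel_right)
  have Pl: "P {l} \<phi> = \<phi>"
  proof (rule l2_eqI[OF P_l2 \<phi>])
    fix \<eta> assume \<eta>: "\<eta> \<in> l2 V"
    \<comment> \<open>Against an eigenvector the complex measure is a multiple of the point mass at
      \<open>l\<close>, since its moments are multiples of the powers of \<open>l\<close>.\<close>
    have "C (indicator {l}) \<eta> \<phi> = complex_of_real (indicator {l} l) * l2_inner V \<eta> \<phi>"
      by (rule integral_like_eq_moments[OF integral_like_C integral_like_evaluation[OF l]])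
         (use \<eta> \<phi> in \<open>auto simp: C_power ip bounded_borel_indicator\<close>)
    then show "l2_inner V \<eta> (P {l} \<phi>) = l2_inner V \<eta> \<phi>" using \<eta> \<phi> by (simp add: inner_P)
  qed (use \<phi> in auto)
  note d = delta_l2[OF v]
  have "\<phi> v = l2_inner V (delta v) (P {l} \<phi>)" using v by (simp add: Pl l2_inner_delta)
  also have "\<dots> = l2_inner V (P {l} (delta v)) \<phi>" using d \<phi> by (intro P_sym) auto
  finally have "cmod (\<phi> v) \<le> l2_norm V (P {l} (delta v)) * l2_norm V \<phi>"
    using l2_cauchy_schwarz[OF P_l2[OF _ d] \<phi>] by simp
  then have "(cmod (\<phi> v))\<^sup>2 \<le> (l2_norm V (P {l} (delta v)))\<^sup>2 * (l2_norm V \<phi>)\<^sup>2"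
    unfolding power_mult_distrib[symmetric] by (intro power_mono) auto
  moreover have "complex_of_real ((l2_norm V (P {l} (delta v)))\<^sup>2) = complex_of_real (measure (\<mu> (delta v)) {l})"
  proof -
    have "complex_of_real (measure (\<mu> (delta v)) {l}) = l2_inner V (delta v) (P {l} (P {l} (delta v)))"
      using d by (simp add: P_idem inner_P_diag)
    also have "\<dots> = l2_inner V (P {l} (delta v)) (P {l} (delta v))" using d by (intro P_sym P_l2) auto
    finally show ?thesis using d by (simp add: l2_inner_self P_l2 del: of_real_power)
  qed
  then have "(l2_norm V (P {l} (delta v)))\<^sup>2 = measure (\<mu> (delta v)) {l}" by (simp only: of_real_eq_iff)
  ultimately show ?thesis by simp
qed

end

subsection \<open>The graph Laplacian\<close>

text \<open>Ordered pairs, so that every edge occurs in both directions; this is the source of the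
  factor 2 in \<open>inner_laplacian\<close> and \<open>energy\<close>.\<close>

definition adj :: "'a graph \<Rightarrow> ('a \<times> 'a) set" where
  "adj G = {(a, b). {a, b} \<in> edges G}"

lemma adj_sym: "(a, b) \<in> adj G \<longleftrightarrow> (b, a) \<in> adj G"
  by (simp add: adj_def insert_commute)

lemma neighbours_adj: "w \<in> neighbours G v \<longleftrightarrow> (v, w) \<in> adj G"
  by (simp add: neighbours_def adj_def)

locale bounded_graph =
  fixes G :: "'a graph" and D :: nat
  assumes simple: "simple_graph G"
    and finite_neighbours: "\<And>v. v \<in> verts G \<Longrightarrow> finite (neighbours G v)"
    and degree_le: "\<And>v. v \<in> verts G \<Longrightarrow> card (neighbours G v) \<le> D"
    and D_pos: "0 < D"
begin

lemma adj_verts: assumes "(a, b) \<in> adj G" shows "a \<in> verts G" "b \<in> verts G" "a \<noteq> b"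
proof -
  obtain u v where "{a, b} = {u, v}" "u \<in> verts G" "v \<in> verts G" "u \<noteq> v"
    using assms simple by (auto simp: adj_def simple_graph_def)
  then show "a \<in> verts G" "b \<in> verts G" "a \<noteq> b" by (auto simp: doubleton_eq_iff)
qed

lemma adj_Sigma: "adj G = Sigma (verts G) (neighbours G)"
  using adj_verts by (auto simp: neighbours_adj)

lemma sum_edges_fst:
  assumes "\<phi> \<in> l2 (verts G)"
  shows "(\<lambda>(v, w). (cmod (\<phi> v))\<^sup>2) summable_on adj G"
    and "(\<Sum>\<^sub>\<infinity>(v, w)\<in>adj G. (cmod (\<phi> v))\<^sup>2) \<le> D * (l2_norm (verts G) \<phi>)\<^sup>2"
proof -
  let ?f = "\<lambda>(v, w). (cmod (\<phi> v))\<^sup>2"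
  have inner: "(\<Sum>\<^sub>\<infinity>w\<in>neighbours G v. (cmod (\<phi> v))\<^sup>2) = card (neighbours G v) * (cmod (\<phi> v))\<^sup>2"
    if "v \<in> verts G" for v using finite_neighbours[OF that] by simp
  have le: "card (neighbours G v) * (cmod (\<phi> v))\<^sup>2 \<le> D * (cmod (\<phi> v))\<^sup>2" if "v \<in> verts G" for v
    using degree_le[OF that] by (intro mult_right_mono) auto
  have sD: "(\<lambda>v. D * (cmod (\<phi> v))\<^sup>2) summable_on verts G"
    using assms by (intro summable_on_cmult_right l2_summable)
  have s: "(\<lambda>v. card (neighbours G v) * (cmod (\<phi> v))\<^sup>2) summable_on verts G"
    by (rule summable_on_comparison_test[OF sD le]) auto
  have "(\<lambda>p. norm (?f p)) summable_on adj G"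
    unfolding adj_Sigma
  proof (rule Infinite_Sum.abs_summable_on_Sigma_iff[THEN iffD2], intro conjI ballI)
    show "(\<lambda>x. norm (\<Sum>\<^sub>\<infinity>y\<in>neighbours G x. norm (?f (x, y)))) summable_on verts G"
      by (rule summable_on_cong[THEN iffD2, OF _ s]) (simp add: inner)
  qed (use finite_neighbours in auto)
  then show s': "?f summable_on adj G" by (simp add: case_prod_unfold)
  have "(\<Sum>\<^sub>\<infinity>(v, w)\<in>adj G. (cmod (\<phi> v))\<^sup>2) = (\<Sum>\<^sub>\<infinity>v\<in>verts G. \<Sum>\<^sub>\<infinity>w\<in>neighbours G v. (cmod (\<phi> v))\<^sup>2)"
    using s' unfolding adj_Sigma by (intro infsum_Sigma'_banach[symmetric])
  also have "\<dots> = (\<Sum>\<^sub>\<infinity>v\<in>verts G. card (neighbours G v) * (cmod (\<phi> v))\<^sup>2)"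
    by (rule infsum_cong) (rule inner)
  also have "\<dots> \<le> (\<Sum>\<^sub>\<infinity>v\<in>verts G. D * (cmod (\<phi> v))\<^sup>2)" by (rule infsum_mono[OF s sD le])
  also have "\<dots> = D * (l2_norm (verts G) \<phi>)\<^sup>2" by (simp add: l2_norm_square infsum_cmult_right')
  finally show "(\<Sum>\<^sub>\<infinity>(v, w)\<in>adj G. (cmod (\<phi> v))\<^sup>2) \<le> D * (l2_norm (verts G) \<phi>)\<^sup>2" .
qed

lemma swap_adj: "bij_betw prod.swap (adj G) (adj G)"
  by (rule bij_betwI[of _ _ _ prod.swap]) (auto simp: adj_sym)

lemma summable_swap:
  "f summable_on adj G \<Longrightarrow> (\<lambda>p. f (prod.swap p)) summable_on adj G"
  using summable_on_reindex_bij_betw[OF swap_adj] by blast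

lemma infsum_swap_adj: "(\<Sum>\<^sub>\<infinity>p\<in>adj G. f (prod.swap p)) = (\<Sum>\<^sub>\<infinity>p\<in>adj G. f p)"
  by (rule infsum_reindex_bij_betw[OF swap_adj])

lemma sum_edges_snd:
  assumes "\<phi> \<in> l2 (verts G)"
  shows "(\<lambda>(v, w). (cmod (\<phi> w))\<^sup>2) summable_on adj G"
    and "(\<Sum>\<^sub>\<infinity>(v, w)\<in>adj G. (cmod (\<phi> w))\<^sup>2) \<le> D * (l2_norm (verts G) \<phi>)\<^sup>2"
  using summable_swap[OF sum_edges_fst(1)[OF assms]] sum_edges_fst(2)[OF assms]
    infsum_swap_adj[of "\<lambda>(v, w). (cmod (\<phi> v))\<^sup>2"] by (simp_all add: case_prod_unfold)

lemma edge_summable: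
  assumes "\<phi> \<in> l2 (verts G)"
  shows "(\<lambda>(v, w). 2 * (cmod (\<phi> v))\<^sup>2 + 2 * (cmod (\<phi> w))\<^sup>2) summable_on adj G"
  using summable_on_add[OF summable_on_cmult_right[OF sum_edges_fst(1)[OF assms], of 2]
      summable_on_cmult_right[OF sum_edges_snd(1)[OF assms], of 2]]
  by (simp add: case_prod_unfold)

lemma diff_square_le: "(cmod (a - b))\<^sup>2 \<le> 2 * (cmod a)\<^sup>2 + 2 * (cmod b)\<^sup>2"
  using norm_add_square_le[of a "- b"] by simp

lemma dirichlet_summable:
  assumes "\<phi> \<in> l2 (verts G)"
  shows "(\<lambda>(v, w). (cmod (\<phi> v - \<phi> w))\<^sup>2) summable_on adj G"
  using summable_on_comparison_test[OF edge_summable[OF assms], of "\<lambda>(v, w). (cmod (\<phi> v - \<phi> w))\<^sup>2"]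
  by (simp add: case_prod_unfold diff_square_le)

lemma laplacian_l2:
  assumes \<phi>: "\<phi> \<in> l2 (verts G)" shows "laplacian G \<phi> \<in> l2 (verts G)"
proof (rule l2I)
  have "(\<lambda>v. \<Sum>\<^sub>\<infinity>w\<in>neighbours G v. 2 * (cmod (\<phi> v))\<^sup>2 + 2 * (cmod (\<phi> w))\<^sup>2) summable_on verts G"
    using edge_summable[OF \<phi>] unfolding adj_Sigma by (rule summable_on_Sigma_banach)
  then have "(\<lambda>v. D * (\<Sum>\<^sub>\<infinity>w\<in>neighbours G v. 2 * (cmod (\<phi> v))\<^sup>2 + 2 * (cmod (\<phi> w))\<^sup>2)) summable_on verts G"
    by (rule summable_on_cmult_right)
  then show "(\<lambda>v. (cmod (laplacian G \<phi> v))\<^sup>2) summable_on verts G"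
  proof (rule summable_on_comparison_test)
    fix v assume v: "v \<in> verts G"
    note fin = finite_neighbours[OF v]
    have "(cmod (\<Sum>w\<in>neighbours G v. \<phi> v - \<phi> w))\<^sup>2 \<le> (\<Sum>w\<in>neighbours G v. 1 * cmod (\<phi> v - \<phi> w))\<^sup>2"
      using norm_sum[of "\<lambda>w. \<phi> v - \<phi> w" "neighbours G v"] by (intro power_mono) auto
    also have "\<dots> \<le> (\<Sum>w\<in>neighbours G v. 1\<^sup>2) * (\<Sum>w\<in>neighbours G v. (cmod (\<phi> v - \<phi> w))\<^sup>2)"
      by (rule Cauchy_Schwarz_ineq_sum)
    also have "\<dots> \<le> D * (\<Sum>w\<in>neighbours G v. 2 * (cmod (\<phi> v))\<^sup>2 + 2 * (cmod (\<phi> w))\<^sup>2)"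
      using degree_le[OF v] by (intro mult_mono sum_mono diff_square_le) (auto intro: sum_nonneg)
    finally show "(cmod (laplacian G \<phi> v))\<^sup>2 \<le>
        D * (\<Sum>\<^sub>\<infinity>w\<in>neighbours G v. 2 * (cmod (\<phi> v))\<^sup>2 + 2 * (cmod (\<phi> w))\<^sup>2)"
      using v fin by (simp add: laplacian_def)
  qed simp
qed (simp add: laplacian_def)

text \<open>Summation by parts: the sum over directed edges is added to its image under reversal.
  Absolute summability, a consequence of the bounded degrees, permits the rearrangement.\<close>

lemma inner_laplacian:
  assumes \<phi>: "\<phi> \<in> l2 (verts G)" and \<xi>: "\<xi> \<in> l2 (verts G)"
  shows "2 * l2_inner (verts G) \<xi> (laplacian G \<phi>) = (\<Sum>\<^sub>\<infinity>(v, w)\<in>adj G. cnj (\<xi> v - \<xi> w) * (\<phi> v - \<phi> w))"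
proof -
  have "(\<lambda>p. (cmod (\<xi> (fst p)))\<^sup>2 + (cmod (\<phi> (fst p) - \<phi> (snd p)))\<^sup>2) summable_on adj G"
    using summable_on_add[OF sum_edges_fst(1)[OF \<xi>] dirichlet_summable[OF \<phi>]] by (simp add: case_prod_unfold)
  then have "(\<lambda>p. norm (cnj (\<xi> (fst p)) * (\<phi> (fst p) - \<phi> (snd p)))) summable_on adj G"
  proof (rule summable_on_comparison_test)
    fix p
    have "cmod x * cmod y \<le> (cmod x)\<^sup>2 + (cmod y)\<^sup>2" for x y
      using sum_squares_bound[of "cmod x" "cmod y"] mult_nonneg_nonneg[OF norm_ge_zero[of x] norm_ge_zero[of y]]
      by linarith
    then show "norm (cnj (\<xi> (fst p)) * (\<phi> (fst p) - \<phi> (snd p))) \<le>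
        (cmod (\<xi> (fst p)))\<^sup>2 + (cmod (\<phi> (fst p) - \<phi> (snd p)))\<^sup>2" by (simp add: norm_mult)
  qed simp
  then have s: "(\<lambda>p. cnj (\<xi> (fst p)) * (\<phi> (fst p) - \<phi> (snd p))) summable_on adj G"
    by (rule Infinite_Sum.abs_summable_summable)
  then have s2: "(\<lambda>p. cnj (\<xi> (snd p)) * (\<phi> (snd p) - \<phi> (fst p))) summable_on adj G"
    using summable_swap by fastforce
  have 1: "l2_inner (verts G) \<xi> (laplacian G \<phi>) = (\<Sum>\<^sub>\<infinity>p\<in>adj G. cnj (\<xi> (fst p)) * (\<phi> (fst p) - \<phi> (snd p)))"
  proof -
    have "l2_inner (verts G) \<xi> (laplacian G \<phi>) =
        (\<Sum>\<^sub>\<infinity>v\<in>verts G. \<Sum>\<^sub>\<infinity>w\<in>neighbours G v. cnj (\<xi> v) * (\<phi> v - \<phi> w))"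
      unfolding l2_inner_def using finite_neighbours
      by (intro infsum_cong) (simp add: laplacian_def sum_distrib_left)
    also have "\<dots> = (\<Sum>\<^sub>\<infinity>(v, w)\<in>adj G. cnj (\<xi> v) * (\<phi> v - \<phi> w))"
      using s unfolding adj_Sigma by (intro infsum_Sigma'_banach) (simp add: case_prod_unfold)
    finally show ?thesis by (simp add: case_prod_unfold)
  qed
  then have 2: "l2_inner (verts G) \<xi> (laplacian G \<phi>) = (\<Sum>\<^sub>\<infinity>p\<in>adj G. cnj (\<xi> (snd p)) * (\<phi> (snd p) - \<phi> (fst p)))"
    using infsum_swap_adj[of "\<lambda>p. cnj (\<xi> (fst p)) * (\<phi> (fst p) - \<phi> (snd p))"] by simp
  have "2 * l2_inner (verts G) \<xi> (laplacian G \<phi>) =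
      (\<Sum>\<^sub>\<infinity>p\<in>adj G. cnj (\<xi> (fst p)) * (\<phi> (fst p) - \<phi> (snd p))) +
      (\<Sum>\<^sub>\<infinity>p\<in>adj G. cnj (\<xi> (snd p)) * (\<phi> (snd p) - \<phi> (fst p)))"
    using 1 2 by simp
  also have "\<dots> = (\<Sum>\<^sub>\<infinity>p\<in>adj G. cnj (\<xi> (fst p)) * (\<phi> (fst p) - \<phi> (snd p)) + cnj (\<xi> (snd p)) * (\<phi> (snd p) - \<phi> (fst p)))"
    by (rule infsum_add[OF s s2, symmetric])
  also have "\<dots> = (\<Sum>\<^sub>\<infinity>(v, w)\<in>adj G. cnj (\<xi> v - \<xi> w) * (\<phi> v - \<phi> w))"
    by (intro infsum_cong) (simp add: case_prod_unfold algebra_simps)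
  finally show ?thesis .
qed

lemma energy:
  assumes \<phi>: "\<phi> \<in> l2 (verts G)"
  shows "2 * Re (l2_inner (verts G) \<phi> (laplacian G \<phi>)) = (\<Sum>\<^sub>\<infinity>(v, w)\<in>adj G. (cmod (\<phi> v - \<phi> w))\<^sup>2)"
proof -
  have "2 * l2_inner (verts G) \<phi> (laplacian G \<phi>) = (\<Sum>\<^sub>\<infinity>(v, w)\<in>adj G. complex_of_real ((cmod (\<phi> v - \<phi> w))\<^sup>2))"
    unfolding inner_laplacian[OF \<phi> \<phi>]
    by (intro infsum_cong) (simp add: case_prod_unfold complex_norm_square mult.commute del: of_real_power)
  also have "\<dots> = complex_of_real (\<Sum>\<^sub>\<infinity>(v, w)\<in>adj G. (cmod (\<phi> v - \<phi> w))\<^sup>2)"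
    using has_sum_of_real[OF has_sum_infsum[OF dirichlet_summable[OF \<phi>]], where 'a=complex]
    by (simp add: case_prod_unfold infsumI)
  finally have e: "2 * l2_inner (verts G) \<phi> (laplacian G \<phi>) = \<dots>" .
  show ?thesis using arg_cong[OF e, of Re] by simp
qed

text \<open>The upper end \<open>2 * D\<close> arises as follows: each squared difference is at most
  twice the sum of the two squares, every vertex is in either position of at most \<open>D\<close>
  directed edges, and the form is half the sum over directed edges.\<close>

sublocale positive_op "verts G" "laplacian G" "2 * real D"
proof
  show "0 < 2 * real D" using D_pos by simp
  show "linear_op (verts G) (laplacian G)"
    unfolding linear_op_def
    by (auto simp: laplacian_l2) (auto simp: laplacian_def lc_def fun_eq_iff sum_distrib_left sum.distrib[symmetric] algebra_simps intro!: sum.cong)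
  fix \<phi> assume \<phi>: "\<phi> \<in> l2 (verts G)"
  show "l2_inner (verts G) \<phi> (laplacian G \<xi>) = l2_inner (verts G) (laplacian G \<phi>) \<xi>" if \<xi>: "\<xi> \<in> l2 (verts G)" for \<xi>
  proof -
    have "2 * l2_inner (verts G) (laplacian G \<phi>) \<xi> = cnj (2 * l2_inner (verts G) \<xi> (laplacian G \<phi>))"
      by (subst l2_inner_cnj) simp
    also have "\<dots> = (\<Sum>\<^sub>\<infinity>(v, w)\<in>adj G. cnj (\<phi> v - \<phi> w) * (\<xi> v - \<xi> w))"
      unfolding inner_laplacian[OF \<phi> \<xi>] infsum_cnj[symmetric]
      by (intro infsum_cong) (simp add: case_prod_unfold mult.commute)
    also have "\<dots> = 2 * l2_inner (verts G) \<phi> (laplacian G \<xi>)" by (rule inner_laplacian[OF \<xi> \<phi>, symmetric])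
    finally show ?thesis by simp
  qed
  have "0 \<le> (\<Sum>\<^sub>\<infinity>(v, w)\<in>adj G. (cmod (\<phi> v - \<phi> w))\<^sup>2)" by (rule infsum_nonneg) auto
  then show "0 \<le> Re (l2_inner (verts G) \<phi> (laplacian G \<phi>))" using energy[OF \<phi>] by simp
  have "(\<Sum>\<^sub>\<infinity>(v, w)\<in>adj G. (cmod (\<phi> v - \<phi> w))\<^sup>2) \<le> (\<Sum>\<^sub>\<infinity>(v, w)\<in>adj G. 2 * (cmod (\<phi> v))\<^sup>2 + 2 * (cmod (\<phi> w))\<^sup>2)"
    by (rule infsum_mono[OF dirichlet_summable[OF \<phi>] edge_summable[OF \<phi>]]) (auto simp: diff_square_le)
  also have "\<dots> = 2 * (\<Sum>\<^sub>\<infinity>(v, w)\<in>adj G. (cmod (\<phi> v))\<^sup>2) + 2 * (\<Sum>\<^sub>\<infinity>(v, w)\<in>adj G. (cmod (\<phi> w))\<^sup>2)"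
    using infsum_add[OF summable_on_cmult_right[OF sum_edges_fst(1)[OF \<phi>], of 2]
        summable_on_cmult_right[OF sum_edges_snd(1)[OF \<phi>], of 2]]
    by (simp add: case_prod_unfold infsum_cmult_right')
  also have "\<dots> \<le> 4 * (D * (l2_norm (verts G) \<phi>)\<^sup>2)" using sum_edges_fst(2)[OF \<phi>] sum_edges_snd(2)[OF \<phi>] by simp
  finally show "Re (l2_inner (verts G) \<phi> (laplacian G \<phi>)) \<le> 2 * real D * Re (l2_inner (verts G) \<phi> \<phi>)"
    using energy[OF \<phi>] by (simp add: l2_inner_self[OF \<phi>])
qed

end

subsection \<open>Paths and clusters\<close>

definition cluster :: "'a graph \<Rightarrow> 'a \<Rightarrow> 'a set" where
  "cluster G v = {w. (v, w) \<in> (adj G)\<^sup>*}"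

text \<open>A repeated vertex would allow the loop in between to be cut out, giving a shorter
  walk.\<close>

lemma minimal_path:
  assumes "(v, a) \<in> R ^^ k" "\<And>j. j < k \<Longrightarrow> (v, a) \<notin> R ^^ j"
  obtains x where "x 0 = v" "x k = a" "\<And>i. i < k \<Longrightarrow> (x i, x (Suc i)) \<in> R" "inj_on x {..k}"
proof -
  obtain x where x: "x 0 = v" "x k = a" "\<And>i. i < k \<Longrightarrow> (x i, x (Suc i)) \<in> R"
    using assms(1) unfolding relpow_fun_conv by blast
  have sub: "(x i, x j) \<in> R ^^ (j - i)" if "i \<le> j" "j \<le> k" for i j
    unfolding relpow_fun_conv using that x(3) by (intro exI[of _ "\<lambda>n. x (i + n)"]) auto
  have False if "i < j" "j \<le> k" "x i = x j" for i j
  proof -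
    have "(v, x j) \<in> R ^^ i" using sub[of 0 i] that x by simp
    moreover have "(x j, a) \<in> R ^^ (k - j)" using sub[of j k] that x by simp
    ultimately have "(v, a) \<in> R ^^ (i + (k - j))" by (auto simp: relpow_add)
    moreover have "i + (k - j) < k" using that by linarith
    ultimately show False using assms(2) by blast
  qed
  then have "inj_on x {..k}" by (intro inj_onI) (metis atMost_iff linorder_neqE_nat)
  then show ?thesis using that x by blast
qed

lemma cluster_path:
  assumes "a \<in> cluster G v"
  obtains k x where "x 0 = v" "x k = a" "\<And>i. i < k \<Longrightarrow> (x i, x (Suc i)) \<in> adj G" "inj_on x {..k}"
proof -
  obtain n where n: "(v, a) \<in> adj G ^^ n" using assms by (auto simp: cluster_def rtrancl_power)
  define k where "k = (LEAST n. (v, a) \<in> adj G ^^ n)"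
  have "(v, a) \<in> adj G ^^ k" unfolding k_def using n by (rule LeastI)
  moreover have "(v, a) \<notin> adj G ^^ j" if "j < k" for j using not_less_Least that unfolding k_def by blast
  ultimately show ?thesis using minimal_path that by metis
qed

lemma path_in_cluster:
  assumes "x 0 = v" "\<And>i. i < k \<Longrightarrow> (x i, x (Suc i)) \<in> adj G" "i \<le> k"
  shows "x i \<in> cluster G v"
  using assms(3)
proof (induction i)
  case 0 then show ?case using assms by (simp add: cluster_def)
next
  case (Suc i)
  then show ?case using assms(2)[of i] by (auto simp: cluster_def intro: rtrancl_into_rtrancl)
qed

context bounded_graph
begin

lemma cluster_verts: "v \<in> verts G \<Longrightarrow> cluster G v \<subseteq> verts G"
  unfolding cluster_def by (auto elim: rtranclE dest: adj_verts)

text \<open>Finitely many vertices lie within fewer than \<open>n\<close> steps of \<open>v\<close>,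
  so an infinite cluster has a vertex at distance at least \<open>n\<close>. The first
  \<open>n\<close> steps of a shortest path to it form the required path.\<close>

lemma infinite_cluster_path:
  assumes v: "v \<in> verts G" and inf: "infinite (cluster G v)"
  obtains x where "x 0 = v" "\<And>i. i < n \<Longrightarrow> (x i, x (Suc i)) \<in> adj G" "inj_on x {..n}"
proof -
  have fin: "finite ((adj G ^^ j) `` {v}) \<and> (adj G ^^ j) `` {v} \<subseteq> verts G" for j
  proof (induction j)
    case 0 then show ?case using v by auto
  next
    case (Suc j)
    have "(adj G ^^ Suc j) `` {v} = (\<Union>w\<in>(adj G ^^ j) `` {v}. neighbours G w)"
      by (auto simp: neighbours_adj)
    then show ?case using Suc finite_neighbours adj_verts by (auto simp: neighbours_adj)
  qed
  have "\<not> cluster G v \<subseteq> (\<Union>j<n. (adj G ^^ j) `` {v})"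
    using inf fin finite_subset by (metis finite_UN finite_lessThan)
  then obtain a where a: "(v, a) \<in> (adj G)\<^sup>*" "\<And>j. j < n \<Longrightarrow> (v, a) \<notin> adj G ^^ j"
    by (auto simp: cluster_def)
  define k where "k = (LEAST n. (v, a) \<in> adj G ^^ n)"
  have k: "(v, a) \<in> adj G ^^ k" unfolding k_def using a(1) by (meson LeastI rtrancl_power)
  have min: "(v, a) \<notin> adj G ^^ j" if "j < k" for j using not_less_Least that unfolding k_def by blast
  have nk: "n \<le> k" using a(2)[of k] k by (meson not_le)
  obtain x where "x 0 = v" "x k = a" "\<And>i. i < k \<Longrightarrow> (x i, x (Suc i)) \<in> adj G" "inj_on x {..k}"
    using minimal_path[OF k min] by blast
  then show ?thesis using that[of x] nk by (meson atMost_subset_iff inj_on_subset order_less_le_trans)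
qed

text \<open>Along a path of at most \<open>n\<close> edges, Cauchy-Schwarz bounds the oscillation of
  \<open>f\<close> on the cluster by its energy \<open>e\<close>. Subtracting the constant
  \<open>f v\<close> on the cluster does not change the pairing with \<open>laplacian G f\<close>,
  because the indicator \<open>u\<close> of the cluster is harmonic. So \<open>e\<close> is at most
  the norm of \<open>g\<close> times that of \<open>laplacian G f\<close>, where the squared norm of
  \<open>g\<close> is at most \<open>2 * n^2 * e\<close>.\<close>

lemma poincare:
  assumes v: "v \<in> verts G" and C: "finite (cluster G v)" "card (cluster G v) \<le> n"
    and f: "f \<in> l2 (verts G)" "\<And>w. w \<notin> cluster G v \<Longrightarrow> f w = 0"
  shows "Re (l2_inner (verts G) f (laplacian G f)) \<le>
    2 * (real n)\<^sup>2 * Re (l2_inner (verts G) (laplacian G f) (laplacian G f))"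
proof -
  let ?V = "verts G" and ?C = "cluster G v"
  define e where "e = Re (l2_inner ?V f (laplacian G f))"
  note Lf = laplacian_l2[OF f(1)]
  have e0: "0 \<le> e" unfolding e_def by (rule pos[OF f(1)])
  have vC: "v \<in> ?C" by (simp add: cluster_def)
  have osc: "(cmod (f a - f v))\<^sup>2 \<le> 2 * real n * e" if aC: "a \<in> ?C" for a
  proof -
    obtain k x where x: "x 0 = v" "x k = a" "\<And>i. i < k \<Longrightarrow> (x i, x (Suc i)) \<in> adj G" "inj_on x {..k}"
      using cluster_path[OF aC] by metis
    have "x i \<in> ?C" if "i \<le> k" for i by (rule path_in_cluster[OF x(1) x(3) that])
    then have "x ` {..k} \<subseteq> ?C" by auto
    then have "card (x ` {..k}) \<le> card ?C" using C by (intro card_mono)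
    then have k: "k \<le> n" using x(4) C by (simp add: card_image)
    have "f a - f v = (\<Sum>i<k. f (x (Suc i)) - f (x i))"
      using x by (subst sum_lessThan_telescope) simp
    then have "cmod (f a - f v) \<le> (\<Sum>i<k. 1 * cmod (f (x i) - f (x (Suc i))))"
      using norm_sum[of "\<lambda>i. f (x (Suc i)) - f (x i)" "{..<k}"] by (simp add: norm_minus_commute)
    then have "(cmod (f a - f v))\<^sup>2 \<le> (\<Sum>i<k. 1 * cmod (f (x i) - f (x (Suc i))))\<^sup>2"
      by (intro power_mono) auto
    also have "\<dots> \<le> (\<Sum>i<k. 1\<^sup>2) * (\<Sum>i<k. (cmod (f (x i) - f (x (Suc i))))\<^sup>2)"
      by (rule Cauchy_Schwarz_ineq_sum)
    \<comment> \<open>The sum over all directed edges is \<open>2 * e\<close>, and a path without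
      repeated vertices uses each of its directed edges once.\<close>
    also have "\<dots> \<le> real n * (2 * e)"
    proof (intro mult_mono)
      have "(\<Sum>i<k. (cmod (f (x i) - f (x (Suc i))))\<^sup>2) = (\<Sum>(a, b)\<in>(\<lambda>i. (x i, x (Suc i))) ` {..<k}. (cmod (f a - f b))\<^sup>2)"
        using x(4) by (subst sum.reindex) (auto simp: inj_on_def)
      also have "\<dots> \<le> (\<Sum>\<^sub>\<infinity>(a, b)\<in>adj G. (cmod (f a - f b))\<^sup>2)"
        using x(3) by (intro finite_sum_le_infsum dirichlet_summable f) auto
      also have "\<dots> = 2 * e" unfolding e_def by (rule energy[OF f(1), symmetric])
      finally show "(\<Sum>i<k. (cmod (f (x i) - f (x (Suc i))))\<^sup>2) \<le> 2 * e" .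
    qed (use k in \<open>auto intro: sum_nonneg\<close>)
    finally show ?thesis by simp
  qed
  define u where "u w = (if w \<in> ?C then 1 else 0 :: complex)" for w
  have u: "u \<in> l2 ?V" using C cluster_verts[OF v] by (intro l2_finite_support[of ?C]) (auto simp: u_def)
  have closed: "w \<in> ?C \<longleftrightarrow> w' \<in> ?C" if "(w, w') \<in> adj G" for w w'
    using that adj_sym[of w w' G] unfolding cluster_def by (auto intro: rtrancl_into_rtrancl)
  have Lu: "laplacian G u = (\<lambda>v. 0)"
  proof
    fix w
    have "u w - u w' = 0" if "w' \<in> neighbours G w" for w'
      using closed[of w w'] that by (simp add: u_def neighbours_adj)
    then show "laplacian G u w = 0" by (simp add: laplacian_def)
  qed
  have "l2_inner ?V u (laplacian G f) = l2_inner ?V (\<lambda>v. 0) f"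
    using sym[OF u f(1)] Lu by simp
  then have z: "l2_inner ?V u (laplacian G f) = 0" by (simp add: l2_inner_def)
  define g where "g = lc 1 f (- f v) u"
  have g: "g \<in> l2 ?V" using f u by (simp add: g_def l2_lc)
  have ge: "e = Re (l2_inner ?V g (laplacian G f))"
    using f u Lf z by (simp add: g_def e_def l2_inner_lc_left)
  have gn: "(l2_norm ?V g)\<^sup>2 \<le> 2 * (real n)\<^sup>2 * e"
  proof -
    have "complex_of_real ((l2_norm ?V g)\<^sup>2) = (\<Sum>w\<in>?C. cnj (g w) * g w)"
      unfolding l2_inner_self[OF g, symmetric] using C cluster_verts[OF v] f(2)
      by (intro l2_inner_finite_support) (auto simp: g_def lc_def u_def)
    also have "\<dots> = complex_of_real (\<Sum>w\<in>?C. (cmod (g w))\<^sup>2)"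
      by (simp add: complex_norm_square mult.commute del: of_real_power)
    finally have "(l2_norm ?V g)\<^sup>2 = (\<Sum>w\<in>?C. (cmod (g w))\<^sup>2)" by (simp only: of_real_eq_iff)
    also have "\<dots> \<le> (\<Sum>w\<in>?C. 2 * real n * e)"
      by (intro sum_mono) (use osc in \<open>auto simp: g_def lc_def u_def\<close>)
    also have "\<dots> = real (card ?C) * (2 * real n * e)" by simp
    also have "\<dots> \<le> real n * (2 * real n * e)" using C e0 by (intro mult_right_mono) auto
    finally show ?thesis by (simp add: power2_eq_square mult_ac)
  qed
  define L where "L = (l2_norm ?V (laplacian G f))\<^sup>2"
  have "e \<le> l2_norm ?V g * l2_norm ?V (laplacian G f)"
    using l2_cauchy_schwarz[OF g Lf] complex_Re_le_cmod[of "l2_inner ?V g (laplacian G f)"] ge by linarith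
  then have "e\<^sup>2 \<le> (l2_norm ?V g)\<^sup>2 * L"
    unfolding L_def power_mult_distrib[symmetric] using e0 by (intro power_mono)
  also have "\<dots> \<le> 2 * (real n)\<^sup>2 * e * L" using gn by (intro mult_right_mono) (simp_all add: L_def)
  finally have "e * e \<le> e * (2 * (real n)\<^sup>2 * L)" by (simp add: power2_eq_square mult_ac)
  then have "e \<le> 2 * (real n)\<^sup>2 * L" using e0 by (cases "e = 0") (auto simp: L_def)
  then show ?thesis by (simp add: e_def L_def l2_inner_self[OF Lf])
qed

lemma laplacian_pow_support:
  assumes "w \<notin> cluster G v" shows "(laplacian G ^^ k) (delta v) w = 0"
  using assms
proof (induction k arbitrary: w)
  case 0 then show ?case by (auto simp: delta_apply cluster_def)
next
  case (Suc k)
  have "w' \<notin> cluster G v" if "w' \<in> neighbours G w" for w'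
    using that Suc.prems adj_sym[of w w' G] unfolding cluster_def neighbours_adj
    by (auto intro: rtrancl_into_rtrancl)
  then show ?case using Suc by (simp add: laplacian_def)
qed

lemma measure_gap:
  assumes v: "v \<in> verts G" and C: "finite (cluster G v)" "card (cluster G v) \<le> n"
    and E: "2 * (real n)\<^sup>2 * E < 1" "n > 0"
  shows "measure (\<mu> (delta v)) {0<..E} = 0"
proof (rule spectral_gap[where \<gamma> = "1 / (2 * (real n)\<^sup>2)"])
  show "E < 1 / (2 * (real n)\<^sup>2)" using E by (simp add: field_simps)
  let ?f = "P {0<..E} (delta v)"
  have "Re (l2_inner (verts G) ?f (laplacian G ?f)) \<le>
    2 * (real n)\<^sup>2 * Re (l2_inner (verts G) (laplacian G ?f) (laplacian G ?f))"
    by (rule poincare[OF v C]) (use v in \<open>auto intro!: P_l2 P_support laplacian_pow_support delta_l2\<close>)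
  then show "1 / (2 * (real n)\<^sup>2) * Re (l2_inner (verts G) ?f (laplacian G ?f)) \<le>
      Re (l2_inner (verts G) (laplacian G ?f) (laplacian G ?f))"
    using E by (simp add: field_simps)
qed (use v in \<open>simp add: delta_l2\<close>)

text \<open>The witness is the lowest nonconstant eigenvector of the Neumann Laplacian on a path.\<close>

lemma measure_path:
  assumes n: "n \<ge> 2" and inj: "inj_on x {..<n}" and xV: "\<And>i. i < n \<Longrightarrow> x i \<in> verts G"
    and path: "\<And>i. Suc i < n \<Longrightarrow> (x i, x (Suc i)) \<in> adj G"
    and only: "\<And>i w. i < n \<Longrightarrow> (x i, w) \<in> adj G \<Longrightarrow> \<exists>j<n. w = x j \<and> (j = Suc i \<or> i = Suc j)"
    and E: "pi\<^sup>2 / (real n)\<^sup>2 \<le> E"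
  shows "1 / (2 * real n) \<le> measure (\<mu> (delta (x 0))) {0<..E}"
proof -
  define \<theta> where "\<theta> = pi / real n"
  define l where "l = 2 - 2 * cos \<theta>"
  \<comment> \<open>The shift by \<open>1 / 2\<close> makes the profile symmetric about the points
    \<open>- 1 / 2\<close> and \<open>n - 1 / 2\<close>, which is the Neumann condition at the two
    ends of the path.\<close>
  define c where "c j = cos (\<theta> * (real j + 1 / 2))" for j :: nat
  define \<phi> where "\<phi> w = (if w \<in> x ` {..<n} then complex_of_real (c (the_inv_into {..<n} x w)) else 0)" for w
  have \<phi>x: "\<phi> (x j) = complex_of_real (c j)" if "j < n" for j
    using that inj by (simp add: \<phi>_def the_inv_into_f_f)
  have \<phi>0: "\<phi> w = 0" if "w \<notin> x ` {..<n}" for w using that by (simp add: \<phi>_def)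
  have \<phi>: "\<phi> \<in> l2 (verts G)" using xV \<phi>0 by (intro l2_finite_support[of "x ` {..<n}"]) auto
  have cc: "cos (t - \<theta>) + cos (t + \<theta>) = 2 * cos \<theta> * cos t" for t by (simp add: cos_add cos_diff)
  have c1: "c (j - 1) + c (Suc j) = 2 * cos \<theta> * c j" if "j > 0" for j
  proof -
    have "\<theta> * (real (j - 1) + 1 / 2) = \<theta> * (real j + 1 / 2) - \<theta>" "\<theta> * (real (Suc j) + 1 / 2) = \<theta> * (real j + 1 / 2) + \<theta>"
      using that by (simp_all add: of_nat_diff algebra_simps)
    then show ?thesis using cc[of "\<theta> * (real j + 1 / 2)"] unfolding c_def by presburger
  qed
  have c0: "c 0 + c 1 = 2 * cos \<theta> * c 0"
  proof -
    have "\<theta> * (1 / 2) - \<theta> = - (\<theta> * (1 / 2))" "\<theta> * (1 / 2) + \<theta> = \<theta> * (1 + 1 / 2)" by (simp_all add: algebra_simps)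
    then show ?thesis using cc[of "\<theta> * (1 / 2)"] unfolding c_def by (simp add: mult.commute[of \<theta>])
  qed
  have cn: "c (n - 2) + c (n - 1) = 2 * cos \<theta> * c (n - 1)"
  proof -
    define t where "t = \<theta> * (real (n - 1) + 1 / 2)"
    have a: "t = pi - \<theta> / 2" "t - \<theta> = \<theta> * (real (n - 2) + 1 / 2)" "t + \<theta> = pi + \<theta> / 2"
      using n by (simp_all add: t_def \<theta>_def of_nat_diff field_simps)
    have "cos (t + \<theta>) = cos t" unfolding a(1,3) by (simp add: cos_add cos_diff)
    moreover have "c (n - 1) = cos t" "c (n - 2) = cos (t - \<theta>)" unfolding c_def t_def a(2)[unfolded t_def] by simp_all
    ultimately show ?thesis using cc[of t] by simp
  qed
  have nb: "neighbours G (x i) = x ` {j. j < n \<and> (j = Suc i \<or> i = Suc j)}" if i: "i < n" for i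
  proof (intro equalityI subsetI)
    fix w assume "w \<in> neighbours G (x i)" then show "w \<in> x ` {j. j < n \<and> (j = Suc i \<or> i = Suc j)}"
      using only[OF i, of w] by (auto simp: neighbours_adj)
  next
    fix w assume "w \<in> x ` {j. j < n \<and> (j = Suc i \<or> i = Suc j)}"
    then obtain j where "w = x j" "j < n" "j = Suc i \<or> i = Suc j" by auto
    then show "w \<in> neighbours G (x i)" using path[of i] path[of j] i adj_sym[of "x i" "x j" G] by (auto simp: neighbours_adj)
  qed
  have eig: "laplacian G \<phi> = (\<lambda>v. complex_of_real l * \<phi> v)"
  proof
    fix w
    show "laplacian G \<phi> w = complex_of_real l * \<phi> w"
    proof (cases "w \<in> x ` {..<n}")
      case False
      \<comment> \<open>By \<open>only\<close> no edge leaves the path, so \<open>\<phi>\<close>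
        vanishes at \<open>w\<close> and at all its neighbours.\<close>
      have "\<phi> w - \<phi> w' = 0" if "w' \<in> neighbours G w" for w'
      proof -
        have "w' \<notin> x ` {..<n}"
        proof
          assume "w' \<in> x ` {..<n}"
          then obtain i where "i < n" "w' = x i" by auto
          then show False using only[of i w] that False adj_sym[of w w' G] by (auto simp: neighbours_adj)
        qed
        then show ?thesis using False \<phi>0 by simp
      qed
      then show ?thesis using False \<phi>0 by (simp add: laplacian_def)
    next
      case True
      then obtain i where i: "i < n" "w = x i" by auto
      let ?J = "{j. j < n \<and> (j = Suc i \<or> i = Suc j)}"
      have "laplacian G \<phi> w = (\<Sum>j\<in>?J. \<phi> (x i) - \<phi> (x j))"
        using i xV inj by (simp add: laplacian_def nb, subst sum.reindex) (auto intro: inj_on_subset)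
      also have "\<dots> = (\<Sum>j\<in>?J. complex_of_real (c i - c j))"
        using i by (intro sum.cong) (auto simp: \<phi>x)
      also have "\<dots> = complex_of_real (\<Sum>j\<in>?J. c i - c j)" by simp
      also have "(\<Sum>j\<in>?J. c i - c j) = l * c i"
      proof -
        consider "i = 0" | "0 < i" "i < n - 1" | "i = n - 1" "0 < i" using i n by linarith
        then show ?thesis
        proof cases
          case 1
          then have "?J = {1}" using n by auto
          then show ?thesis using c0 1 by (simp add: l_def algebra_simps)
        next
          case 2
          then have "?J = {i - 1, Suc i}" "i - 1 \<noteq> Suc i" by auto
          then show ?thesis using c1[of i] 2 by (simp add: l_def algebra_simps)
        next
          case 3
          then have "?J = {n - 2}" using n by auto
          then show ?thesis using cn 3 by (simp add: l_def algebra_simps)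
        qed
      qed
      finally show ?thesis using i \<phi>x by simp
    qed
  qed
  have \<theta>: "0 < \<theta>" "\<theta> \<le> pi / 2" using n by (auto simp: \<theta>_def field_simps)
  have l: "l \<in> {0<..E}"
  proof -
    have lsin: "l = 4 * (sin (\<theta> / 2))\<^sup>2"
      using cos_double_sin[of "\<theta> / 2"] by (simp add: l_def)
    have "0 < sin (\<theta> / 2)" using \<theta> by (intro sin_gt_zero) auto
    moreover have "sin (\<theta> / 2) \<le> \<theta> / 2" using \<theta> by (intro sin_x_le_x) auto
    ultimately have "0 < (sin (\<theta> / 2))\<^sup>2" "(sin (\<theta> / 2))\<^sup>2 \<le> (\<theta> / 2)\<^sup>2" by (auto intro: power_mono)
    moreover have "4 * (\<theta> / 2)\<^sup>2 \<le> E" using E by (simp add: \<theta>_def power_divide)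
    ultimately show ?thesis by (simp add: lsin)
  qed
  have norm: "(l2_norm (verts G) \<phi>)\<^sup>2 \<le> real n"
  proof -
    have "complex_of_real ((l2_norm (verts G) \<phi>)\<^sup>2) = (\<Sum>w\<in>x ` {..<n}. cnj (\<phi> w) * \<phi> w)"
      unfolding l2_inner_self[OF \<phi>, symmetric] using xV \<phi>0 by (intro l2_inner_finite_support) auto
    also have "\<dots> = (\<Sum>j<n. complex_of_real ((c j)\<^sup>2))"
      using inj \<phi>x by (subst sum.reindex) (auto simp: power2_eq_square)
    also have "\<dots> = complex_of_real (\<Sum>j<n. (c j)\<^sup>2)" by simp
    finally have "(l2_norm (verts G) \<phi>)\<^sup>2 = (\<Sum>j<n. (c j)\<^sup>2)" by (simp only: of_real_eq_iff)
    also have "\<dots> \<le> (\<Sum>j<n. 1)" by (intro sum_mono) (simp add: c_def abs_square_le_1)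
    finally show ?thesis by simp
  qed
  \<comment> \<open>From \<open>n \<ge> 2\<close> follows \<open>\<theta> / 2 \<le> pi / 4\<close>,
    so the first vertex has weight at least 1/2 against a total of at most \<open>n\<close>.\<close>
  have "1 / 2 \<le> (cmod (\<phi> (x 0)))\<^sup>2"
  proof -
    have "cos (pi / 4) \<le> cos (\<theta> / 2)" using \<theta> by (intro cos_monotone_0_pi_le) auto
    then have "(sqrt 2 / 2)\<^sup>2 \<le> (cos (\<theta> / 2))\<^sup>2" by (intro power_mono) (auto simp: cos_45)
    moreover have "(sqrt 2 / 2)\<^sup>2 = (1 / 2 :: real)" by (simp add: power_divide)
    moreover have "(cmod (\<phi> (x 0)))\<^sup>2 = (cos (\<theta> / 2))\<^sup>2" using \<phi>x[of 0] n by (simp add: c_def norm_power[symmetric])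
    ultimately show ?thesis by simp
  qed
  also have "\<dots> \<le> measure (\<mu> (delta (x 0))) {l} * (l2_norm (verts G) \<phi>)\<^sup>2"
    by (rule eigenvector_weight[OF \<phi> eig]) (use xV n in auto)
  also have "\<dots> \<le> measure (\<mu> (delta (x 0))) {0<..E} * real n"
  proof (intro mult_mono norm)
    have d: "delta (x 0) \<in> l2 (verts G)" using xV n by (intro delta_l2) auto
    interpret finite_measure "\<mu> (delta (x 0))" using interval_\<mu>[OF d] by (simp add: interval_measure_on_def)
    show "measure (\<mu> (delta (x 0))) {l} \<le> measure (\<mu> (delta (x 0))) {0<..E}"
      using l interval_\<mu>[OF d] by (intro finite_measure_mono) (auto simp: interval_measure_on_def)
  qed auto
  finally show ?thesis using n by (simp add: field_simps)
qed

end

subsection \<open>Exploration of a percolation cluster\<close>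

text \<open>The expectation of \<open>g\<close> at a random subset of \<open>F\<close> whose
  elements are kept independently with probability \<open>p\<close>. In this finite form the
  exploration is an induction on the number of edges.\<close>

definition bernoulli_sum :: "real \<Rightarrow> 'b set \<Rightarrow> ('b set \<Rightarrow> real) \<Rightarrow> real" where
  "bernoulli_sum p F g = (\<Sum>S\<in>Pow F. p ^ card S * (1 - p) ^ card (F - S) * g S)"

lemma bernoulli_sum_insert:
  assumes "finite F" "e \<notin> F"
  shows "bernoulli_sum p (insert e F) g =
    p * bernoulli_sum p F (\<lambda>S. g (insert e S)) + (1 - p) * bernoulli_sum p F g"
proof -
  let ?t = "\<lambda>S. p ^ card S * (1 - p) ^ card (insert e F - S) * g S"
  have "Pow F \<inter> insert e ` Pow F = {}" using assms by auto
  then have "bernoulli_sum p (insert e F) g = sum ?t (Pow F) + sum ?t (insert e ` Pow F)"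
    unfolding bernoulli_sum_def Pow_insert using assms by (intro sum.union_disjoint) auto
  also have "sum ?t (insert e ` Pow F) = (\<Sum>S\<in>Pow F. ?t (insert e S))"
    using assms by (subst sum.reindex) (auto simp: inj_on_def)
  also have "\<dots> = p * bernoulli_sum p F (\<lambda>S. g (insert e S))"
    unfolding bernoulli_sum_def sum_distrib_left
  proof (rule sum.cong[OF refl])
    fix S assume "S \<in> Pow F"
    then have "finite S" "e \<notin> S" "insert e F - insert e S = F - S" using assms finite_subset by auto
    then show "?t (insert e S) = p * (p ^ card S * (1 - p) ^ card (F - S) * g (insert e S))" by simp
  qed
  also have "sum ?t (Pow F) = (1 - p) * bernoulli_sum p F g"
    unfolding bernoulli_sum_def sum_distrib_left
  proof (rule sum.cong[OF refl])
    fix S assume "S \<in> Pow F"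
    then have "insert e F - S = insert e (F - S)" "e \<notin> F - S" using assms by auto
    then show "?t S = (1 - p) * (p ^ card S * (1 - p) ^ card (F - S) * g S)" using assms by simp
  qed
  finally show ?thesis by simp
qed

lemma bernoulli_sum_const: "finite F \<Longrightarrow> bernoulli_sum p F (\<lambda>_. c) = c"
proof (induction F rule: finite_induct)
  case empty then show ?case by (simp add: bernoulli_sum_def)
next
  case (insert e F) then show ?case by (simp add: bernoulli_sum_insert algebra_simps)
qed

lemma bernoulli_sum_mono:
  assumes "0 \<le> p" "p \<le> 1" "\<And>S. S \<subseteq> F \<Longrightarrow> g S \<le> g' S"
  shows "bernoulli_sum p F g \<le> bernoulli_sum p F g'"
  unfolding bernoulli_sum_def using assms by (intro sum_mono mult_left_mono) auto

text \<open>It starts from a set rather than a vertex because the exploration absorbs each vertex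
  that it discovers into \<open>A\<close>.\<close>

definition reach :: "'a set set \<Rightarrow> 'a set \<Rightarrow> 'a set" where
  "reach S A = {w. \<exists>a\<in>A. (a, w) \<in> {(x, y). {x, y} \<in> S}\<^sup>*}"

lemma reach_base: "a \<in> A \<Longrightarrow> a \<in> reach S A"
  by (auto simp: reach_def)

lemma reach_step: "y \<in> reach S A \<Longrightarrow> {y, w} \<in> S \<Longrightarrow> w \<in> reach S A"
  by (auto simp: reach_def intro: rtrancl_into_rtrancl)

lemma reach_least:
  assumes "A \<subseteq> T" "\<And>y w. y \<in> T \<Longrightarrow> {y, w} \<in> S \<Longrightarrow> w \<in> T"
  shows "reach S A \<subseteq> T"
proof
  fix w assume "w \<in> reach S A"
  then obtain a where "a \<in> A" "(a, w) \<in> {(x, y). {x, y} \<in> S}\<^sup>*" by (auto simp: reach_def)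
  from this(2) show "w \<in> T" by (induction rule: rtrancl_induct) (use \<open>a \<in> A\<close> assms in auto)
qed

lemma reach_mono: "S \<subseteq> S' \<Longrightarrow> A \<subseteq> A' \<Longrightarrow> reach S A \<subseteq> reach S' A'"
  by (rule reach_least) (auto intro: reach_base reach_step)

lemma reach_insert:
  assumes "a \<in> A" shows "reach (insert {a, x} S) A = reach S (insert x A)"
proof
  show "reach (insert {a, x} S) A \<subseteq> reach S (insert x A)"
    by (rule reach_least) (use assms in \<open>auto simp: doubleton_eq_iff intro: reach_base reach_step\<close>)
  have "x \<in> reach (insert {a, x} S) A" using reach_step[OF reach_base[OF assms]] by blast
  then show "reach S (insert x A) \<subseteq> reach (insert {a, x} S) A"
    by (intro reach_least) (auto intro: reach_base reach_step)
qed

lemma reach_finite: "finite S \<Longrightarrow> (\<And>e. e \<in> S \<Longrightarrow> finite e) \<Longrightarrow> finite A \<Longrightarrow> finite (reach S A)"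
proof (rule finite_subset)
  show "reach S A \<subseteq> A \<union> \<Union>S" by (rule reach_least) auto
qed auto

text \<open>The edges at the boundary of the explored set \<open>A\<close> are revealed one at a time: a closed edge
  removes one factor \<open>\<alpha>\<close>, an open one adds a vertex with at most \<open>D - 1\<close> unexplored edges. The
  assumption on \<open>z\<close> and \<open>\<alpha>\<close> makes the weight \<open>z ^ card A * \<alpha> ^ boundary\<close> a supermartingale.\<close>

lemma exploration_bound:
  fixes F :: "'a set set"
  assumes p: "0 \<le> p" "p \<le> 1" and \<alpha>: "1 \<le> \<alpha>" and z: "1 \<le> z"
    and super: "(1 - p) + p * z * \<alpha> ^ (D - 1) \<le> \<alpha>"
    and F: "finite F" "\<And>e. e \<in> F \<Longrightarrow> \<exists>x y. e = {x, y}" and A: "finite A"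
    and deg: "\<And>x. x \<notin> A \<Longrightarrow> card {e \<in> F. x \<in> e} \<le> D"
  shows "bernoulli_sum p F (\<lambda>S. z ^ card (reach S A)) \<le>
    z ^ card A * \<alpha> ^ card {e \<in> F. e \<inter> A \<noteq> {} \<and> \<not> e \<subseteq> A}"
  using F A deg
proof (induction "card F" arbitrary: F A)
  case 0
  then have "F = {}" by simp
  moreover have "reach {} A = A" by (rule antisym[OF reach_least]) (auto intro: reach_base)
  ultimately show ?case by (simp add: bernoulli_sum_def)
next
  case (Suc m)
  show ?case
  proof (cases "\<exists>e\<in>F. e \<inter> A \<noteq> {} \<and> \<not> e \<subseteq> A")
    case False
    then have no: "\<forall>e\<in>F. e \<inter> A = {} \<or> e \<subseteq> A" by simp
    have "reach S A = A" if "S \<subseteq> F" for S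
    proof (rule antisym[OF reach_least])
      fix y w assume "y \<in> A" "{y, w} \<in> S"
      then show "w \<in> A" using bspec[OF no subsetD[OF that], of "{y, w}"] by simp
    qed (auto intro: reach_base)
    then have "bernoulli_sum p F (\<lambda>S. z ^ card (reach S A)) \<le> bernoulli_sum p F (\<lambda>S. z ^ card A)"
      using p by (intro bernoulli_sum_mono) auto
    moreover have empty: "{e \<in> F. e \<inter> A \<noteq> {} \<and> \<not> e \<subseteq> A} = {}" using False by auto
    ultimately show ?thesis unfolding empty using Suc.prems(1) by (simp add: bernoulli_sum_const)
  next
    case True
    then obtain e where e: "e \<in> F" "e \<inter> A \<noteq> {}" "\<not> e \<subseteq> A" by blast
    obtain u w where "e = {u, w}" using Suc.prems(2)[OF e(1)] by blast
    then obtain a x where ax: "e = {a, x}" "a \<in> A" "x \<notin> A" using e by (cases "u \<in> A") auto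
    define F' where "F' = F - {e}"
    have F': "F = insert e F'" "e \<notin> F'" "finite F'" "card F' = m"
      using e(1) Suc.prems(1) Suc.hyps(2) by (auto simp: F'_def)
    define b where "b = card {e \<in> F'. e \<inter> A \<noteq> {} \<and> \<not> e \<subseteq> A}"
    have "{e \<in> F. e \<inter> A \<noteq> {} \<and> \<not> e \<subseteq> A} = insert e {e \<in> F'. e \<inter> A \<noteq> {} \<and> \<not> e \<subseteq> A}"
      using F'(1) e by auto
    then have bF: "card {e \<in> F. e \<inter> A \<noteq> {} \<and> \<not> e \<subseteq> A} = Suc b" using F' by (simp add: b_def)
    have deg': "card {e \<in> F'. y \<in> e} \<le> D" if "y \<notin> A" for y
    proof -
      have "card {e \<in> F'. y \<in> e} \<le> card {e \<in> F. y \<in> e}" using Suc.prems(1) by (intro card_mono) (auto simp: F'_def)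
      then show ?thesis using Suc.prems(4)[OF that] by simp
    qed
    \<comment> \<open>The edge just revealed is one of those at \<open>x\<close>; this turns
      \<open>D\<close> into \<open>D - 1\<close>.\<close>
    have "{e \<in> F. x \<in> e} = insert e {e \<in> F'. x \<in> e}" using F'(1) ax by auto
    then have degx: "card {e \<in> F'. x \<in> e} \<le> D - 1" using Suc.prems(4)[OF ax(3)] F' by simp
    have "card {e \<in> F'. e \<inter> insert x A \<noteq> {} \<and> \<not> e \<subseteq> insert x A} \<le>
        card ({e \<in> F'. e \<inter> A \<noteq> {} \<and> \<not> e \<subseteq> A} \<union> {e \<in> F'. x \<in> e})"
      using F'(3) by (intro card_mono) auto
    also have "\<dots> \<le> b + (D - 1)" by (rule order_trans[OF card_Un_le]) (use degx in \<open>simp add: b_def\<close>)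
    finally have bx: "card {e \<in> F'. e \<inter> insert x A \<noteq> {} \<and> \<not> e \<subseteq> insert x A} \<le> b + (D - 1)" .
    have open_le: "bernoulli_sum p F' (\<lambda>S. z ^ card (reach S (insert x A))) \<le> z ^ Suc (card A) * \<alpha> ^ (b + (D - 1))"
    proof -
      have "bernoulli_sum p F' (\<lambda>S. z ^ card (reach S (insert x A))) \<le>
          z ^ card (insert x A) * \<alpha> ^ card {e \<in> F'. e \<inter> insert x A \<noteq> {} \<and> \<not> e \<subseteq> insert x A}"
        using Suc.prems(2,3) F' deg' by (intro Suc.hyps(1)) auto
      also have "\<dots> \<le> z ^ card (insert x A) * \<alpha> ^ (b + (D - 1))"
        using bx \<alpha> z by (intro mult_left_mono power_increasing) auto
      finally show ?thesis using ax Suc.prems(3) by simp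
    qed
    have closed_le: "bernoulli_sum p F' (\<lambda>S. z ^ card (reach S A)) \<le> z ^ card A * \<alpha> ^ b"
      unfolding b_def using Suc.prems(2,3) F' deg' by (intro Suc.hyps(1)) auto
    have "bernoulli_sum p F (\<lambda>S. z ^ card (reach S A)) =
        p * bernoulli_sum p F' (\<lambda>S. z ^ card (reach S (insert x A))) +
        (1 - p) * bernoulli_sum p F' (\<lambda>S. z ^ card (reach S A))"
      unfolding F'(1) bernoulli_sum_insert[OF F'(3,2)] by (simp only: ax(1) reach_insert[OF ax(2)])
    also have "\<dots> \<le> p * (z ^ Suc (card A) * \<alpha> ^ (b + (D - 1))) + (1 - p) * (z ^ card A * \<alpha> ^ b)"
      using open_le closed_le p by (intro add_mono mult_left_mono) auto
    also have "\<dots> = z ^ card A * \<alpha> ^ b * ((1 - p) + p * z * \<alpha> ^ (D - 1))"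
      by (simp add: power_add algebra_simps)
    also have "\<dots> \<le> z ^ card A * \<alpha> ^ b * \<alpha>" using super \<alpha> z by (intro mult_left_mono) auto
    finally show ?thesis unfolding bF by (simp add: mult_ac)
  qed
qed

text \<open>At \<open>\<alpha> = z = 1\<close> the inequality is an equality, and its slack has the
  derivative \<open>1 - p * (D - 1) > 0\<close> in \<open>\<alpha>\<close>. A slightly larger
  \<open>\<alpha>\<close> leaves room for some \<open>z > 1\<close>, which is taken so large that
  equality holds again.\<close>

lemma subcritical_weights:
  assumes p: "0 < p" "p * (real D - 1) < 1" and D: "1 \<le> D"
  obtains \<alpha> z :: real where "1 \<le> \<alpha>" "1 < z" "(1 - p) + p * z * \<alpha> ^ (D - 1) \<le> \<alpha>"
proof -
  define f where "f \<alpha> = \<alpha> - (1 - p) - p * \<alpha> ^ (D - 1)" for \<alpha> :: real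
  have "DERIV f 1 :> 1 - p * (real D - 1)"
    unfolding f_def[abs_def] using D by (auto intro!: derivative_eq_intros simp: of_nat_diff)
  then obtain d where d: "d > 0" "\<And>h. 0 < h \<Longrightarrow> h < d \<Longrightarrow> f 1 < f (1 + h)"
    using DERIV_pos_inc_right[of f _ 1] p by (metis diff_gt_0_iff_gt)
  define \<alpha> where "\<alpha> = 1 + d / 2"
  have \<alpha>: "1 \<le> \<alpha>" "0 < f \<alpha>" using d(1) d(2)[of "d / 2"] by (auto simp: \<alpha>_def f_def)
  define z where "z = (\<alpha> - (1 - p)) / (p * \<alpha> ^ (D - 1))"
  have pos: "0 < p * \<alpha> ^ (D - 1)" using p \<alpha> by simp
  have "p * \<alpha> ^ (D - 1) < \<alpha> - (1 - p)" using \<alpha> by (simp add: f_def)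
  then have "1 < z" using pos by (simp add: z_def field_simps)
  moreover have "z * (p * \<alpha> ^ (D - 1)) = \<alpha> - (1 - p)"
    unfolding z_def by (rule nonzero_eq_divide_eq[THEN iffD1]) (use pos in linarith, rule refl)
  then have "(1 - p) + p * z * \<alpha> ^ (D - 1) = \<alpha>" by (simp add: mult_ac)
  ultimately show ?thesis using that \<alpha> by simp
qed

subsection \<open>Percolation measures\<close>

context
  fixes p :: real
  assumes p01: "0 \<le> p" "p \<le> 1"
begin

lemma product_prob_space_percolation: "product_prob_space (\<lambda>e. measure_pmf (bernoulli_pmf p))"
  by standard

lemma prob_space_percolation: "prob_space (percolation p G)"
  unfolding percolation_def by (intro prob_space_PiM) (rule prob_space_measure_pmf)

lemma measurable_coordinate [measurable]:
  "e \<in> edges G \<Longrightarrow> (\<lambda>\<omega>. \<omega> e) \<in> measurable (percolation p G) (count_space UNIV)"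
  unfolding percolation_def by (rule measurable_compose[OF measurable_component_singleton]) auto

lemma cylinder:
  assumes "finite S" "finite T" "S \<inter> T = {}" "S \<subseteq> edges G" "T \<subseteq> edges G"
  defines "C \<equiv> {\<omega> \<in> space (percolation p G). (\<forall>e\<in>S. \<omega> e) \<and> (\<forall>e\<in>T. \<not> \<omega> e)}"
  shows "C \<in> sets (percolation p G)" "measure (percolation p G) C = p ^ card S * (1 - p) ^ card T"
proof -
  interpret product_prob_space "\<lambda>e. measure_pmf (bernoulli_pmf p)" "edges G"
    by (rule product_prob_space_percolation)
  define X where "X e = (if e \<in> S then {True} else {False})" for e :: "'a set"
  have C: "C = {\<omega> \<in> space (percolation p G). \<forall>e\<in>S \<union> T. \<omega> e \<in> X e}"
    using assms(3) by (auto simp: C_def X_def)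
  have "emeasure (percolation p G) C = (\<Prod>e\<in>S \<union> T. emeasure (measure_pmf (bernoulli_pmf p)) (X e))"
    unfolding C percolation_def using assms by (intro emeasure_PiM_Collect) auto
  also have "\<dots> = (\<Prod>e\<in>S. emeasure (measure_pmf (bernoulli_pmf p)) (X e)) *
      (\<Prod>e\<in>T. emeasure (measure_pmf (bernoulli_pmf p)) (X e))"
    using assms by (intro prod.union_disjoint)
  also have "\<dots> = ennreal p ^ card S * ennreal (1 - p) ^ card T"
  proof (rule arg_cong2[where f = "(*)"])
    have "(\<Prod>e\<in>S. emeasure (measure_pmf (bernoulli_pmf p)) (X e)) = (\<Prod>e\<in>S. ennreal p)"
      using p01 by (intro prod.cong) (auto simp: X_def emeasure_pmf_single)
    then show "(\<Prod>e\<in>S. emeasure (measure_pmf (bernoulli_pmf p)) (X e)) = ennreal p ^ card S" by simp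
    have "(\<Prod>e\<in>T. emeasure (measure_pmf (bernoulli_pmf p)) (X e)) = (\<Prod>e\<in>T. ennreal (1 - p))"
      using p01 assms(3) by (intro prod.cong) (auto simp: X_def emeasure_pmf_single)
    then show "(\<Prod>e\<in>T. emeasure (measure_pmf (bernoulli_pmf p)) (X e)) = ennreal (1 - p) ^ card T" by simp
  qed
  also have "\<dots> = ennreal (p ^ card S * (1 - p) ^ card T)"
    using p01 by (simp add: ennreal_power ennreal_mult)
  finally show "measure (percolation p G) C = p ^ card S * (1 - p) ^ card T"
    using p01 by (simp add: measure_def)
  have "{\<omega> \<in> space (percolation p G). \<forall>e\<in>S. \<omega> e} \<in> sets (percolation p G)"
    "{\<omega> \<in> space (percolation p G). \<forall>e\<in>T. \<not> \<omega> e} \<in> sets (percolation p G)"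
    using assms by (auto intro!: sets.sets_Collect_finite_All' sets.sets_Collect_finite_All measurable_sets_Collect pred_intros_finite simp flip: pred_def)
  then have "{\<omega> \<in> space (percolation p G). \<forall>e\<in>S. \<omega> e} \<inter> {\<omega> \<in> space (percolation p G). \<forall>e\<in>T. \<not> \<omega> e} \<in> sets (percolation p G)"
    by (rule sets.Int)
  moreover have "{\<omega> \<in> space (percolation p G). \<forall>e\<in>S. \<omega> e} \<inter> {\<omega> \<in> space (percolation p G). \<forall>e\<in>T. \<not> \<omega> e} = C"
    by (auto simp: C_def)
  ultimately show "C \<in> sets (percolation p G)" by simp
qed

text \<open>The bridge from the product measure to \<open>bernoulli_sum\<close>: an event that
  depends on finitely many edges is a finite disjoint union of cylinders.\<close>

lemma open_edges_prob:
  fixes Q :: "'a set set \<Rightarrow> bool"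
  assumes F: "finite F" "F \<subseteq> edges G"
  defines "C \<equiv> {\<omega> \<in> space (percolation p G). Q {e \<in> F. \<omega> e}}"
  shows "C \<in> sets (percolation p G)"
    and "measure (percolation p G) C = bernoulli_sum p F (\<lambda>S. if Q S then 1 else 0)"
proof -
  interpret prob_space "percolation p G" by (rule prob_space_percolation)
  define Z where "Z S = {\<omega> \<in> space (percolation p G). (\<forall>e\<in>S. \<omega> e) \<and> (\<forall>e\<in>F - S. \<not> \<omega> e)}" for S
  have Z: "Z S \<in> sets (percolation p G)" "prob (Z S) = p ^ card S * (1 - p) ^ card (F - S)" if "S \<subseteq> F" for S
    unfolding Z_def using that F by (auto intro!: cylinder finite_subset[OF that])
  have Ze: "Z S = {\<omega> \<in> space (percolation p G). {e \<in> F. \<omega> e} = S}" if "S \<subseteq> F" for S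
    using that by (auto simp: Z_def)
  have C: "C = (\<Union>S\<in>{S \<in> Pow F. Q S}. Z S)" using Ze by (auto simp: C_def)
  have fin: "finite {S \<in> Pow F. Q S}" using F by simp
  show "C \<in> sets (percolation p G)" unfolding C using fin Z by (intro sets.finite_UN) auto
  have "prob C = (\<Sum>S\<in>{S \<in> Pow F. Q S}. prob (Z S))"
    unfolding C using fin Z Ze by (intro finite_measure_finite_Union) (auto simp: disjoint_family_on_def)
  also have "\<dots> = (\<Sum>S\<in>{S \<in> Pow F. Q S}. p ^ card S * (1 - p) ^ card (F - S) * 1)" using Z by (intro sum.cong) auto
  also have "\<dots> = bernoulli_sum p F (\<lambda>S. if Q S then 1 else 0)"
    unfolding bernoulli_sum_def using F by (intro sum.mono_neutral_cong_left) auto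
  finally show "prob C = bernoulli_sum p F (\<lambda>S. if Q S then 1 else 0)" .
qed

end

lemma adj_open_subgraph: "(a, b) \<in> adj (open_subgraph G \<omega>) \<longleftrightarrow> (a, b) \<in> adj G \<and> \<omega> {a, b}"
  by (simp add: adj_def open_subgraph_def)

lemma verts_open_subgraph [simp]: "verts (open_subgraph G \<omega>) = verts G"
  by (simp add: open_subgraph_def)

lemma neighbours_open_subgraph: "neighbours (open_subgraph G \<omega>) v = {w \<in> neighbours G v. \<omega> {v, w}}"
  by (auto simp: neighbours_adj adj_open_subgraph)

context bounded_graph
begin

lemma subgraph:
  assumes "verts H \<subseteq> verts G" "edges H \<subseteq> edges G"
    "\<And>e. e \<in> edges H \<Longrightarrow> e \<subseteq> verts H"
  shows "bounded_graph H D"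
proof
  have nb: "neighbours H v \<subseteq> neighbours G v" for v using assms by (auto simp: neighbours_def)
  show "simple_graph H" unfolding simple_graph_def
  proof (intro conjI subsetI)
    show "countable (verts H)" using simple assms(1) countable_subset by (auto simp: simple_graph_def)
    fix e assume e: "e \<in> edges H"
    then obtain u v where "e = {u, v}" "u \<noteq> v" using simple assms(2) by (auto simp: simple_graph_def)
    then show "e \<in> {{u, v} |u v. u \<in> verts H \<and> v \<in> verts H \<and> u \<noteq> v}" using assms(3)[OF e] by auto
  qed
  fix v assume "v \<in> verts H"
  then have v: "v \<in> verts G" using assms by auto
  show "finite (neighbours H v)" using nb finite_neighbours[OF v] finite_subset by blast
  show "card (neighbours H v) \<le> D"
    using card_mono[OF finite_neighbours[OF v] nb] degree_le[OF v] by simp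
qed (rule D_pos)

lemma edge_verts: "e \<in> edges G \<Longrightarrow> e \<subseteq> verts G"
  using simple by (auto simp: simple_graph_def)

lemma edge_pair: "e \<in> edges G \<Longrightarrow> \<exists>x y. e = {x, y}"
  using simple unfolding simple_graph_def by blast

lemma bounded_graph_open_subgraph: "bounded_graph (open_subgraph G \<omega>) D"
  by (rule subgraph) (use edge_verts in \<open>auto simp: open_subgraph_def\<close>)

lemma bounded_graph_induced: "bounded_graph (induced G U) D"
  by (rule subgraph) (use edge_verts in \<open>auto simp: induced_def\<close>)

lemma edges_at: 
  shows "finite {e \<in> edges G. x \<in> e}" "card {e \<in> edges G. x \<in> e} \<le> D"
proof -
  have "{e \<in> edges G. x \<in> e} = (\<lambda>w. {x, w}) ` neighbours G x"
  proof (intro equalityI subsetI)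
    fix e assume e: "e \<in> {e \<in> edges G. x \<in> e}"
    then obtain y z where "e = {y, z}" using edge_pair by blast
    then obtain w where "e = {x, w}" using e by (auto simp: insert_commute)
    then show "e \<in> (\<lambda>w. {x, w}) ` neighbours G x" using e by (auto simp: neighbours_def)
  qed (auto simp: neighbours_def)
  moreover have "finite (neighbours G x) \<and> card (neighbours G x) \<le> D"
  proof (cases "x \<in> verts G")
    case False
    then have "neighbours G x = {}" using edge_verts by (auto simp: neighbours_def)
    then show ?thesis by simp
  qed (simp add: finite_neighbours degree_le)
  ultimately show "finite {e \<in> edges G. x \<in> e}" "card {e \<in> edges G. x \<in> e} \<le> D"
    using card_image_le[of "neighbours G x" "\<lambda>w. {x, w}"] by auto
qed

lemma countable_edges: "countable (edges G)"
proof -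
  have "edges G \<subseteq> (\<lambda>(u, v). {u, v}) ` (verts G \<times> verts G)" using simple by (auto simp: simple_graph_def)
  moreover have "countable (verts G)" using simple by (simp add: simple_graph_def)
  ultimately show ?thesis by (meson countable_SIGMA countable_image countable_subset)
qed

lemma cluster_reach: "cluster G v = reach (edges G) {v}"
  by (simp add: cluster_def reach_def adj_def)

text \<open>Markov's inequality for \<open>z ^ card\<close> and the exploration bound control the
  clusters formed by the finitely many edges \<open>F k\<close>, uniformly in \<open>k\<close>. The
  exceptional event is the increasing union of the \<open>A k\<close>; it is measurable by
  construction and contains all configurations in which the cluster of \<open>v\<close> is
  infinite.\<close>

lemma cluster_tail:
  assumes p: "0 \<le> p" "p \<le> 1" and \<alpha>: "1 \<le> \<alpha>" and z: "1 < z"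
    and super: "(1 - p) + p * z * \<alpha> ^ (D - 1) \<le> \<alpha>"
  obtains A where "A \<in> sets (percolation p G)" "measure (percolation p G) A \<le> z * \<alpha> ^ D / z ^ n"
    "\<And>\<omega>. \<omega> \<in> space (percolation p G) - A \<Longrightarrow>
      finite (cluster (open_subgraph G \<omega>) v) \<and> card (cluster (open_subgraph G \<omega>) v) < n"
proof -
  interpret prob_space "percolation p G" by (rule prob_space_percolation[OF p])
  define F where "F k = {e \<in> edges G. to_nat_on (edges G) e < k}" for k
  have F_sub: "F k \<subseteq> edges G" for k by (auto simp: F_def)
  have F_fin: "finite (F k)" for k
  proof (rule finite_imageD)
    show "finite (to_nat_on (edges G) ` F k)" by (rule finite_subset[of _ "{..<k}"]) (auto simp: F_def)
    show "inj_on (to_nat_on (edges G)) (F k)"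
      using inj_on_to_nat_on[OF countable_edges] F_sub by (rule inj_on_subset)
  qed
  define T where "T k \<omega> = reach {e \<in> F k. \<omega> e} {v}" for k and \<omega> :: "'a set \<Rightarrow> bool"
  have T_fin: "finite (T k \<omega>)" for k \<omega>
    unfolding T_def using F_fin F_sub edge_pair by (intro reach_finite) fastforce+
  have T_mono: "T k \<omega> \<subseteq> T k' \<omega>" if "k \<le> k'" for k k' \<omega>
    unfolding T_def using that by (intro reach_mono) (auto simp: F_def)
  define A where "A k = {\<omega> \<in> space (percolation p G). n \<le> card (T k \<omega>)}" for k
  have A_sets: "A k \<in> events" for k
    unfolding A_def T_def by (rule open_edges_prob[OF p F_fin F_sub])
  have A_prob: "prob (A k) \<le> z * \<alpha> ^ D / z ^ n" for k
  proof -
    have "prob (A k) = bernoulli_sum p (F k) (\<lambda>S. if n \<le> card (reach S {v}) then 1 else 0)"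
      unfolding A_def T_def by (rule open_edges_prob[OF p F_fin F_sub])
    also have "\<dots> \<le> bernoulli_sum p (F k) (\<lambda>S. z ^ card (reach S {v}) / z ^ n)"
      using p z by (intro bernoulli_sum_mono) (auto intro!: power_increasing)
    also have "\<dots> = bernoulli_sum p (F k) (\<lambda>S. z ^ card (reach S {v})) / z ^ n"
      by (simp add: bernoulli_sum_def sum_divide_distrib)
    also have "\<dots> \<le> (z ^ card {v} * \<alpha> ^ card {e \<in> F k. e \<inter> {v} \<noteq> {} \<and> \<not> e \<subseteq> {v}}) / z ^ n"
    proof (intro divide_right_mono exploration_bound[OF p \<alpha> _ super F_fin])
      have "card {e \<in> F k. x \<in> e} \<le> card {e \<in> edges G. x \<in> e}" for x
        using edges_at F_sub by (intro card_mono) auto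
      then show "card {e \<in> F k. x \<in> e} \<le> D" for x using edges_at(2) order_trans by blast
      show "\<exists>x y. e = {x, y}" if "e \<in> F k" for e using edge_pair F_sub that by blast
    qed (use z in auto)
    \<comment> \<open>The exploration starts with at most \<open>D\<close> edges at the boundary of
      \<open>{v}\<close>.\<close>
    also have "\<dots> \<le> (z ^ card {v} * \<alpha> ^ D) / z ^ n"
    proof (intro divide_right_mono mult_left_mono power_increasing)
      have "card {e \<in> F k. e \<inter> {v} \<noteq> {} \<and> \<not> e \<subseteq> {v}} \<le> card {e \<in> edges G. v \<in> e}"
        using edges_at F_sub by (intro card_mono) auto
      then show "card {e \<in> F k. e \<inter> {v} \<noteq> {} \<and> \<not> e \<subseteq> {v}} \<le> D" using edges_at(2)[of v] by simp
    qed (use z \<alpha> in auto)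
    finally show ?thesis by simp
  qed
  have "incseq A"
    unfolding incseq_def A_def using card_mono[OF T_fin T_mono] by (auto intro: order_trans)
  then have "(\<lambda>k. prob (A k)) \<longlonglongrightarrow> prob (\<Union>k. A k)"
    using A_sets by (intro finite_Lim_measure_incseq) auto
  then have 1: "prob (\<Union>k. A k) \<le> z * \<alpha> ^ D / z ^ n"
    by (rule LIMSEQ_le_const2) (use A_prob in auto)
  have 2: "finite (cluster (open_subgraph G \<omega>) v) \<and> card (cluster (open_subgraph G \<omega>) v) < n"
    if \<omega>: "\<omega> \<in> space (percolation p G) - (\<Union>k. A k)" for \<omega>
  proof (rule ccontr)
    let ?C = "cluster (open_subgraph G \<omega>) v"
    assume "\<not> (finite ?C \<and> card ?C < n)"
    \<comment> \<open>Any \<open>n\<close> vertices of the cluster, be it finite or infinite, are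
      already connected to \<open>v\<close> by the open edges of some \<open>F K\<close>.\<close>
    then obtain U where U: "finite U" "card U = n" "U \<subseteq> ?C"
      by (metis infinite_arbitrarily_large not_less obtain_subset_with_card_n)
    have "?C \<subseteq> (\<Union>k. T k \<omega>)"
    proof -
      interpret H: bounded_graph "open_subgraph G \<omega>" D by (rule bounded_graph_open_subgraph)
      show ?thesis unfolding H.cluster_reach
      proof (rule reach_least)
        show "{v} \<subseteq> (\<Union>k. T k \<omega>)" by (auto simp: T_def intro: reach_base)
        fix y w assume y: "y \<in> (\<Union>k. T k \<omega>)" and yw: "{y, w} \<in> edges (open_subgraph G \<omega>)"
        then obtain k where k: "y \<in> T k \<omega>" by blast
        define k' where "k' = max k (Suc (to_nat_on (edges G) {y, w}))"
        have "y \<in> T k' \<omega>" using k T_mono[of k k' \<omega>] by (auto simp: k'_def)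
        then have "w \<in> T k' \<omega>" unfolding T_def using yw
          by (elim reach_step) (auto simp: F_def open_subgraph_def k'_def)
        then show "w \<in> (\<Union>k. T k \<omega>)" by blast
      qed
    qed
    then have "\<forall>u\<in>U. \<exists>k. u \<in> T k \<omega>" using U by blast
    then obtain k where k: "\<And>u. u \<in> U \<Longrightarrow> u \<in> T (k u) \<omega>" by metis
    define K where "K = Max (insert 0 (k ` U))"
    have "U \<subseteq> T K \<omega>"
      using k T_mono[of "k _" K \<omega>] U(1) by (fastforce simp: K_def intro!: Max_ge)
    then have "n \<le> card (T K \<omega>)" using card_mono[OF T_fin] U by metis
    then show False using \<omega> by (auto simp: A_def)
  qed
  show ?thesis using that[of "\<Union>k. A k"] A_sets 1 2 by blast
qed

end


section \<open>Spectral measures averaged over the configurations\<close>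

definition spectral :: "nat \<Rightarrow> 'a graph \<Rightarrow> 'a \<Rightarrow> real measure" where
  "spectral D G v = positive_op.\<mu> (verts G) (laplacian G) (2 * real D) (delta v)"

definition mean_spectral :: "real \<Rightarrow> nat \<Rightarrow> (real \<Rightarrow> real) \<Rightarrow> 'a graph \<Rightarrow> 'a \<Rightarrow> real" where
  "mean_spectral p D f G v = (\<integral>\<omega>. (\<integral>x. f x \<partial>spectral D (open_subgraph G \<omega>) v) \<partial>percolation p G)"

context bounded_graph
begin

text \<open>Opening the first \<open>n - 1\<close> edges of a path of distinct vertices from
  \<open>v\<close>, and closing every other edge at its first \<open>n\<close> vertices, makes the
  cluster of \<open>v\<close> a path. At most \<open>n\<close> edges are opened and at most
  \<open>n * D\<close> closed, whence the probability.\<close>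

lemma path_event:
  assumes p: "0 \<le> p" "p \<le> 1" and v: "v \<in> verts G" and inf: "infinite (cluster G v)"
    and n: "n \<ge> 2" and E: "pi\<^sup>2 / (real n)\<^sup>2 \<le> E"
  obtains A where "A \<in> sets (percolation p G)" "(p * (1 - p) ^ D) ^ n \<le> measure (percolation p G) A"
    "\<And>\<omega>. \<omega> \<in> A \<Longrightarrow> 1 / (2 * real n) \<le> measure (spectral D (open_subgraph G \<omega>) v) {0<..E}"
proof -
  obtain x where x: "x 0 = v" "\<And>i. i < n \<Longrightarrow> (x i, x (Suc i)) \<in> adj G" "inj_on x {..n}"
    using infinite_cluster_path[OF v inf] by metis
  have inj: "inj_on x {..<n}" using x(3) by (rule inj_on_subset) auto
  have xV: "x i \<in> verts G" if "i < n" for i using adj_verts[OF x(2)[OF that]] by simp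
  define S where "S = (\<lambda>i. {x i, x (Suc i)}) ` {i. Suc i < n}"
  define T where "T = (\<Union>i<n. {e \<in> edges G. x i \<in> e}) - S"
  define A where "A = {\<omega> \<in> space (percolation p G). (\<forall>e\<in>S. \<omega> e) \<and> (\<forall>e\<in>T. \<not> \<omega> e)}"
  have in_finite: "finite {i. Suc i < n}" by (rule finite_subset[of _ "{..<n}"]) auto
  have S: "finite S" "card S \<le> n" "S \<subseteq> edges G"
  proof -
    show "finite S" using in_finite by (simp add: S_def)
    have "card S \<le> card {i. Suc i < n}" unfolding S_def by (rule card_image_le[OF in_finite])
    also have "\<dots> \<le> card {..<n}" by (rule card_mono) auto
    finally show "card S \<le> n" by simp
    show "S \<subseteq> edges G" using x(2) by (auto simp: S_def adj_def)
  qed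
  have T: "finite T" "card T \<le> n * D" "T \<subseteq> edges G"
  proof -
    show "finite T" unfolding T_def using edges_at(1) by auto
    have "card T \<le> card (\<Union>i<n. {e \<in> edges G. x i \<in> e})"
      unfolding T_def using edges_at(1) by (intro card_mono) auto
    also have "\<dots> \<le> (\<Sum>i<n. card {e \<in> edges G. x i \<in> e})" by (rule card_UN_le) simp
    also have "\<dots> \<le> (\<Sum>i<n. D)" by (intro sum_mono edges_at)
    finally show "card T \<le> n * D" by simp
    show "T \<subseteq> edges G" by (auto simp: T_def)
  qed
  have ST: "S \<inter> T = {}" by (auto simp: T_def)
  note cyl = cylinder[OF p S(1) T(1) ST S(3) T(3), folded A_def]
  have "(p * (1 - p) ^ D) ^ n = p ^ n * (1 - p) ^ (n * D)"
    by (simp add: power_mult_distrib power_mult[symmetric] mult.commute)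
  also have "\<dots> \<le> p ^ card S * (1 - p) ^ card T"
    using p S T by (intro mult_mono power_decreasing) auto
  finally have prob: "(p * (1 - p) ^ D) ^ n \<le> measure (percolation p G) A" by (simp add: cyl)
  have "1 / (2 * real n) \<le> measure (spectral D (open_subgraph G \<omega>) v) {0<..E}" if \<omega>: "\<omega> \<in> A" for \<omega>
  proof -
    interpret H: bounded_graph "open_subgraph G \<omega>" D by (rule bounded_graph_open_subgraph)
    have "1 / (2 * real n) \<le> measure (H.\<mu> (delta (x 0))) {0<..E}"
    proof (rule H.measure_path[OF n inj _ _ _ E])
      fix i assume "Suc i < n"
      then show "(x i, x (Suc i)) \<in> adj (open_subgraph G \<omega>)"
        using x(2)[of i] \<omega> by (auto simp: adj_open_subgraph A_def S_def)
    next
      fix i w assume i: "i < n" and w: "(x i, w) \<in> adj (open_subgraph G \<omega>)"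
      have "{x i, w} \<in> edges G" "\<omega> {x i, w}" using w by (auto simp: adj_def open_subgraph_def)
      then have "{x i, w} \<in> S" using \<omega> i by (auto simp: A_def T_def)
      then obtain j where j: "Suc j < n" "{x i, w} = {x j, x (Suc j)}" by (auto simp: S_def)
      then consider "x i = x j" "w = x (Suc j)" | "x i = x (Suc j)" "w = x j"
        by (auto simp: doubleton_eq_iff)
      then show "\<exists>j<n. w = x j \<and> (j = Suc i \<or> i = Suc j)"
      proof cases
        case 1
        then have "i = j" using inj i j by (auto simp: inj_on_def)
        then show ?thesis using 1 j by auto
      next
        case 2
        then have "i = Suc j" using inj i j by (auto simp: inj_on_def)
        then show ?thesis using 2 j by (intro exI[of _ j]) auto
      qed
    qed (use xV in auto)
    then show ?thesis by (simp add: spectral_def x(1))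
  qed
  then show ?thesis using that[of A] cyl prob by blast
qed

lemma interval_spectral': "v \<in> verts G \<Longrightarrow> interval_measure_on 0 (2 * real D) (spectral D G v)"
  unfolding spectral_def by (rule interval_\<mu>[OF delta_l2])

lemma interval_spectral:
  "v \<in> verts G \<Longrightarrow> interval_measure_on 0 (2 * real D) (spectral D (open_subgraph G \<omega>) v)"
  using bounded_graph.interval_spectral'[OF bounded_graph_open_subgraph] by simp

lemma prob_space_spectral':
  assumes v: "v \<in> verts G" shows "prob_space (spectral D G v)"
proof -
  interpret finite_measure "spectral D G v" using interval_spectral'[OF v] by (simp add: interval_measure_on_def)
  have "(l2_norm (verts G) (delta v))\<^sup>2 = 1"
    using l2_inner_self[OF delta_l2[OF v]] l2_inner_delta[OF v, of "delta v"]
    by (simp add: delta_apply del: of_real_power)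
  then have "measure (spectral D G v) UNIV = 1"
    using measure_\<mu>_UNIV[OF delta_l2[OF v]] by (simp add: spectral_def)
  moreover have "space (spectral D G v) = UNIV"
    using interval_spectral'[OF v] sets_eq_imp_space_eq[of "spectral D G v" borel] by (simp add: interval_measure_on_def)
  ultimately show ?thesis by (intro prob_spaceI) (simp add: emeasure_eq_measure)
qed

lemma prob_space_spectral: "v \<in> verts G \<Longrightarrow> prob_space (spectral D (open_subgraph G \<omega>) v)"
  using bounded_graph.prob_space_spectral'[OF bounded_graph_open_subgraph] by simp

lemma spectral_moment':
  assumes "v \<in> verts G"
  shows "(\<integral>x. x ^ k \<partial>spectral D G v) = Re ((laplacian G ^^ k) (delta v) v)"
  using is_moment_measure_\<mu>[OF delta_l2[OF assms]] assms
  by (simp add: spectral_def is_moment_measure_def l2_inner_delta)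

lemma spectral_moment:
  assumes "v \<in> verts G"
  shows "(\<integral>x. x ^ k \<partial>spectral D (open_subgraph G \<omega>) v) = Re ((laplacian (open_subgraph G \<omega>) ^^ k) (delta v) v)"
  using assms by (simp add: bounded_graph.spectral_moment'[OF bounded_graph_open_subgraph])

lemma integral_spectral_bound:
  fixes f :: "real \<Rightarrow> real"
  assumes v: "v \<in> verts G" and f: "f \<in> borel_measurable borel" "\<And>x. x \<in> {0..2 * real D} \<Longrightarrow> \<bar>f x\<bar> \<le> K"
  shows "\<bar>\<integral>x. f x \<partial>spectral D (open_subgraph G \<omega>) v\<bar> \<le> K"
proof -
  let ?M = "spectral D (open_subgraph G \<omega>) v"
  interpret prob_space ?M by (rule prob_space_spectral[OF v])
  note I = interval_spectral[OF v, of \<omega>]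
  have "AE x in ?M. x \<in> {0..2 * real D}" using I by (simp add: interval_measure_on_def)
  then have ae: "AE x in ?M. \<bar>f x\<bar> \<le> K" by eventually_elim (rule f(2))
  have int: "integrable ?M f" by (rule interval_measure_on_integrable[OF I bounded_borelI[OF f]])
  have "\<bar>\<integral>x. f x \<partial>?M\<bar> \<le> (\<integral>x. \<bar>f x\<bar> \<partial>?M)" by (rule integral_abs_bound)
  also have "\<dots> \<le> (\<integral>x. K \<partial>?M)" using ae int by (intro integral_mono_AE) auto
  finally show ?thesis by (simp add: prob_space)
qed

context
  fixes p :: real
  assumes p01: "0 \<le> p" "p \<le> 1"
begin

text \<open>One more application of the Laplacian is a finite sum over the neighbours in
  \<open>G\<close>, each term being switched on or off by a single edge.\<close>

lemma measurable_laplacian_pow: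
  "(\<lambda>\<omega>. (laplacian (open_subgraph G \<omega>) ^^ k) (delta v) u) \<in> borel_measurable (percolation p G)"
proof (induction k arbitrary: u)
  case 0 show ?case by simp
next
  case (Suc k)
  have e: "(laplacian (open_subgraph G \<omega>) ^^ Suc k) (delta v) u =
      (if u \<in> verts G then \<Sum>w\<in>neighbours G u. if \<omega> {u, w} then
        (laplacian (open_subgraph G \<omega>) ^^ k) (delta v) u - (laplacian (open_subgraph G \<omega>) ^^ k) (delta v) w else 0 else 0)" for \<omega>
    using finite_neighbours[of u]
    by (auto simp: laplacian_def neighbours_open_subgraph sum.inter_filter)
  have "(\<lambda>\<omega>. if \<omega> {u, w} then
        (laplacian (open_subgraph G \<omega>) ^^ k) (delta v) u - (laplacian (open_subgraph G \<omega>) ^^ k) (delta v) w else 0)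
      \<in> borel_measurable (percolation p G)" if "w \<in> neighbours G u" for w
  proof -
    have [measurable]: "Measurable.pred (percolation p G) (\<lambda>\<omega>. \<omega> {u, w})"
      using that by (intro measurable_coordinate[OF p01]) (auto simp: neighbours_def)
    show ?thesis using Suc by measurable
  qed
  then show ?case unfolding e by (cases "u \<in> verts G") (auto intro!: borel_measurable_sum)
qed

lemma measurable_Re_laplacian_pow:
  "(\<lambda>\<omega>. Re ((laplacian (open_subgraph G \<omega>) ^^ k) (delta v) u)) \<in> borel_measurable (percolation p G)"
  by (rule measurable_compose[OF measurable_laplacian_pow borel_measurable_continuous_onI[OF continuous_on_Re[OF continuous_on_id]]])

lemma measurable_spectral:
  assumes v: "v \<in> verts G" and f: "bounded_borel 0 (2 * real D) f"
  shows "(\<lambda>\<omega>. \<integral>x. f x \<partial>spectral D (open_subgraph G \<omega>) v) \<in> borel_measurable (percolation p G)"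
proof -
  interpret mc: monotone_class 0 "2 * real D"
    "\<lambda>f. (\<lambda>\<omega>. \<integral>x. f x \<partial>spectral D (open_subgraph G \<omega>) v) \<in> borel_measurable (percolation p G)"
  proof
    fix f g :: "real \<Rightarrow> real" and c d
    assume fg: "bounded_borel 0 (2 * real D) f" "bounded_borel 0 (2 * real D) g"
      and m: "(\<lambda>\<omega>. \<integral>x. f x \<partial>spectral D (open_subgraph G \<omega>) v) \<in> borel_measurable (percolation p G)"
        "(\<lambda>\<omega>. \<integral>x. g x \<partial>spectral D (open_subgraph G \<omega>) v) \<in> borel_measurable (percolation p G)"
    have "(\<integral>x. c * f x + d * g x \<partial>spectral D (open_subgraph G \<omega>) v) =
        c * (\<integral>x. f x \<partial>spectral D (open_subgraph G \<omega>) v) + d * (\<integral>x. g x \<partial>spectral D (open_subgraph G \<omega>) v)" for \<omega>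
      using interval_measure_on_integrable[OF interval_spectral[OF v]] fg by simp
    then show "(\<lambda>\<omega>. \<integral>x. c * f x + d * g x \<partial>spectral D (open_subgraph G \<omega>) v) \<in> borel_measurable (percolation p G)"
      using m by simp
  next
    fix f g K
    assume *: "\<And>n. bounded_borel 0 (2 * real D) (f n)"
      "\<And>n::nat. (\<lambda>\<omega>. \<integral>x. f n x \<partial>spectral D (open_subgraph G \<omega>) v) \<in> borel_measurable (percolation p G)"
      "bounded_borel 0 (2 * real D) g" "\<And>n x. x \<in> {0..2 * real D} \<Longrightarrow> \<bar>f n x\<bar> \<le> K"
      "\<And>x. x \<in> {0..2 * real D} \<Longrightarrow> (\<lambda>n. f n x) \<longlonglongrightarrow> g x"
    show "(\<lambda>\<omega>. \<integral>x. g x \<partial>spectral D (open_subgraph G \<omega>) v) \<in> borel_measurable (percolation p G)"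
      by (rule borel_measurable_LIMSEQ_real[OF interval_measure_on_limit[OF interval_spectral[OF v] *(1,3,4,5)] *(2)])
  qed
  show ?thesis
    by (rule mc.from_monomials[OF _ f]) (simp add: spectral_moment[OF v] measurable_Re_laplacian_pow)
qed

lemma integrable_spectral:
  assumes v: "v \<in> verts G" and f: "bounded_borel 0 (2 * real D) f"
  shows "integrable (percolation p G) (\<lambda>\<omega>. \<integral>x. f x \<partial>spectral D (open_subgraph G \<omega>) v)"
proof -
  interpret prob_space "percolation p G" by (rule prob_space_percolation[OF p01])
  obtain K where K: "\<And>x. x \<in> {0..2 * real D} \<Longrightarrow> \<bar>f x\<bar> \<le> K" using bounded_borelE[OF f] by metis
  show ?thesis
    using integral_spectral_bound[OF v bounded_borel_measurable[OF f] K]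
    by (intro integrable_const_bound[of _ K] measurable_spectral[OF v f]) auto
qed

lemma mean_spectral_bound:
  assumes v: "v \<in> verts G" and f: "f \<in> borel_measurable borel" "\<And>x. x \<in> {0..2 * real D} \<Longrightarrow> \<bar>f x\<bar> \<le> K"
  shows "\<bar>mean_spectral p D f G v\<bar> \<le> K"
proof -
  interpret prob_space "percolation p G" by (rule prob_space_percolation[OF p01])
  let ?g = "\<lambda>\<omega>. \<integral>x. f x \<partial>spectral D (open_subgraph G \<omega>) v"
  have int: "integrable (percolation p G) ?g" by (rule integrable_spectral[OF v bounded_borelI[OF f]])
  have "\<bar>expectation ?g\<bar> \<le> expectation (\<lambda>\<omega>. \<bar>?g \<omega>\<bar>)" by (rule integral_abs_bound)
  also have "\<dots> \<le> expectation (\<lambda>\<omega>. K)"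
    using int integral_spectral_bound[OF v f] by (intro integral_mono) auto
  finally show ?thesis by (simp add: mean_spectral_def prob_space)
qed

lemma mean_spectral_linear:
  assumes v: "v \<in> verts G" and "bounded_borel 0 (2 * real D) f" "bounded_borel 0 (2 * real D) g"
  shows "mean_spectral p D (\<lambda>x. c * f x + d * g x) G v = c * mean_spectral p D f G v + d * mean_spectral p D g G v"
proof -
  have "(\<integral>x. c * f x + d * g x \<partial>spectral D (open_subgraph G \<omega>) v) =
      c * (\<integral>x. f x \<partial>spectral D (open_subgraph G \<omega>) v) + d * (\<integral>x. g x \<partial>spectral D (open_subgraph G \<omega>) v)" for \<omega>
    using interval_measure_on_integrable[OF interval_spectral[OF v]] assms by simp
  then show ?thesis using integrable_spectral[OF v] assms by (simp add: mean_spectral_def)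
qed

lemma mean_spectral_limit:
  assumes v: "v \<in> verts G" and *: "\<And>n. bounded_borel 0 (2 * real D) (f n)" "bounded_borel 0 (2 * real D) g"
    "\<And>n x. x \<in> {0..2 * real D} \<Longrightarrow> \<bar>f n x\<bar> \<le> K" "\<And>x. x \<in> {0..2 * real D} \<Longrightarrow> (\<lambda>n. f n x) \<longlonglongrightarrow> g x"
  shows "(\<lambda>n. mean_spectral p D (f n) G v) \<longlonglongrightarrow> mean_spectral p D g G v"
proof -
  interpret prob_space "percolation p G" by (rule prob_space_percolation[OF p01])
  show ?thesis unfolding mean_spectral_def
  proof (rule integral_dominated_convergence[where w = "\<lambda>_. K"])
    show "AE \<omega> in percolation p G. (\<lambda>n. \<integral>x. f n x \<partial>spectral D (open_subgraph G \<omega>) v) \<longlonglongrightarrow>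
        (\<integral>x. g x \<partial>spectral D (open_subgraph G \<omega>) v)"
      using interval_measure_on_limit[OF interval_spectral[OF v] *] by simp
    show "AE \<omega> in percolation p G. norm (\<integral>x. f n x \<partial>spectral D (open_subgraph G \<omega>) v) \<le> K" for n
      using integral_spectral_bound[OF v bounded_borel_measurable[OF *(1)] *(3)] by simp
  qed (use measurable_spectral[OF v] * in auto)
qed

lemma mean_spectral_power:
  assumes v: "v \<in> verts G"
  shows "mean_spectral p D (\<lambda>x. x ^ k) G v =
    (\<integral>\<omega>. Re ((laplacian (open_subgraph G \<omega>) ^^ k) (delta v) v) \<partial>percolation p G)"
  by (simp add: mean_spectral_def spectral_moment[OF v])

end

end

subsection \<open>Translations and locality\<close>

text \<open>Selecting and renaming coordinates along an injection maps a product of identical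
  factors to such a product. The injection is a bijection for translations and the inclusion of
  edges for induced subgraphs.\<close>

lemma percolation_reindex:
  assumes p: "0 \<le> p" "p \<le> 1" and f: "inj_on f (edges H)" "f \<in> edges H \<rightarrow> edges G"
    and g: "g \<in> borel_measurable (percolation p H)"
  shows "(\<integral>\<omega>. g \<omega> \<partial>percolation p H) = (\<integral>\<omega>. g (\<lambda>e\<in>edges H. \<omega> (f e)) \<partial>percolation p G :: real)"
proof -
  have "distr (percolation p G) (percolation p H) (\<lambda>\<omega>. \<lambda>e\<in>edges H. \<omega> (f e)) = percolation p H"
    unfolding percolation_def
    by (rule distr_PiM_reindex[of _ "\<lambda>_. measure_pmf (bernoulli_pmf p)", OF _ f]) (rule prob_space_measure_pmf)
  moreover have "(\<lambda>\<omega>. \<lambda>e\<in>edges H. \<omega> (f e)) \<in> measurable (percolation p G) (percolation p H)"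
    unfolding percolation_def using f
    by (intro measurable_restrict measurable_component_singleton) auto
  ultimately show ?thesis using integral_distr[OF _ g] by metis
qed

lemma verts_translate: "verts (translate z G) = (+) z ` verts G"
  by (simp add: translate_def)

lemma neighbours_translate: "neighbours (translate z G) (z + u) = (+) z ` neighbours G u"
proof -
  have "{z + u, w} \<in> edges (translate z G) \<longleftrightarrow> {u, w - z} \<in> edges G" for w
  proof -
    have e: "{z + u, w} = (+) z ` {u, w - z}" by simp
    have "inj ((`) ((+) z))" by (auto simp: inj_def inj_image_eq_iff)
    then show ?thesis unfolding e translate_def snd_conv by (rule inj_image_mem_iff)
  qed
  moreover have "w \<in> (+) z ` A \<longleftrightarrow> w - z \<in> A" for w A
    using image_eqI[of w "(+) z" "w - z" A] by auto
  ultimately show ?thesis by (auto simp: neighbours_def)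
qed

lemma laplacian_pow_translate:
  "(laplacian (translate z G) ^^ k) (delta (z + v)) (z + u) = (laplacian G ^^ k) (delta v) u"
proof (induction k arbitrary: u)
  case 0 show ?case by (simp add: delta_apply)
next
  case (Suc k)
  define \<phi> \<phi>' where "\<phi> = (laplacian G ^^ k) (delta v)" and "\<phi>' = (laplacian (translate z G) ^^ k) (delta (z + v))"
  have "\<phi>' (z + w) = \<phi> w" for w using Suc by (simp add: \<phi>_def \<phi>'_def)
  moreover have "z + u \<in> verts (translate z G) \<longleftrightarrow> u \<in> verts G" by (auto simp: verts_translate)
  ultimately have "laplacian (translate z G) \<phi>' (z + u) = laplacian G \<phi> u"
    by (simp add: laplacian_def neighbours_translate sum.reindex)
  then show ?case by (simp add: \<phi>_def \<phi>'_def)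
qed

lemma open_subgraph_translate:
  "open_subgraph (translate z G) (\<lambda>e\<in>edges (translate z G). \<omega> ((+) (- z) ` e)) = translate z (open_subgraph G \<omega>)"
  by (auto simp: open_subgraph_def translate_def image_image)

lemma open_subgraph_induced:
  "open_subgraph (induced G B) (\<lambda>e\<in>edges (induced G B). \<omega> e) = induced (open_subgraph G \<omega>) B"
  by (auto simp: open_subgraph_def induced_def)

text \<open>Finite speed of propagation: each application of the Laplacian looks one edge further,
  and edges are shorter than \<open>L\<close>. The budget \<open>i + j \<le> Suc k\<close> is what
  the induction preserves, since one power fewer is evaluated one step further away from
  \<open>v\<close>.\<close>

lemma laplacian_pow_local:
  fixes G :: "'a::euclidean_space graph"
  assumes L: "0 < L" "\<And>a b. (a, b) \<in> adj G \<Longrightarrow> dist a b < L" and \<rho>: "real (Suc k) * L \<le> \<rho>"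
  shows "i + j \<le> Suc k \<Longrightarrow> dist v u < real i * L \<Longrightarrow>
    (laplacian (induced G (ball v \<rho>)) ^^ j) (delta v) u = (laplacian G ^^ j) (delta v) u"
proof (induction j arbitrary: i u)
  case (Suc j)
  define \<phi> \<phi>' where "\<phi> = (laplacian G ^^ j) (delta v)"
    and "\<phi>' = (laplacian (induced G (ball v \<rho>)) ^^ j) (delta v)"
  have in_ball: "w \<in> ball v \<rho>" if "dist v w < real m * L" "m \<le> Suc k" for w m
  proof -
    have "real m * L \<le> real (Suc k) * L" using that L by (intro mult_right_mono) auto
    then show ?thesis using that \<rho> by simp
  qed
  have u: "u \<in> ball v \<rho>" using in_ball[OF Suc.prems(2)] Suc.prems(1) by simp
  have nb: "dist v w < real (Suc i) * L" if "w \<in> neighbours G u" for w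
    using dist_triangle[of v w u] L(2)[of u w] that Suc.prems(2) by (simp add: neighbours_adj algebra_simps)
  have "neighbours (induced G (ball v \<rho>)) u = neighbours G u"
    using u in_ball[OF nb] Suc.prems(1) by (auto simp: neighbours_def induced_def)
  moreover have "\<phi>' w = \<phi> w" if "w \<in> neighbours G u" for w
    using Suc.IH[OF _ nb[OF that]] Suc.prems(1) by (simp add: \<phi>_def \<phi>'_def)
  moreover have "\<phi>' u = \<phi> u"
    using Suc.IH[of i u] Suc.prems by (simp add: \<phi>_def \<phi>'_def)
  moreover have "u \<in> verts (induced G (ball v \<rho>)) \<longleftrightarrow> u \<in> verts G" using u by (simp add: induced_def)
  ultimately have "laplacian (induced G (ball v \<rho>)) \<phi>' u = laplacian G \<phi> u" by (simp add: laplacian_def)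
  then show ?case by (simp add: \<phi>_def \<phi>'_def)
qed simp

lemma bounded_graph_translate:
  assumes "bounded_graph G D" shows "bounded_graph (translate z G) D"
proof -
  interpret bounded_graph G D by fact
  show ?thesis
  proof
    show "simple_graph (translate z G)"
      unfolding simple_graph_def
    proof (intro conjI subsetI)
      show "countable (verts (translate z G))" using simple by (simp add: simple_graph_def verts_translate)
      fix e assume "e \<in> edges (translate z G)"
      then obtain e' where e': "e' \<in> edges G" "e = (+) z ` e'" by (auto simp: translate_def)
      then obtain a b where "e' = {a, b}" "a \<in> verts G" "b \<in> verts G" "a \<noteq> b"
        using simple by (auto simp: simple_graph_def)
      then have "e = {z + a, z + b}" "z + a \<in> verts (translate z G)" "z + b \<in> verts (translate z G)" "z + a \<noteq> z + b"
        using e' by (auto simp: verts_translate)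
      then show "e \<in> {{u, v} |u v. u \<in> verts (translate z G) \<and> v \<in> verts (translate z G) \<and> u \<noteq> v}" by blast
    qed
    fix v assume "v \<in> verts (translate z G)"
    then obtain u where u: "v = z + u" "u \<in> verts G" by (auto simp: verts_translate)
    then show "finite (neighbours (translate z G) v)" "card (neighbours (translate z G) v) \<le> D"
      using finite_neighbours degree_le by (auto simp: neighbours_translate card_image)
  qed (rule D_pos)
qed

lemma mean_spectral_translate:
  assumes G: "bounded_graph G D" and p: "0 \<le> p" "p \<le> 1" and v: "v \<in> verts G"
  shows "mean_spectral p D (\<lambda>x. x ^ k) (translate z G) (z + v) = mean_spectral p D (\<lambda>x. x ^ k) G v"
proof -
  interpret bounded_graph G D by fact
  interpret T: bounded_graph "translate z G" D using G by (rule bounded_graph_translate)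
  have zv: "z + v \<in> verts (translate z G)" using v by (simp add: verts_translate)
  have "mean_spectral p D (\<lambda>x. x ^ k) (translate z G) (z + v) =
      (\<integral>\<omega>. Re ((laplacian (open_subgraph (translate z G) (\<lambda>e\<in>edges (translate z G). \<omega> ((+) (- z) ` e))) ^^ k) (delta (z + v)) (z + v)) \<partial>percolation p G)"
    unfolding T.mean_spectral_power[OF p zv]
  proof (rule percolation_reindex[OF p])
    show "inj_on ((`) ((+) (- z))) (edges (translate z G))" by (auto simp: inj_on_def inj_image_eq_iff)
    show "(`) ((+) (- z)) \<in> edges (translate z G) \<rightarrow> edges G" by (auto simp: translate_def image_image)
    show "(\<lambda>\<omega>. Re ((laplacian (open_subgraph (translate z G) \<omega>) ^^ k) (delta (z + v)) (z + v)))
        \<in> borel_measurable (percolation p (translate z G))"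
      by (rule T.measurable_Re_laplacian_pow[OF p])
  qed
  also have "\<dots> = mean_spectral p D (\<lambda>x. x ^ k) G v"
    unfolding open_subgraph_translate laplacian_pow_translate mean_spectral_power[OF p v] ..
  finally show ?thesis .
qed

lemma mean_spectral_local:
  fixes G :: "'a::euclidean_space graph"
  assumes G: "bounded_graph G D" and p: "0 \<le> p" "p \<le> 1" and v: "v \<in> verts G"
    and L: "0 < L" "\<And>a b. (a, b) \<in> adj G \<Longrightarrow> dist a b < L" and \<rho>: "real (Suc k) * L \<le> \<rho>"
  shows "mean_spectral p D (\<lambda>x. x ^ k) (induced G (ball v \<rho>)) v = mean_spectral p D (\<lambda>x. x ^ k) G v"
proof -
  interpret bounded_graph G D by fact
  let ?H = "induced G (ball v \<rho>)"
  interpret H: bounded_graph ?H D by (rule bounded_graph_induced)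
  have "0 < real (Suc k) * L" using L by simp
  then have vH: "v \<in> verts ?H" using v \<rho> by (simp add: induced_def)
  have "mean_spectral p D (\<lambda>x. x ^ k) ?H v =
      (\<integral>\<omega>. Re ((laplacian (open_subgraph ?H (\<lambda>e\<in>edges ?H. \<omega> (id e))) ^^ k) (delta v) v) \<partial>percolation p G)"
    unfolding H.mean_spectral_power[OF p vH]
  proof (rule percolation_reindex[OF p])
    show "id \<in> edges ?H \<rightarrow> edges G" by (auto simp: induced_def)
    show "(\<lambda>\<omega>. Re ((laplacian (open_subgraph ?H \<omega>) ^^ k) (delta v) v)) \<in> borel_measurable (percolation p ?H)"
      by (rule H.measurable_Re_laplacian_pow[OF p])
  qed simp
  also have "\<dots> = (\<integral>\<omega>. Re ((laplacian (induced (open_subgraph G \<omega>) (ball v \<rho>)) ^^ k) (delta v) v) \<partial>percolation p G)"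
    by (simp add: open_subgraph_induced)
  also have "\<dots> = mean_spectral p D (\<lambda>x. x ^ k) G v"
  proof -
    have "(laplacian (induced (open_subgraph G \<omega>) (ball v \<rho>)) ^^ k) (delta v) v = (laplacian (open_subgraph G \<omega>) ^^ k) (delta v) v" for \<omega>
      \<comment> \<open>Here \<open>i = 1\<close>, not 0, because the distance bound is strict; this
        is why the radius has \<open>Suc k\<close> in place of \<open>k\<close>.\<close>
      by (rule laplacian_pow_local[OF L(1) _ \<rho>, of _ 1]) (use L in \<open>auto simp: adj_open_subgraph\<close>)
    then show ?thesis by (simp add: mean_spectral_power[OF p v])
  qed
  finally show ?thesis .
qed

subsection \<open>Graphs in the hull\<close>

text \<open>Agreement at some \<open>\<epsilon> < 1 / (s + 1)\<close> covers the ball of radius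
  \<open>s + 1\<close>. The small translation of \<open>G\<close> uses up at most one unit of this
  radius and is absorbed into \<open>t\<close>.\<close>

lemma graph_hull_local:
  assumes "G \<in> graph_hull G\<^sub>0" "s > 0"
  obtains t where "induced G (ball 0 s) = induced (translate t G\<^sub>0) (ball 0 s)"
proof -
  interpret Metric_space locally_finite_graphs graph_dist by (rule Metric_space_graph_dist)
  define c where "c = min (2 powr (- 1/2)) (1 / (s + 1))"
  have "c > 0" using assms(2) by (simp add: c_def)
  then obtain t where "graph_dist G (translate t G\<^sub>0) < c"
    using assms(1) unfolding graph_hull_def graph_topology_def metric_closure_of by auto
  then obtain \<epsilon> where \<epsilon>: "\<epsilon> \<in> agreement_radii G (translate t G\<^sub>0)" "\<epsilon> < c"
    by (rule graph_dist_less_obtain) (simp_all add: c_def)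
  then obtain x y where xy: "\<epsilon> > 0" "norm x < \<epsilon>" "norm y < \<epsilon>"
      "induced (translate x G) (ball 0 (1 / \<epsilon>)) = induced (translate y (translate t G\<^sub>0)) (ball 0 (1 / \<epsilon>))"
    using agreement_radiiE by metis
  have "\<epsilon> < 1 / (s + 1)" using \<epsilon>(2) by (simp add: c_def)
  then have "s + 1 < 1 / \<epsilon>" using xy(1) assms(2) by (simp add: field_simps)
  moreover have "1 / (s + 1) < 1" using assms(2) by simp
  then have "norm x < 1" using \<open>\<epsilon> < 1 / (s + 1)\<close> xy(2) by linarith
  ultimately have "(+) (- (- x)) ` ball 0 s \<subseteq> ball 0 (1 / \<epsilon>)"
    using norm_triangle_ineq[of x] by (force intro: le_less_trans)
  from agreement_shift[OF xy(4) this]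
  have "induced G (ball 0 s) = induced (translate (- x + (y + t)) G\<^sub>0) (ball 0 s)"
    by (simp add: translate_translate)
  then show ?thesis by (rule that)
qed

lemma graph_hull_locally_finite: "G \<in> graph_hull G\<^sub>0 \<Longrightarrow> G \<in> locally_finite_graphs"
proof -
  interpret Metric_space locally_finite_graphs graph_dist by (rule Metric_space_graph_dist)
  show "G \<in> graph_hull G\<^sub>0 \<Longrightarrow> G \<in> locally_finite_graphs"
    unfolding graph_hull_def graph_topology_def metric_closure_of by auto
qed

lemma adj_translate: "(a, b) \<in> adj (translate t G) \<longleftrightarrow> (a - t, b - t) \<in> adj G"
  using neighbours_translate[of t G "a - t"] unfolding neighbours_adj[symmetric] by (auto simp: image_iff) (metis add.commute diff_add_cancel)

locale hull_model =
  fixes G\<^sub>0 :: "'a::euclidean_space graph" and r L :: real and D :: nat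
  assumes bounded: "bounded_graph G\<^sub>0 D"
    and L: "L > 0" "\<And>a b. (a, b) \<in> adj G\<^sub>0 \<Longrightarrow> dist a b < L"
    and discrete: "uniformly_discrete r (verts G\<^sub>0)"
begin

lemma hull_verts: "G \<in> graph_hull G\<^sub>0 \<Longrightarrow> s > 0 \<Longrightarrow>
    \<exists>t. (\<forall>v\<in>ball 0 s. v \<in> verts G \<longleftrightarrow> v - t \<in> verts G\<^sub>0) \<and>
      (\<forall>a\<in>ball 0 s. \<forall>b\<in>ball 0 s. (a, b) \<in> adj G \<longleftrightarrow> (a - t, b - t) \<in> adj G\<^sub>0)"
proof -
  assume "G \<in> graph_hull G\<^sub>0" "s > 0"
  then obtain t where t: "induced G (ball 0 s) = induced (translate t G\<^sub>0) (ball 0 s)" by (rule graph_hull_local)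
  have "v \<in> verts G \<longleftrightarrow> v - t \<in> verts G\<^sub>0" if "v \<in> ball 0 s" for v
  proof -
    have "verts G \<inter> ball 0 s = verts (translate t G\<^sub>0) \<inter> ball 0 s"
      using arg_cong[OF t, of verts] by (simp add: induced_def)
    then have "v \<in> verts G \<longleftrightarrow> v \<in> verts (translate t G\<^sub>0)" using that by blast
    then show ?thesis by (auto simp: verts_translate image_iff intro: bexI[of _ "v - t"])
  qed
  moreover have "(a, b) \<in> adj G \<longleftrightarrow> (a - t, b - t) \<in> adj G\<^sub>0" if "a \<in> ball 0 s" "b \<in> ball 0 s" for a b
  proof -
    have "{a, b} \<in> edges (induced G (ball 0 s)) \<longleftrightarrow> {a, b} \<in> edges (induced (translate t G\<^sub>0) (ball 0 s))"
      by (simp only: t)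
    then have "(a, b) \<in> adj G \<longleftrightarrow> (a, b) \<in> adj (translate t G\<^sub>0)"
      using that by (simp add: induced_def adj_def)
    then show ?thesis by (simp add: adj_translate)
  qed
  ultimately show ?thesis by blast
qed

lemma hull_short:
  assumes G: "G \<in> graph_hull G\<^sub>0" and ab: "(a, b) \<in> adj G" shows "dist a b < L"
proof -
  define s where "s = norm a + norm b + 1"
  have "a \<in> ball 0 s" "b \<in> ball 0 s" "s > 0"
    by (auto simp: s_def add_nonneg_pos)
  then obtain t where "(a - t, b - t) \<in> adj G\<^sub>0" using hull_verts[OF G, of s] ab by blast
  then show ?thesis using L(2) by (fastforce simp: dist_norm)
qed

lemma hull_bounded:
  assumes G: "G \<in> graph_hull G\<^sub>0" shows "bounded_graph G D"
proof
  have lf: "simple_graph G" "finite (verts G \<inter> ball 0 s)" for s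
    using graph_hull_locally_finite[OF G] by (auto simp: locally_finite_graphs_def)
  show "simple_graph G" by (rule lf)
  show "0 < D" using bounded by (rule bounded_graph.D_pos)
  fix v assume v: "v \<in> verts G"
  \<comment> \<open>This ball contains all neighbours of \<open>v\<close>, so the degree can be
    compared with that in a translate of \<open>G\<^sub>0\<close>.\<close>
  define s where "s = norm v + L"
  have s: "s > 0" "v \<in> ball 0 s" using L(1) by (auto simp: s_def add_nonneg_pos)
  have nb: "w \<in> verts G \<inter> ball 0 s" if "w \<in> neighbours G v" for w
  proof -
    have "(v, w) \<in> adj G" using that by (simp add: neighbours_adj)
    moreover from this have "w \<in> verts G" using lf(1) by (auto simp: adj_def simple_graph_def doubleton_eq_iff)
    ultimately show ?thesis
      using hull_short[OF G, of v w] norm_triangle_ineq[of v "w - v"] by (auto simp: s_def dist_norm norm_minus_commute)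
  qed
  then have "neighbours G v \<subseteq> verts G \<inter> ball 0 s" by blast
  then show "finite (neighbours G v)" by (rule finite_subset[OF _ lf(2)])
  obtain t where t: "\<forall>v\<in>ball 0 s. v \<in> verts G \<longleftrightarrow> v - t \<in> verts G\<^sub>0"
      "\<forall>a\<in>ball 0 s. \<forall>b\<in>ball 0 s. (a, b) \<in> adj G \<longleftrightarrow> (a - t, b - t) \<in> adj G\<^sub>0"
    using hull_verts[OF G s(1)] by blast
  interpret G0: bounded_graph G\<^sub>0 D by (rule bounded)
  have v0: "v - t \<in> verts G\<^sub>0" using t(1) s(2) v by blast
  have "(\<lambda>w. w - t) ` neighbours G v \<subseteq> neighbours G\<^sub>0 (v - t)"
    using t(2) s(2) nb by (fastforce simp: neighbours_adj)
  then have "card ((\<lambda>w. w - t) ` neighbours G v) \<le> card (neighbours G\<^sub>0 (v - t))"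
    by (rule card_mono[OF G0.finite_neighbours[OF v0]])
  then show "card (neighbours G v) \<le> D"
    using G0.degree_le[OF v0] by (simp add: card_image inj_on_def)
qed

lemma hull_discrete:
  assumes G: "G \<in> graph_hull G\<^sub>0" and uv: "u \<in> verts G" "v \<in> verts G" "norm u < r" "norm v < r"
  shows "u = v"
proof -
  have "r > 0" using discrete by (simp add: uniformly_discrete_def)
  then obtain t where t: "\<forall>v\<in>ball 0 r. v \<in> verts G \<longleftrightarrow> v - t \<in> verts G\<^sub>0" using hull_verts[OF G] by blast
  have "u - t \<in> verts G\<^sub>0 \<inter> ball (- t) r" "v - t \<in> verts G\<^sub>0 \<inter> ball (- t) r"
    using t uv by (auto simp: dist_norm norm_minus_commute)
  then have "u - t = v - t" using discrete unfolding uniformly_discrete_def by blast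
  then show ?thesis by simp
qed

end

section \<open>The integrated density of states as an integral over the hull\<close>

locale percolation_model = hull_model G\<^sub>0 r L D for G\<^sub>0 :: "'a::euclidean_space graph" and r L D +
  fixes \<mu> :: "'a graph measure" and \<psi> :: "'a \<Rightarrow> real" and p :: real
  assumes prob: "prob_space \<mu>" and space_\<mu>: "space \<mu> = graph_hull G\<^sub>0"
    and sets_\<mu>: "sets \<mu> = sets (hull_borel G\<^sub>0)"
    and mollifier: "mollifier r \<psi>" and p: "0 \<le> p" "p \<le> 1"
begin

lemma \<psi>: "continuous_on UNIV \<psi>" "0 \<le> \<psi> x" "r \<le> norm x \<Longrightarrow> \<psi> x = 0"
  using mollifier by (auto simp: mollifier_def)

lemma \<psi>_bounded: obtains K where "K > 0" "\<And>x. \<psi> x \<le> K"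
proof -
  have "compact (\<psi> ` cball 0 r)" by (intro compact_continuous_image continuous_on_subset[OF \<psi>(1)]) auto
  then have "bounded (\<psi> ` cball 0 r)" by (rule compact_imp_bounded)
  then obtain K where "\<forall>y\<in>\<psi> ` cball 0 r. norm y \<le> K" by (auto simp: bounded_iff)
  then have K: "norm (\<psi> x) \<le> K" if "x \<in> cball 0 r" for x using that by blast
  have "\<psi> x \<le> \<bar>K\<bar> + 1" for x
    using K[of x] \<psi>(3)[of x] by (cases "norm x \<le> r") auto
  then show ?thesis using that[of "\<bar>K\<bar> + 1"] by auto
qed

lemma \<psi>_uniform:
  assumes "\<eta> > 0"
  obtains \<delta> where "\<delta> > 0" "\<And>x y. dist x y < \<delta> \<Longrightarrow> \<bar>\<psi> x - \<psi> y\<bar> < \<eta>"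
proof -
  have "uniformly_continuous_on (cball 0 (r + 1)) \<psi>"
    by (intro compact_uniformly_continuous continuous_on_subset[OF \<psi>(1)]) auto
  then obtain d where d: "d > 0" "\<And>x y. x \<in> cball 0 (r + 1) \<Longrightarrow> y \<in> cball 0 (r + 1) \<Longrightarrow> dist y x < d \<Longrightarrow> dist (\<psi> y) (\<psi> x) < \<eta>"
    using assms unfolding uniformly_continuous_on_def by metis
  have "\<bar>\<psi> x - \<psi> y\<bar> < \<eta>" if xy: "dist x y < min d 1" for x y
  proof (cases "norm x < r \<or> norm y < r")
    case True
    have "norm x \<le> norm y + dist x y" "norm y \<le> norm x + dist x y"
      using norm_triangle_ineq2[of x y] norm_triangle_ineq2[of y x] by (auto simp: dist_norm norm_minus_commute)
    then have "x \<in> cball 0 (r + 1)" "y \<in> cball 0 (r + 1)" using True xy by auto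
    then show ?thesis using d(2)[of y x] xy by (simp add: dist_real_def)
  next
    case False
    then show ?thesis using \<psi>(3)[of x] \<psi>(3)[of y] assms by simp
  qed
  then show ?thesis using that[of "min d 1"] d(1) by simp
qed

text \<open>Uniform discreteness leaves at most one vertex in the support of \<open>\<psi>\<close>.
  As a case rule for all subsets and weights at once, it settles summability and the interchange of
  sums with integrals and limits.\<close>

lemma vertex_sum:
  assumes G: "G \<in> graph_hull G\<^sub>0"
  obtains "\<And>U g. U \<subseteq> verts G \<Longrightarrow> (\<Sum>\<^sub>\<infinity>v\<in>U. \<psi> v * g v) = 0"
  | v where "v \<in> verts G" "0 < \<psi> v"
    "\<And>U g. U \<subseteq> verts G \<Longrightarrow> (\<Sum>\<^sub>\<infinity>v\<in>U. \<psi> v * g v) = (if v \<in> U then \<psi> v * g v else 0)"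
proof (cases "\<exists>v\<in>verts G. \<psi> v \<noteq> 0")
  case False
  then show ?thesis by (intro that(1) infsum_0) auto
next
  case True
  then obtain v where v: "v \<in> verts G" "\<psi> v \<noteq> 0" by blast
  have "norm u < r" if "\<psi> u \<noteq> 0" for u
    using \<psi>(3)[of u] that by (cases "norm u < r") auto
  then have zero: "\<psi> w = 0" if "w \<in> verts G" "w \<noteq> v" for w
    using hull_discrete[OF G v(1) that(1)] v(2) that(2) by blast
  show ?thesis
  proof (rule that(2)[OF v(1)])
    show "0 < \<psi> v" using v(2) \<psi>(2)[of v] by simp
    fix U g assume "U \<subseteq> verts G"
    then have "(\<Sum>\<^sub>\<infinity>w\<in>U. \<psi> w * g w) = (\<Sum>\<^sub>\<infinity>w\<in>U \<inter> {v}. \<psi> w * g w)"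
      using zero by (intro infsum_cong_neutral) auto
    then show "(\<Sum>\<^sub>\<infinity>w\<in>U. \<psi> w * g w) = (if v \<in> U then \<psi> v * g v else 0)" by auto
  qed
qed

text \<open>The integrand over the hull after averaging over the configurations. A general
  \<open>f\<close> in place of the indicator of \<open>{..E}\<close> is what the passage from
  moments requires.\<close>

definition J :: "(real \<Rightarrow> real) \<Rightarrow> 'a graph \<Rightarrow> real" where
  "J f G = (\<Sum>\<^sub>\<infinity>v\<in>verts G. \<psi> v * mean_spectral p D f G v)"

lemma J_linear:
  assumes G: "G \<in> graph_hull G\<^sub>0" and fg: "bounded_borel 0 (2 * real D) f" "bounded_borel 0 (2 * real D) g"
  shows "J (\<lambda>x. c * f x + d * g x) G = c * J f G + d * J g G"
proof -
  interpret bounded_graph G D by (rule hull_bounded[OF G])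
  show ?thesis unfolding J_def
    by (rule vertex_sum[OF G]) (simp_all add: mean_spectral_linear[OF p _ fg] distrib_left mult.left_commute)
qed

lemma J_limit:
  assumes G: "G \<in> graph_hull G\<^sub>0"
    and *: "\<And>n. bounded_borel 0 (2 * real D) (f n)" "bounded_borel 0 (2 * real D) g"
    "\<And>n x. x \<in> {0..2 * real D} \<Longrightarrow> \<bar>f n x\<bar> \<le> K" "\<And>x. x \<in> {0..2 * real D} \<Longrightarrow> (\<lambda>n. f n x) \<longlonglongrightarrow> g x"
  shows "(\<lambda>n. J (f n) G) \<longlonglongrightarrow> J g G"
proof -
  interpret bounded_graph G D by (rule hull_bounded[OF G])
  show ?thesis unfolding J_def
    by (rule vertex_sum[OF G]) (auto intro!: tendsto_intros mean_spectral_limit[OF p _ *])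
qed

lemma mean_spectral_nonneg:
  assumes "bounded_graph G D" "v \<in> verts G" "\<And>x. 0 \<le> x \<Longrightarrow> 0 \<le> f x"
  shows "0 \<le> mean_spectral p D f G v"
proof -
  interpret bounded_graph G D by fact
  have "0 \<le> (\<integral>x. f x \<partial>spectral D (open_subgraph G \<omega>) v)" for \<omega>
  proof (rule integral_nonneg_AE)
    have "AE x in spectral D (open_subgraph G \<omega>) v. x \<in> {0..2 * real D}"
      using interval_spectral[OF assms(2), of \<omega>] by (simp add: interval_measure_on_def)
    then show "AE x in spectral D (open_subgraph G \<omega>) v. 0 \<le> f x" by eventually_elim (use assms(3) in auto)
  qed
  then show ?thesis unfolding mean_spectral_def by (rule Bochner_Integration.integral_nonneg)
qed

text \<open>Semicontinuity suffices for measurability, and the one-sided estimate is easier because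
  all terms of the sum are nonnegative.\<close>

lemma J_power_semicontinuous:
  assumes G: "G \<in> graph_hull G\<^sub>0" and G': "G' \<in> graph_hull G\<^sub>0"
    and \<epsilon>: "\<epsilon> \<in> agreement_radii G G'" "r + \<epsilon> + real (Suc k) * L \<le> 1 / \<epsilon>"
    and \<eta>: "\<And>x y. dist x y < 2 * \<epsilon> \<Longrightarrow> \<bar>\<psi> x - \<psi> y\<bar> \<le> \<eta>"
  shows "J (\<lambda>x. x ^ k) G \<le> J (\<lambda>x. x ^ k) G' + \<eta> * (2 * real D) ^ k"
proof -
  interpret A: bounded_graph G D by (rule hull_bounded[OF G])
  interpret B: bounded_graph G' D by (rule hull_bounded[OF G'])
  let ?h = "mean_spectral p D (\<lambda>x. x ^ k)"
  have bound: "?h G v \<le> (2 * real D) ^ k" if "v \<in> verts G" for v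
  proof (rule abs_le_D1, rule A.mean_spectral_bound[OF p that])
    show "\<bar>x ^ k\<bar> \<le> (2 * real D) ^ k" if "x \<in> {0..2 * real D}" for x
      unfolding power_abs by (rule power_mono) (use that in auto)
  qed simp
  have nonneg: "0 \<le> J (\<lambda>x. x ^ k) G'"
    unfolding J_def by (intro infsum_nonneg mult_nonneg_nonneg \<psi> mean_spectral_nonneg[OF hull_bounded[OF G']]) auto
  have \<eta>0: "0 \<le> \<eta>" using \<eta>[of 0 0] agreement_radii_pos[OF \<epsilon>(1)] by simp
  obtain x y where xy: "\<epsilon> > 0" "norm x < \<epsilon>" "norm y < \<epsilon>"
      "induced (translate x G) (ball 0 (1 / \<epsilon>)) = induced (translate y G') (ball 0 (1 / \<epsilon>))"
    using \<epsilon>(1) by (rule agreement_radiiE)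
  show ?thesis
  proof (rule vertex_sum[OF G])
    assume "\<And>U g. U \<subseteq> verts G \<Longrightarrow> (\<Sum>\<^sub>\<infinity>v\<in>U. \<psi> v * g v) = 0"
    then have "J (\<lambda>x. x ^ k) G = 0" by (simp add: J_def)
    then show ?thesis using nonneg \<eta>0 by simp
  next
    fix v assume v: "v \<in> verts G" "0 < \<psi> v"
      and sum: "\<And>U g. U \<subseteq> verts G \<Longrightarrow> (\<Sum>\<^sub>\<infinity>v\<in>U. \<psi> v * g v) = (if v \<in> U then \<psi> v * g v else 0)"
    \<comment> \<open>The vertex of \<open>G'\<close> that corresponds to \<open>v\<close>:
      \<open>x + v = y + v'\<close>.\<close>
    define v' where "v' = x + v - y"
    define \<rho> where "\<rho> = real (Suc k) * L"
    have nv: "norm v < r" using \<psi>(3)[of v] v(2) by (cases "norm v < r") auto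
    have "ball (x + v) \<rho> \<subseteq> ball 0 (1 / \<epsilon>)"
    proof
      fix w assume "w \<in> ball (x + v) \<rho>"
      then have "norm (w - (x + v)) < \<rho>" by (simp add: dist_norm norm_minus_commute)
      then have "norm w < \<rho> + norm (x + v)" using norm_triangle_ineq2[of w "x + v"] by linarith
      also have "\<dots> < 1 / \<epsilon>" using norm_triangle_ineq[of x v] xy(2) nv \<epsilon>(2) by (simp add: \<rho>_def)
      finally show "w \<in> ball 0 (1 / \<epsilon>)" by simp
    qed
    then have patch: "induced (translate x G) (ball (x + v) \<rho>) = induced (translate y G') (ball (y + v') \<rho>)"
      using arg_cong[OF xy(4), of "\<lambda>H. induced H (ball (x + v) \<rho>)"] by (simp add: induced_induced v'_def)
    have "\<rho> > 0" using L(1) by (simp add: \<rho>_def)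
    then have "x + v \<in> verts (induced (translate x G) (ball (x + v) \<rho>))" using v by (simp add: induced_def verts_translate)
    then have "y + v' \<in> verts (translate y G')" unfolding patch by (simp add: induced_def v'_def)
    then have v': "v' \<in> verts G'" by (auto simp: verts_translate)
    have short: "dist a b < L" if "H \<in> graph_hull G\<^sub>0" "(a, b) \<in> adj (translate z H)" for H a b z
      using hull_short[OF that(1), of "a - z" "b - z"] that(2) by (simp add: adj_translate dist_norm)
    have "?h G v = ?h (translate x G) (x + v)"
      by (rule mean_spectral_translate[OF A.bounded_graph_axioms p v(1), symmetric])
    also have "\<dots> = ?h (induced (translate x G) (ball (x + v) \<rho>)) (x + v)"
      by (rule mean_spectral_local[symmetric, OF bounded_graph_translate[OF A.bounded_graph_axioms] p _ L(1) short[OF G]])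
         (use v in \<open>auto simp: verts_translate \<rho>_def\<close>)
    also have "\<dots> = ?h (induced (translate y G') (ball (y + v') \<rho>)) (y + v')"
      unfolding patch by (simp add: v'_def)
    also have "\<dots> = ?h (translate y G') (y + v')"
      by (rule mean_spectral_local[OF bounded_graph_translate[OF B.bounded_graph_axioms] p _ L(1) short[OF G']])
         (use v' in \<open>auto simp: verts_translate \<rho>_def\<close>)
    also have "\<dots> = ?h G' v'" by (rule mean_spectral_translate[OF B.bounded_graph_axioms p v'])
    finally have h: "?h G v = ?h G' v'" .
    have h0: "0 \<le> ?h G v" by (rule mean_spectral_nonneg[OF A.bounded_graph_axioms v(1)]) simp
    have "dist v v' < 2 * \<epsilon>" using norm_triangle_ineq4[of y x] xy(2,3) by (simp add: v'_def dist_norm)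
    then have "\<psi> v \<le> \<psi> v' + \<eta>" using \<eta> by fastforce
    then have "\<psi> v * ?h G v \<le> (\<psi> v' + \<eta>) * ?h G v" using h0 by (rule mult_right_mono)
    also have "\<dots> \<le> \<psi> v' * ?h G' v' + \<eta> * (2 * real D) ^ k"
      using mult_left_mono[OF bound[OF v(1)] \<eta>0] by (simp add: h distrib_right)
    finally have "\<psi> v * ?h G v \<le> \<psi> v' * ?h G' v' + \<eta> * (2 * real D) ^ k" .
    \<comment> \<open>If \<open>\<psi> v'\<close> is nonzero, then \<open>v'\<close> must be the one
      vertex of \<open>G'\<close> that \<open>vertex_sum\<close> singles out.\<close>
    moreover have "\<psi> v' * ?h G' v' \<le> J (\<lambda>x. x ^ k) G'"
    proof (cases "\<psi> v' = 0")
      case False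
      show ?thesis
      proof (rule vertex_sum[OF G'])
        assume s: "\<And>U g. U \<subseteq> verts G' \<Longrightarrow> (\<Sum>\<^sub>\<infinity>v\<in>U. \<psi> v * g v) = 0"
        have "(\<Sum>\<^sub>\<infinity>v\<in>{v'}. \<psi> v * 1) = 0" using v' by (intro s) simp
        then show ?thesis using False by simp
      next
        fix u assume s: "\<And>U g. U \<subseteq> verts G' \<Longrightarrow> (\<Sum>\<^sub>\<infinity>v\<in>U. \<psi> v * g v) = (if u \<in> U then \<psi> u * g u else 0)"
          and u: "u \<in> verts G'"
        have "(\<Sum>\<^sub>\<infinity>v\<in>{v'}. \<psi> v * 1) = (if u \<in> {v'} then \<psi> u * 1 else 0)" using v' by (intro s) simp
        then have "u = v'" using False by (cases "u = v'") auto
        moreover have "J (\<lambda>x. x ^ k) G' = \<psi> u * ?h G' u"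
          unfolding J_def by (subst s[OF subset_refl]) (simp add: u)
        ultimately show ?thesis by simp
      qed
    qed (simp add: nonneg)
    moreover have "J (\<lambda>x. x ^ k) G = \<psi> v * ?h G v"
      unfolding J_def by (subst sum[OF subset_refl]) (simp add: v)
    ultimately show ?thesis by simp
  qed
qed

text \<open>Lower semicontinuity: the sets where \<open>J\<close> exceeds a given \<open>a\<close>
  are relatively open in the hull.\<close>

lemma J_power_measurable: "J (\<lambda>x. x ^ k) \<in> borel_measurable \<mu>"
  unfolding borel_measurable_iff_greater
proof
  fix a :: real
  interpret Metric_space locally_finite_graphs graph_dist by (rule Metric_space_graph_dist)
  let ?X = "subtopology graph_topology (graph_hull G\<^sub>0)"
  define U where "U = {G \<in> space \<mu>. a < J (\<lambda>x. x ^ k) G}"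
  have "openin ?X U"
  proof (subst openin_subopen, intro ballI)
    fix G assume "G \<in> U"
    then have G: "G \<in> graph_hull G\<^sub>0" and aG: "a < J (\<lambda>x. x ^ k) G" by (auto simp: U_def space_\<mu>)
    define m where "m = (2 * real D) ^ k"
    \<comment> \<open>With this choice the loss \<open>\<eta> * m\<close> is half of the margin by
      which \<open>J\<close> exceeds \<open>a\<close>.\<close>
    define \<eta> where "\<eta> = (J (\<lambda>x. x ^ k) G - a) / (2 * m)"
    have Dk: "m > 0" using bounded_graph.D_pos[OF bounded] by (simp add: m_def)
    have \<eta>: "\<eta> > 0" using aG Dk by (simp add: \<eta>_def)
    then obtain \<delta> where \<delta>: "\<delta> > 0" "\<And>x y. dist x y < \<delta> \<Longrightarrow> \<bar>\<psi> x - \<psi> y\<bar> < \<eta>" using \<psi>_uniform by metis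
    define Q where "Q = r + 1 + real (Suc k) * L"
    have r: "r > 0" using discrete by (simp add: uniformly_discrete_def)
    have Q: "Q > 1" using r L(1) by (simp add: Q_def add_pos_pos)
    \<comment> \<open>The three bounds serve, in this order, the cutoff of the metric, the uniform
      continuity of \<open>\<psi>\<close>, and the size of the patch on which the two graphs
      agree.\<close>
    define c where "c = min (2 powr (- 1/2)) (min (\<delta> / 2) (1 / Q))"
    have c: "c > 0" using \<delta> Q by (simp add: c_def)
    have "J (\<lambda>x. x ^ k) G' > a" if G': "G' \<in> graph_hull G\<^sub>0" and d: "graph_dist G G' < c" for G'
    proof -
      obtain \<epsilon> where \<epsilon>: "\<epsilon> \<in> agreement_radii G G'" "\<epsilon> < c"
        using d by (rule graph_dist_less_obtain) (simp_all add: c_def)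
      note \<epsilon>0 = agreement_radii_pos[OF \<epsilon>(1)]
      have "\<epsilon> < 1 / Q" using \<epsilon> by (simp add: c_def)
      then have "Q < 1 / \<epsilon>" using \<epsilon>0 Q by (simp add: field_simps)
      moreover have "1 / Q < 1" using Q by simp
      ultimately have rad: "r + \<epsilon> + real (Suc k) * L \<le> 1 / \<epsilon>" using \<open>\<epsilon> < 1 / Q\<close> by (simp add: Q_def)
      have "J (\<lambda>x. x ^ k) G \<le> J (\<lambda>x. x ^ k) G' + \<eta> * m"
        unfolding m_def
      proof (rule J_power_semicontinuous[OF G G' \<epsilon>(1) rad])
        fix x y :: 'a assume "dist x y < 2 * \<epsilon>"
        then have "dist x y < \<delta>" using \<epsilon>(2) by (simp add: c_def)
        then show "\<bar>\<psi> x - \<psi> y\<bar> \<le> \<eta>" using \<delta>(2) less_imp_le by blast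
      qed
      moreover have "\<eta> * m = (J (\<lambda>x. x ^ k) G - a) / 2" using Dk by (simp add: \<eta>_def)
      moreover have "a < u'" if "u \<le> u' + e" "e = (u - a) / 2" "a < u" for u u' e :: real
        using that by (simp add: field_simps)
      ultimately show ?thesis using aG by blast
    qed
    moreover have "openin ?X (mball G c \<inter> graph_hull G\<^sub>0)"
      unfolding graph_topology_def by (intro openin_subtopology_Int openin_mball)
    ultimately show "\<exists>T. openin ?X T \<and> G \<in> T \<and> T \<subseteq> U"
      using G c graph_hull_locally_finite[OF G]
      by (intro exI[of _ "mball G c \<inter> graph_hull G\<^sub>0"]) (auto simp: U_def space_\<mu>)
  qed
  moreover have "{W. openin ?X W} \<subseteq> Pow (graph_hull G\<^sub>0)"
    using openin_subset[of ?X] by (auto simp: topspace_subtopology)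
  ultimately have "U \<in> sets (hull_borel G\<^sub>0)"
    unfolding hull_borel_def by (simp add: sets_measure_of sigma_sets.Basic)
  then show "{G \<in> space \<mu>. a < J (\<lambda>x. x ^ k) G} \<in> sets \<mu>" by (simp add: sets_\<mu> U_def)
qed

lemma J_measurable: assumes f: "bounded_borel 0 (2 * real D) f" shows "J f \<in> borel_measurable \<mu>"
proof -
  interpret mc: monotone_class 0 "2 * real D" "\<lambda>f. J f \<in> borel_measurable \<mu>"
  proof
    fix f g :: "real \<Rightarrow> real" and c d
    assume "bounded_borel 0 (2 * real D) f" "bounded_borel 0 (2 * real D) g"
      and m: "J f \<in> borel_measurable \<mu>" "J g \<in> borel_measurable \<mu>"
    then have "J (\<lambda>x. c * f x + d * g x) G = c * J f G + d * J g G" if "G \<in> space \<mu>" for G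
      using that J_linear by (simp add: space_\<mu>)
    then show "J (\<lambda>x. c * f x + d * g x) \<in> borel_measurable \<mu>"
      using m by (subst measurable_cong[of \<mu> _ "\<lambda>G. c * J f G + d * J g G"]) auto
  next
    fix f g K
    assume *: "\<And>n. bounded_borel 0 (2 * real D) (f n)" "\<And>n::nat. J (f n) \<in> borel_measurable \<mu>"
      "bounded_borel 0 (2 * real D) g" "\<And>n x. x \<in> {0..2 * real D} \<Longrightarrow> \<bar>f n x\<bar> \<le> K"
      "\<And>x. x \<in> {0..2 * real D} \<Longrightarrow> (\<lambda>n. f n x) \<longlonglongrightarrow> g x"
    show "J g \<in> borel_measurable \<mu>"
      by (rule borel_measurable_LIMSEQ_real[OF J_limit[OF _ *(1,3,4,5)] *(2)]) (simp add: space_\<mu>)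
  qed
  show ?thesis by (rule mc.from_monomials[OF J_power_measurable f])
qed

lemma J_bound:
  assumes G: "G \<in> graph_hull G\<^sub>0" and K: "\<And>x. \<psi> x \<le> K"
    and b: "\<And>v. v \<in> verts G \<Longrightarrow> \<bar>mean_spectral p D f G v\<bar> \<le> b" and b0: "0 \<le> b"
  shows "\<bar>J f G\<bar> \<le> K * b"
proof (rule vertex_sum[OF G])
  have "0 \<le> K" using K[of 0] \<psi>(2)[of 0] by simp
  assume "\<And>U g. U \<subseteq> verts G \<Longrightarrow> (\<Sum>\<^sub>\<infinity>v\<in>U. \<psi> v * g v) = 0"
  then have "J f G = 0" by (simp add: J_def)
  then show ?thesis using b0 \<open>0 \<le> K\<close> by simp
next
  fix v assume v: "v \<in> verts G"
    and s: "\<And>U g. U \<subseteq> verts G \<Longrightarrow> (\<Sum>\<^sub>\<infinity>v\<in>U. \<psi> v * g v) = (if v \<in> U then \<psi> v * g v else 0)"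
  have "J f G = \<psi> v * mean_spectral p D f G v" using s[of "verts G"] v by (simp add: J_def)
  moreover have "\<psi> v * \<bar>mean_spectral p D f G v\<bar> \<le> K * b" using K \<psi>(2) b[OF v] b0 by (intro mult_mono) (auto intro: order_trans)
  ultimately show ?thesis using \<psi>(2)[of v] by (simp add: abs_mult)
qed

lemma J_integrable: assumes f: "bounded_borel 0 (2 * real D) f" shows "integrable \<mu> (J f)"
proof -
  interpret prob_space \<mu> by (rule prob)
  obtain K where K: "\<And>x. \<psi> x \<le> K" using \<psi>_bounded by metis
  obtain b where b: "\<And>x. x \<in> {0..2 * real D} \<Longrightarrow> \<bar>f x\<bar> \<le> b" using bounded_borelE[OF f] by metis
  then have b0: "0 \<le> b" using abs_ge_zero order_trans by (metis atLeastAtMost_iff mult_nonneg_nonneg of_nat_0_le_iff order_refl zero_le_numeral)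
  have "\<bar>J f G\<bar> \<le> K * b" if "G \<in> space \<mu>" for G
  proof -
    have G: "G \<in> graph_hull G\<^sub>0" using that by (simp add: space_\<mu>)
    show ?thesis
      using bounded_graph.mean_spectral_bound[OF hull_bounded[OF G] p _ bounded_borel_measurable[OF f] b]
      by (intro J_bound[OF G K _ b0])
  qed
  then show ?thesis by (intro integrable_const_bound[of _ "K * b"] J_measurable[OF f]) auto
qed

text \<open>For each configuration the chosen operator is replaced by the spectral measure, and
  \<open>vertex_sum\<close> moves the sum over the vertices out of the integral over the
  configurations.\<close>

lemma integrated_density_of_states_eq:
  "integrated_density_of_states \<psi> \<mu> p E = (\<integral>G. J (indicator {..E}) G \<partial>\<mu>)"
  unfolding integrated_density_of_states_def
proof (rule Bochner_Integration.integral_cong[OF refl])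
  fix G assume "G \<in> space \<mu>"
  then have G: "G \<in> graph_hull G\<^sub>0" by (simp add: space_\<mu>)
  interpret bounded_graph G D by (rule hull_bounded[OF G])
  define n where "n \<omega> v = Re (l2_inner (verts G) (delta v) (functional_calculus (verts G)
     (laplacian (open_subgraph G \<omega>)) (\<lambda>x. heaviside (E - x)) (delta v)))" for \<omega> v
  have n: "n \<omega> v = (\<integral>x. indicator {..E} x \<partial>spectral D (open_subgraph G \<omega>) v)" if v: "v \<in> verts G" for \<omega> v
  proof -
    interpret H: bounded_graph "open_subgraph G \<omega>" D by (rule bounded_graph_open_subgraph)
    have d: "delta v \<in> l2 (verts (open_subgraph G \<omega>))" using v by (simp add: delta_l2)
    have "sets (spectral D (open_subgraph G \<omega>) v) = sets borel"
      using interval_spectral[OF v, of \<omega>] by (simp add: interval_measure_on_def)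
    then have "space (spectral D (open_subgraph G \<omega>) v) = UNIV" by (auto dest: sets_eq_imp_space_eq)
    then show ?thesis
      using H.functional_calculus_heaviside[OF d H.is_moment_measure_\<mu>[OF d], of E]
      by (simp add: n_def spectral_def)
  qed
  have "(\<integral>\<omega>. (\<Sum>\<^sub>\<infinity>v\<in>verts G. \<psi> v * n \<omega> v) \<partial>percolation p G) = J (indicator {..E}) G"
    unfolding J_def mean_spectral_def by (rule vertex_sum[OF G]) (simp_all add: n)
  then show "(\<integral>\<omega>. (\<Sum>\<^sub>\<infinity>v\<in>verts G. \<psi> v * Re (l2_inner (verts G) (delta v) (functional_calculus (verts G)
     (laplacian (open_subgraph G \<omega>)) (\<lambda>x. heaviside (E - x)) (delta v)))) \<partial>percolation p G) = J (indicator {..E}) G"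
    by (simp add: n_def)
qed

lemma integrated_density_of_states_diff:
  assumes "E > 0"
  shows "integrated_density_of_states \<psi> \<mu> p E - integrated_density_of_states \<psi> \<mu> p 0 =
    (\<integral>G. J (indicator {0<..E}) G \<partial>\<mu>)"
proof -
  have bb: "bounded_borel 0 (2 * real D) (indicator {..E'})" for E' :: real by (rule bounded_borel_indicator) simp
  have ind: "indicator {0<..E} = (\<lambda>x. 1 * indicator {..E} x + (- 1) * indicator {..0} x :: real)"
    using assms by (auto simp: indicator_def)
  have "(\<integral>G. J (indicator {0<..E}) G \<partial>\<mu>) = (\<integral>G. J (indicator {..E}) G - J (indicator {..0}) G \<partial>\<mu>)"
  proof (rule Bochner_Integration.integral_cong[OF refl])
    fix G assume "G \<in> space \<mu>"
    then show "J (indicator {0<..E}) G = J (indicator {..E}) G - J (indicator {..0}) G"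
      unfolding ind using J_linear[OF _ bb bb, of G 1 E "- 1" 0] by (simp add: space_\<mu>)
  qed
  then show ?thesis using J_integrable[OF bb] by (simp add: integrated_density_of_states_eq)
qed

text \<open>Outside the tail event the cluster of the vertex is so small that its spectral measure
  has no mass on \<open>{0<..E}\<close>; on the event the mass is at most 1.\<close>

lemma upper_bound:
  assumes \<alpha>: "1 \<le> \<alpha>" and z: "1 < z" and super: "(1 - p) + p * z * \<alpha> ^ (D - 1) \<le> \<alpha>"
    and K: "\<And>x. \<psi> x \<le> K" and n: "n > 0" "2 * (real n)\<^sup>2 * E < 1"
  shows "(\<integral>G. J (indicator {0<..E}) G \<partial>\<mu>) \<le> K * (z * \<alpha> ^ D / z ^ Suc n)"
proof -
  interpret prob_space \<mu> by (rule prob)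
  let ?b = "z * \<alpha> ^ D / z ^ Suc n"
  have bb: "bounded_borel 0 (2 * real D) (indicator {0<..E})" by (rule bounded_borel_indicator) simp
  have "J (indicator {0<..E}) G \<le> K * ?b" if "G \<in> space \<mu>" for G
  proof -
    have G: "G \<in> graph_hull G\<^sub>0" using that by (simp add: space_\<mu>)
    interpret G: bounded_graph G D by (rule hull_bounded[OF G])
    have "\<bar>mean_spectral p D (indicator {0<..E}) G v\<bar> \<le> ?b" if v: "v \<in> verts G" for v
    proof -
      interpret P: prob_space "percolation p G" by (rule prob_space_percolation[OF p])
      obtain A where A: "A \<in> P.events" "P.prob A \<le> ?b"
        "\<And>\<omega>. \<omega> \<in> space (percolation p G) - A \<Longrightarrow>
          finite (cluster (open_subgraph G \<omega>) v) \<and> card (cluster (open_subgraph G \<omega>) v) < Suc n"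
        \<comment> \<open>Fewer than \<open>Suc n\<close> vertices means at most \<open>n\<close>,
          as \<open>measure_gap\<close> demands.\<close>
        using G.cluster_tail[OF p \<alpha> z super, of "Suc n" v] by blast
      have le: "(\<integral>x. indicator {0<..E} x \<partial>spectral D (open_subgraph G \<omega>) v) \<le> (indicator A \<omega> :: real)"
        if \<omega>: "\<omega> \<in> space (percolation p G)" for \<omega>
      proof (cases "\<omega> \<in> A")
        case True
        have "(\<integral>x. indicator {0<..E} x \<partial>spectral D (open_subgraph G \<omega>) v) \<le> (1::real)"
          using G.integral_spectral_bound[OF v, of "indicator {0<..E}" 1 \<omega>] by (auto simp: indicator_def)
        then show ?thesis using True by simp
      next
        case False
        interpret H: bounded_graph "open_subgraph G \<omega>" D by (rule G.bounded_graph_open_subgraph)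
        have "measure (spectral D (open_subgraph G \<omega>) v) {0<..E} = 0"
          unfolding spectral_def using A(3)[of \<omega>] \<omega> False v n by (intro H.measure_gap[of v n]) auto
        moreover have "space (spectral D (open_subgraph G \<omega>) v) = UNIV"
          using G.interval_spectral[OF v, of \<omega>] sets_eq_imp_space_eq[of "spectral D (open_subgraph G \<omega>) v" borel]
          by (simp add: interval_measure_on_def)
        ultimately show ?thesis by simp
      qed
      have "integrable (percolation p G) (indicator A :: _ \<Rightarrow> real)"
        using A(1) P.emeasure_finite by (intro integrable_real_indicator) (auto simp: less_top[symmetric])
      then have "mean_spectral p D (indicator {0<..E}) G v \<le> (\<integral>\<omega>. indicator A \<omega> \<partial>percolation p G)"
        unfolding mean_spectral_def by (rule integral_mono[OF G.integrable_spectral[OF p v bb]]) (rule le)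
      also have "\<dots> = P.prob A" using A(1) sets.sets_into_space by (auto simp: Int_absorb1)
      finally show ?thesis
        using A(2) mean_spectral_nonneg[OF G.bounded_graph_axioms v, of "indicator {0<..E}"] by simp
    qed
    then have "\<bar>J (indicator {0<..E}) G\<bar> \<le> K * ?b" using z \<alpha> by (intro J_bound[OF G K]) auto
    then show ?thesis by simp
  qed
  then have "(\<integral>G. J (indicator {0<..E}) G \<partial>\<mu>) \<le> (\<integral>G. K * ?b \<partial>\<mu>)"
    by (intro integral_mono J_integrable[OF bb]) auto
  then show ?thesis by (simp add: prob_space)
qed

text \<open>Only the vertices in infinite components of \<open>G\<close> are kept; a path event
  exists for each of them, and integrating its uniform bound over the hull produces the density as a
  factor.\<close>

lemma lower_bound:
  assumes dens: "infinite_cluster_density \<psi> \<mu> > 0" and n: "n \<ge> 2" and E: "pi\<^sup>2 / (real n)\<^sup>2 \<le> E"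
  shows "infinite_cluster_density \<psi> \<mu> * ((p * (1 - p) ^ D) ^ n / (2 * real n)) \<le> (\<integral>G. J (indicator {0<..E}) G \<partial>\<mu>)"
proof -
  let ?q = "(p * (1 - p) ^ D) ^ n / (2 * real n)"
  let ?d = "\<lambda>F. \<Sum>\<^sub>\<infinity>v\<in>infinite_cluster_verts F. \<psi> v"
  have bb: "bounded_borel 0 (2 * real D) (indicator {0<..E})" by (rule bounded_borel_indicator) simp
  \<comment> \<open>A function that is not integrable has integral 0 by convention, so positivity of
    the density yields integrability.\<close>
  have int: "integrable \<mu> ?d"
    using dens not_integrable_integral_eq unfolding infinite_cluster_density_def by fastforce
  have "?d G * ?q \<le> J (indicator {0<..E}) G" if "G \<in> space \<mu>" for G
  proof -
    have G: "G \<in> graph_hull G\<^sub>0" using that by (simp add: space_\<mu>)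
    interpret G: bounded_graph G D by (rule hull_bounded[OF G])
    have inf: "infinite_cluster_verts G = {v \<in> verts G. infinite (cluster G v)}"
      by (simp add: infinite_cluster_verts_def cluster_def adj_def)
    have low: "?q \<le> mean_spectral p D (indicator {0<..E}) G v" if v: "v \<in> infinite_cluster_verts G" for v
    proof -
      have v: "v \<in> verts G" "infinite (cluster G v)" using v by (auto simp: inf)
      interpret P: prob_space "percolation p G" by (rule prob_space_percolation[OF p])
      obtain A where A: "A \<in> P.events" "(p * (1 - p) ^ D) ^ n \<le> P.prob A"
        "\<And>\<omega>. \<omega> \<in> A \<Longrightarrow> 1 / (2 * real n) \<le> measure (spectral D (open_subgraph G \<omega>) v) {0<..E}"
        using G.path_event[OF p v n E] by blast
      have le: "indicator A \<omega> * (1 / (2 * real n)) \<le> (\<integral>x. indicator {0<..E} x \<partial>spectral D (open_subgraph G \<omega>) v)" for \<omega>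
      proof -
        have "space (spectral D (open_subgraph G \<omega>) v) = UNIV"
          using G.interval_spectral[OF v(1), of \<omega>] sets_eq_imp_space_eq[of "spectral D (open_subgraph G \<omega>) v" borel]
          by (simp add: interval_measure_on_def)
        then show ?thesis using A(3)[of \<omega>] by (simp add: indicator_def[of A])
      qed
      have "?q \<le> P.prob A * (1 / (2 * real n))" using divide_right_mono[OF A(2), of "2 * real n"] by simp
      also have "\<dots> = (\<integral>\<omega>. indicator A \<omega> * (1 / (2 * real n)) \<partial>percolation p G)"
        using A(1) sets.sets_into_space by (auto simp: Int_absorb1)
      also have "\<dots> \<le> mean_spectral p D (indicator {0<..E}) G v"
        unfolding mean_spectral_def
      proof (rule integral_mono[OF integrable_mult_left G.integrable_spectral[OF p v(1) bb]])
        show "integrable (percolation p G) (indicator A :: _ \<Rightarrow> real)"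
          using A(1) P.emeasure_finite by (intro integrable_real_indicator) (auto simp: less_top[symmetric])
      qed (rule le)
      finally show ?thesis .
    qed
    have nonneg: "0 \<le> J (indicator {0<..E}) G"
      unfolding J_def by (intro infsum_nonneg mult_nonneg_nonneg \<psi> mean_spectral_nonneg[OF G.bounded_graph_axioms]) auto
    have sub: "infinite_cluster_verts G \<subseteq> verts G" by (auto simp: inf)
    show ?thesis
    proof (rule vertex_sum[OF G])
      assume s: "\<And>U g. U \<subseteq> verts G \<Longrightarrow> (\<Sum>\<^sub>\<infinity>v\<in>U. \<psi> v * g v) = 0"
      show ?thesis using s[OF sub, of "\<lambda>_. 1"] nonneg by simp
    next
      fix v assume v: "v \<in> verts G"
        and s: "\<And>U g. U \<subseteq> verts G \<Longrightarrow> (\<Sum>\<^sub>\<infinity>v\<in>U. \<psi> v * g v) = (if v \<in> U then \<psi> v * g v else 0)"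
      have 1: "?d G = (if v \<in> infinite_cluster_verts G then \<psi> v else 0)" using s[OF sub, of "\<lambda>_. 1"] by simp
      have 2: "J (indicator {0<..E}) G = \<psi> v * mean_spectral p D (indicator {0<..E}) G v"
        using s[of "verts G"] v by (simp add: J_def)
      show ?thesis
      proof (cases "v \<in> infinite_cluster_verts G")
        case True
        then have "?d G * ?q = \<psi> v * ?q" using 1 by simp
        also have "\<dots> \<le> \<psi> v * mean_spectral p D (indicator {0<..E}) G v"
          using low[OF True] \<psi>(2) by (rule mult_left_mono)
        finally show ?thesis using 2 by simp
      qed (use 1 nonneg in simp)
    qed
  qed
  then have "(\<integral>G. ?d G * ?q \<partial>\<mu>) \<le> (\<integral>G. J (indicator {0<..E}) G \<partial>\<mu>)"
    using int by (intro integral_mono J_integrable[OF bb]) auto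
  then show ?thesis by (simp add: infinite_cluster_density_def)
qed

end

subsection \<open>Lifshits asymptotics\<close>

text \<open>Suitable \<open>n\<close> of order \<open>1 / sqrt E\<close> show that
  \<open>- ln (F E)\<close> lies between two affine functions of \<open>1 / sqrt E\<close> with
  positive slopes. Its logarithm is therefore \<open>- 1/2 * ln E\<close> up to a bounded
  error.\<close>

lemma lifshits_exponent:
  fixes F :: "real \<Rightarrow> real"
  assumes z: "1 < z" and K: "0 < K" and q: "0 < q" "q < 1" and \<rho>: "0 < \<rho>"
    and upper: "\<And>E n. 0 < E \<Longrightarrow> 0 < n \<Longrightarrow> 2 * (real n)\<^sup>2 * E < 1 \<Longrightarrow> F E \<le> K / z ^ Suc n"
    and lower: "\<And>E n. 0 < E \<Longrightarrow> 2 \<le> n \<Longrightarrow> pi\<^sup>2 / (real n)\<^sup>2 \<le> E \<Longrightarrow> \<rho> * (q ^ n / (2 * real n)) \<le> F E"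
  shows "((\<lambda>E. ln \<bar>ln (F E)\<bar> / ln E) \<longlongrightarrow> - 1/2) (at_right 0)"
proof -
  define a b where "a = ln z / 2" and "b = ln K"
  \<comment> \<open>The 2 pays for replacing the factor \<open>1 / n\<close> by
    \<open>1 / 2 ^ n\<close> in the lower bound.\<close>
  define c where "c = ln (2 / q)"
  \<comment> \<open>The term \<open>3 * c\<close> stems from the rounding
    \<open>n \<le> pi / sqrt E + 3\<close>.\<close>
  define a' b' where "a' = c * pi" and "b' = 3 * c - ln (\<rho> / 2)"
  have a: "a > 0" using z by (simp add: a_def)
  have c: "c > 0" unfolding c_def using q by (intro ln_gt_zero) simp
  then have a': "a' > 0" by (simp add: a'_def)
  have up: "F E \<le> exp (- (a / sqrt E - b))" if E: "0 < E" "E \<le> 1 / 4" for E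
  proof -
    \<comment> \<open>With this \<open>n\<close> the product \<open>2 * n^2 * E\<close> is at most
      1/2, while \<open>Suc n\<close> still exceeds \<open>1 / (2 * sqrt E)\<close>.\<close>
    define n where "n = nat \<lfloor>1 / (2 * sqrt E)\<rfloor>"
    have s: "0 < sqrt E" "sqrt E \<le> 1 / 2" using E real_sqrt_le_mono[of E "1 / 4"] by (auto simp: real_sqrt_divide)
    then have ge1: "1 \<le> 1 / (2 * sqrt E)" by (simp add: field_simps)
    have n: "real n \<le> 1 / (2 * sqrt E)" "1 / (2 * sqrt E) < real (Suc n)" "0 < n"
      using ge1 unfolding n_def by linarith+
    have "(real n)\<^sup>2 \<le> (1 / (2 * sqrt E))\<^sup>2" using n by (intro power_mono) auto
    also have "\<dots> = 1 / (4 * E)" using E by (simp add: power_divide power_mult_distrib)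
    finally have "2 * (real n)\<^sup>2 * E < 1" using E by (simp add: field_simps)
    then have "F E \<le> K / z ^ Suc n" using upper E n by blast
    also have "\<dots> = exp (b - real (Suc n) * ln z)"
      using z K by (simp only: exp_diff b_def exp_ln exp_of_nat_mult)
    also have "\<dots> \<le> exp (- (a / sqrt E - b))"
    proof -
      have "1 / (2 * sqrt E) * ln z \<le> real (Suc n) * ln z" using n z by (intro mult_right_mono) auto
      then show ?thesis by (simp add: a_def)
    qed
    finally show ?thesis .
  qed
  have low: "exp (- (a' / sqrt E + b')) \<le> F E" if E: "0 < E" for E
  proof -
    \<comment> \<open>The ceiling gives \<open>pi^2 / n^2 \<le> E\<close>, and the 2 ensures
      \<open>n \<ge> 2\<close>.\<close>
    define n where "n = nat \<lceil>pi / sqrt E\<rceil> + 2"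
    have s: "0 < sqrt E" using E by simp
    then have pos: "0 < pi / sqrt E" by simp
    have n: "pi / sqrt E \<le> real n" "real n \<le> pi / sqrt E + 3" "2 \<le> n"
      using pos unfolding n_def by linarith+
    have "pi \<le> real n * sqrt E" using n(1) s by (simp add: field_simps)
    then have "pi\<^sup>2 \<le> (real n * sqrt E)\<^sup>2" by (intro power_mono) auto
    then have "pi\<^sup>2 / (real n)\<^sup>2 \<le> E" using n(3) E by (simp add: power_mult_distrib field_simps)
    then have l: "\<rho> * (q ^ n / (2 * real n)) \<le> F E" using lower E n by blast
    have "real n \<le> 2 ^ n" using less_exp[of n] by (metis less_imp_le of_nat_le_iff of_nat_numeral of_nat_power)
    then have "q ^ n / (2 * 2 ^ n) \<le> q ^ n / (2 * real n)" using n q by (intro divide_left_mono) auto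
    then have "\<rho> * (q ^ n / (2 * 2 ^ n)) \<le> \<rho> * (q ^ n / (2 * real n))" using \<rho> by (intro mult_left_mono) auto
    also note l
    also have "\<rho> * (q ^ n / (2 * 2 ^ n)) = \<rho> / 2 / (2 / q) ^ n" by (simp add: power_divide)
    also have "\<dots> = exp (ln (\<rho> / 2) - real n * c)"
      using \<rho> q by (simp only: exp_diff c_def exp_of_nat_mult) (simp add: exp_ln)
    finally have "exp (ln (\<rho> / 2) - real n * c) \<le> F E" .
    moreover have "real n * c \<le> (pi / sqrt E + 3) * c" using n c by (intro mult_right_mono) auto
    then have "- (a' / sqrt E + b') \<le> ln (\<rho> / 2) - real n * c" by (simp add: a'_def b'_def algebra_simps)
    then have "exp (- (a' / sqrt E + b')) \<le> exp (ln (\<rho> / 2) - real n * c)" by simp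
    ultimately show ?thesis by linarith
  qed
  have bounds: "a / sqrt E - b \<le> - ln (F E) \<and> - ln (F E) \<le> a' / sqrt E + b'" if E: "0 < E" "E \<le> 1 / 4" for E
  proof -
    have F: "0 < F E" using low[OF E(1)] exp_gt_zero less_le_trans by blast
    have "ln (F E) \<le> ln (exp (- (a / sqrt E - b)))" using up[OF E] F by (subst ln_le_cancel_iff) auto
    moreover have "ln (exp (- (a' / sqrt E + b'))) \<le> ln (F E)" using low[OF E(1)] F by (subst ln_le_cancel_iff) auto
    ultimately show ?thesis by simp
  qed
  have large: "eventually (\<lambda>E. 1 < a / sqrt E - b) (at_right 0)" using a by real_asymp
  have small: "eventually (\<lambda>E::real. 0 < E \<and> E \<le> 1 / 4) (at_right 0)"
    by (intro eventually_at_right_less[THEN eventually_conj]) (auto simp: eventually_at_right[of 0 1] intro!: exI[of _ "1/4"])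
  show ?thesis
  proof (rule tendsto_sandwich)
    \<comment> \<open>Since \<open>ln E\<close> is negative, the upper bound for
      \<open>- ln (F E)\<close> provides the lower function of the sandwich.\<close>
    show "((\<lambda>E. ln (a' / sqrt E + b') / ln E) \<longlongrightarrow> - 1/2) (at_right 0)" using a' by real_asymp
    show "((\<lambda>E. ln (a / sqrt E - b) / ln E) \<longlongrightarrow> - 1/2) (at_right 0)" using a by real_asymp
    show "eventually (\<lambda>E. ln (a' / sqrt E + b') / ln E \<le> ln \<bar>ln (F E)\<bar> / ln E) (at_right 0)"
      using large small
    proof eventually_elim
      case (elim E)
      then have "\<bar>ln (F E)\<bar> = - ln (F E)" "1 < - ln (F E)" "- ln (F E) \<le> a' / sqrt E + b'" "ln E < 0"
        using bounds[of E] by auto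
      then show ?case by (simp add: divide_right_mono_neg)
    qed
    show "eventually (\<lambda>E. ln \<bar>ln (F E)\<bar> / ln E \<le> ln (a / sqrt E - b) / ln E) (at_right 0)"
      using large small
    proof eventually_elim
      case (elim E)
      then have "\<bar>ln (F E)\<bar> = - ln (F E)" "a / sqrt E - b \<le> - ln (F E)" "1 < a / sqrt E - b" "ln E < 0"
        using bounds[of E] by auto
      then show ?case by (simp add: divide_right_mono_neg)
    qed
  qed
qed

theorem theorem5p2:
  fixes G\<^sub>0 :: "'a::euclidean_space graph" and \<mu> :: "'a graph measure"
    and \<psi> :: "'a \<Rightarrow> real" and r p :: real
  assumes "simple_graph G\<^sub>0"
    and "finite_local_complexity G\<^sub>0"
    and "uniformly_discrete r (verts G\<^sub>0)"
    and "bounded_degrees G\<^sub>0"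
    and "bounded_edge_lengths G\<^sub>0"
    and "ergodic_measure G\<^sub>0 \<mu>"
    and "mollifier r \<psi>"
    and "infinite_cluster_density \<psi> \<mu> > 0"
    and "p \<in> {0..1}"
    and "p \<in> {0<..<1 / (real (max_degree G\<^sub>0) - 1)}"
  defines "N \<equiv> integrated_density_of_states \<psi> \<mu> p"
  shows "((\<lambda>E. ln \<bar>ln (N E - N 0)\<bar> / ln E) \<longlongrightarrow> - 1/2) (at_right 0)"
proof -
  define D where "D = max_degree G\<^sub>0"
  have p0: "0 < p" "p < 1 / (real D - 1)" using assms(10) by (auto simp: D_def)
  \<comment> \<open>For \<open>D = 1\<close> this quotient is 0 by convention and for
    \<open>D = 0\<close> it is negative, so in both cases no \<open>p\<close> would be left.\<close>
  then have "0 < 1 / (real D - 1)" by linarith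
  then have D: "2 \<le> D" by (simp add: zero_less_divide_iff)
  have sub: "p * (real D - 1) < 1" using p0(2) D by (simp add: field_simps)
  have "p * 1 \<le> p * (real D - 1)" using p0(1) D by (intro mult_left_mono) auto
  then have p1: "p < 1" using sub by simp
  obtain l where l: "\<And>u v. {u, v} \<in> edges G\<^sub>0 \<Longrightarrow> norm (u - v) \<le> l"
    using assms(5) unfolding bounded_edge_lengths_def bdd_above_def by blast
  have bg: "bounded_graph G\<^sub>0 D"
  proof
    fix v assume v: "v \<in> verts G\<^sub>0"
    show "finite (neighbours G\<^sub>0 v)" using assms(4) v by (simp add: bounded_degrees_def)
    show "card (neighbours G\<^sub>0 v) \<le> D"
      using assms(4) v unfolding D_def max_degree_def degree_def[symmetric] bounded_degrees_def
      by (intro cSUP_upper) auto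
  qed (use assms(1) D in auto)
  \<comment> \<open>\<open>l\<close> is some upper bound of the edge lengths and may be negative if
    there are no edges; \<open>\<bar>l\<bar> + 1\<close> is positive and makes the bound
    strict.\<close>
  interpret percolation_model G\<^sub>0 r "\<bar>l\<bar> + 1" D \<mu> \<psi> p
  proof (intro percolation_model.intro hull_model.intro percolation_model_axioms.intro)
    show "bounded_graph G\<^sub>0 D" by (rule bg)
    show "uniformly_discrete r (verts G\<^sub>0)" by (rule assms(3))
    show "mollifier r \<psi>" by (rule assms(7))
    show "prob_space \<mu>" "space \<mu> = graph_hull G\<^sub>0" "sets \<mu> = sets (hull_borel G\<^sub>0)"
      using assms(6) by (simp_all add: ergodic_measure_def)
    show "dist a b < \<bar>l\<bar> + 1" if "(a, b) \<in> adj G\<^sub>0" for a b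
      using l[of a b] that by (simp add: adj_def dist_norm)
  qed (use p0 p1 in auto)
  obtain \<alpha> z where w: "1 \<le> \<alpha>" "1 < z" "(1 - p) + p * z * \<alpha> ^ (D - 1) \<le> \<alpha>"
    using subcritical_weights[OF p0(1) sub] D by auto
  obtain K where K: "K > 0" "\<And>x. \<psi> x \<le> K" using \<psi>_bounded by metis
  show ?thesis
  proof (rule lifshits_exponent[where z = z and K = "K * (z * \<alpha> ^ D)" and q = "p * (1 - p) ^ D"
        and \<rho> = "infinite_cluster_density \<psi> \<mu>"])
    have "(1 - p) ^ D \<le> 1" using p0 p1 by (intro power_le_one) auto
    then have "p * (1 - p) ^ D \<le> p * 1" using p0 by (intro mult_left_mono) auto
    then show "p * (1 - p) ^ D < 1" using p1 by simp
    show "1 < z" by (rule w)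
    show "0 < infinite_cluster_density \<psi> \<mu>" by (rule assms(8))
    show "0 < p * (1 - p) ^ D" using p0(1) p1 by simp
    show "0 < K * (z * \<alpha> ^ D)" using w(1,2) K(1) by simp
    fix E :: real and n :: nat
    assume E: "0 < E"
    show "N E - N 0 \<le> K * (z * \<alpha> ^ D) / z ^ Suc n" if "0 < n" "2 * (real n)\<^sup>2 * E < 1"
      using upper_bound[OF w K(2) that]
      by (simp only: N_def integrated_density_of_states_diff[OF E] times_divide_eq_right)
    show "infinite_cluster_density \<psi> \<mu> * ((p * (1 - p) ^ D) ^ n / (2 * real n)) \<le> N E - N 0"
      if "2 \<le> n" "pi\<^sup>2 / (real n)\<^sup>2 \<le> E"
      using lower_bound[OF assms(8) that] integrated_density_of_states_diff[OF E] by (simp add: N_def)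
  qed
qed

end
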